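(* Let $\sigma_1,\dots,\sigma_m$ be single-qubit states. Then $$\Lambda\Big(\bigotimes_j\sigma_j\Big)=\Xi\Big(\bigotimes_j\sigma_j\Big)=\Lambda^+\Big(\bigotimes_j\sigma_j\Big)=\prod_j\Lambda^+(\sigma_j),$$ and furthermore $\bigotimes_j\sigma_j$ admits an equimagical decomposition.
   Context: $\mathrm{S}_n$ denotes the set of pure $n$-qubit stabilizer states (states $|\psi\rangle$ for which there is an abelian subgroup of the $n$-qubit Pauli group with $2^n$ elements all of which fix $|\psi\rangle$), and $\bar{\mathrm S}_n=\mathrm{conv}\{|\phi\rangle\langle\phi|:|\phi\rangle\in\mathrm S_n\}$ the mixed stabilizer states; all monotones below are taken with respect to the number of qubits of their argument. The stabilizer extent of a pure state is $\xi(\Psi)=\min\{\|c\|_1^2: |\Psi\rangle=\sum_j c_j|\phi_j\rangle,\ |\phi_j\rangle\in\mathrm S_n\}$. The mixed-state extent is $\Xi(\rho)=\min\{\sum_j p_j\xi(\Psi_j):\rho=\sum_jp_j|\Psi_j\rangle\langle\Psi_j|\}$ over convex decompositions into pure states; if the minimum is attained by a decomposition with all $\xi(\Psi_j)$ equal, $\rho$ admits an equimagical decomposition. The dyadic negativity is $\Lambda(\rho)=\min\{\|\alpha\|_1:\rho=\sum_j\alpha_j|L_j\rangle\langle R_j|,\ |L_j\rangle,|R_j\rangle\in\mathrm S_n,\ \alpha_j\in\mathbb C\}$. The generalized robustness is $\Lambda^+(\rho)=\min\{\lambda:\rho\le\lambda\sigma,\ \sigma\in\bar{\mathrm S}_n\}$.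 *)

theory Defs
  imports Complex_Main "Jordan_Normal_Form.Matrix"
begin

definition kron :: "complex mat \<Rightarrow> complex mat \<Rightarrow> complex mat" where
  "kron A B = mat (dim_row A * dim_row B) (dim_col A * dim_col B)
     (\<lambda>(i,j). A $$ (i div dim_row B, j div dim_col B) * B $$ (i mod dim_row B, j mod dim_col B))"

definition kron_list :: "complex mat list \<Rightarrow> complex mat" where
  "kron_list As = foldr kron As (1\<^sub>m 1)"

definition pauli_I :: "complex mat" where
  "pauli_I = mat 2 2 (\<lambda>(i,j). if i = j then 1 else 0)"
definition pauli_X :: "complex mat" where
  "pauli_X = mat 2 2 (\<lambda>(i,j). if i \<noteq> j then 1 else 0)"
definition pauli_Y :: "complex mat" where
  "pauli_Y = mat 2 2 (\<lambda>(i,j). if i = 0 \<and> j = 1 then - \<i> else if i = 1 \<and> j = 0 then \<i> else 0)"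
definition pauli_Z :: "complex mat" where
  "pauli_Z = mat 2 2 (\<lambda>(i,j). if i = j then (if i = 0 then 1 else -1) else 0)"

definition pauli_group :: "nat \<Rightarrow> complex mat set" where
  "pauli_group n = {(\<i> ^ k) \<cdot>\<^sub>m kron_list Ps | k Ps.
      length Ps = n \<and> set Ps \<subseteq> {pauli_I, pauli_X, pauli_Y, pauli_Z}}"

definition abelian_pauli_subgroup :: "nat \<Rightarrow> complex mat set \<Rightarrow> bool" where
  "abelian_pauli_subgroup n G \<longleftrightarrow>
     G \<subseteq> pauli_group n \<and> 1\<^sub>m (2^n) \<in> G \<and>
     (\<forall>g\<in>G. \<forall>h\<in>G. g * h \<in> G) \<and>
     (\<forall>g\<in>G. \<exists>h\<in>G. g * h = 1\<^sub>m (2^n)) \<and>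
     (\<forall>g\<in>G. \<forall>h\<in>G. g * h = h * g)"

definition unit_vec :: "nat \<Rightarrow> complex vec \<Rightarrow> bool" where
  "unit_vec n v \<longleftrightarrow> v \<in> carrier_vec (2^n) \<and> (\<Sum>i<2^n. (cmod (v $ i))\<^sup>2) = 1"

definition stab_states :: "nat \<Rightarrow> complex vec set" where
  "stab_states n = {\<psi>. unit_vec n \<psi> \<and>
     (\<exists>G. abelian_pauli_subgroup n G \<and> card G = 2^n \<and> (\<forall>g\<in>G. g *\<^sub>v \<psi> = \<psi>))}"

definition outer :: "complex vec \<Rightarrow> complex vec \<Rightarrow> complex mat" where
  "outer L R = mat (dim_vec L) (dim_vec R) (\<lambda>(i,j). L $ i * cnj (R $ j))"

definition msum :: "nat \<Rightarrow> nat \<Rightarrow> (nat \<Rightarrow> complex mat) \<Rightarrow> complex mat" where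
  "msum d N f = mat d d (\<lambda>(i,j). \<Sum>k<N. f k $$ (i,j))"
definition vsum :: "nat \<Rightarrow> nat \<Rightarrow> (nat \<Rightarrow> complex vec) \<Rightarrow> complex vec" where
  "vsum d N f = vec d (\<lambda>i. \<Sum>k<N. f k $ i)"

definition psd :: "nat \<Rightarrow> complex mat \<Rightarrow> bool" where
  "psd d A \<longleftrightarrow> A \<in> carrier_mat d d \<and>
     (\<forall>v\<in>carrier_vec d. let q = (\<Sum>i<d. \<Sum>j<d. cnj (v $ i) * A $$ (i,j) * v $ j)
                          in Im q = 0 \<and> Re q \<ge> 0)"

definition mtrace :: "complex mat \<Rightarrow> complex" where
  "mtrace A = (\<Sum>i<dim_row A. A $$ (i,i))"

definition density :: "nat \<Rightarrow> complex mat \<Rightarrow> bool" where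
  "density n \<rho> \<longleftrightarrow> psd (2^n) \<rho> \<and> mtrace \<rho> = 1"

definition mixed_stab_states :: "nat \<Rightarrow> complex mat set" where
  "mixed_stab_states n = {msum (2^n) N (\<lambda>k. complex_of_real (p k) \<cdot>\<^sub>m outer (\<phi> k) (\<phi> k)) | N p \<phi>.
      (\<forall>k<N. p k \<ge> 0 \<and> \<phi> k \<in> stab_states n) \<and> (\<Sum>k<N. p k) = 1}"

definition stab_extent :: "nat \<Rightarrow> complex vec \<Rightarrow> real" where
  "stab_extent n \<Psi> = Inf {(\<Sum>k<N. cmod (c k))\<^sup>2 | N c \<phi>.
      (\<forall>k<N. \<phi> k \<in> stab_states n) \<and> \<Psi> = vsum (2^n) N (\<lambda>k. c k \<cdot>\<^sub>v \<phi> k)}"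

definition pure_decomp :: "nat \<Rightarrow> complex mat \<Rightarrow> nat \<Rightarrow> (nat \<Rightarrow> real) \<Rightarrow> (nat \<Rightarrow> complex vec) \<Rightarrow> bool" where
  "pure_decomp n \<rho> N p \<Psi> \<longleftrightarrow>
     (\<forall>k<N. p k \<ge> 0 \<and> unit_vec n (\<Psi> k)) \<and> (\<Sum>k<N. p k) = 1 \<and>
     \<rho> = msum (2^n) N (\<lambda>k. complex_of_real (p k) \<cdot>\<^sub>m outer (\<Psi> k) (\<Psi> k))"

definition mixed_extent :: "nat \<Rightarrow> complex mat \<Rightarrow> real" where
  "mixed_extent n \<rho> = Inf {(\<Sum>k<N. p k * stab_extent n (\<Psi> k)) | N p \<Psi>. pure_decomp n \<rho> N p \<Psi>}"

definition equimagical :: "nat \<Rightarrow> complex mat \<Rightarrow> bool" where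
  "equimagical n \<rho> \<longleftrightarrow> (\<exists>N p \<Psi>. pure_decomp n \<rho> N p \<Psi> \<and>
      (\<Sum>k<N. p k * stab_extent n (\<Psi> k)) = mixed_extent n \<rho> \<and>
      (\<forall>k<N. \<forall>l<N. stab_extent n (\<Psi> k) = stab_extent n (\<Psi> l)))"

definition dyadic_negativity :: "nat \<Rightarrow> complex mat \<Rightarrow> real" where
  "dyadic_negativity n \<rho> = Inf {(\<Sum>k<N. cmod (\<alpha> k)) | N \<alpha> L R.
      (\<forall>k<N. L k \<in> stab_states n \<and> R k \<in> stab_states n) \<and>
      \<rho> = msum (2^n) N (\<lambda>k. \<alpha> k \<cdot>\<^sub>m outer (L k) (R k))}"

definition gen_robustness :: "nat \<Rightarrow> complex mat \<Rightarrow> real" where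
  "gen_robustness n \<rho> = Inf {t. \<exists>\<sigma>\<in>mixed_stab_states n.
      psd (2^n) (complex_of_real t \<cdot>\<^sub>m \<sigma> - \<rho>)}"

end

theory Submission
  imports "HOL-Analysis.Convex_Euclidean_Space" Defs
begin

text \<open>
  Upper bound. In the Bloch picture a qubit \<open>r\<close> has generalized robustness at most \<open>l\<close> iff it lies in
  \<open>l O + (l - 1) K\<close>, where \<open>O\<close> is the stabiliser octahedron and \<open>K\<close> the unit ball. Write
  \<open>r = l s + d\<close> with \<open>s = \<Sum> q\<^sub>k e\<^sub>k\<close> in \<open>O\<close> and \<open>|d| \<le> l - 1\<close>. Then \<open>r\<close> is a mixture of the points
  \<open>l e\<^sub>k + d\<close>, all of norm at least 1; pulling each of them towards \<open>r\<close> onto the sphere gives a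
  decomposition of \<open>r\<close> into pure states of the same level set, and a pure state of that level set has
  extent at most \<open>l\<close>. Tensor products of such decompositions bound all three monotones by the product
  of the \<open>l\<close>'s.

  Lower bound. Convex duality provides \<open>w\<close> with \<open>|w| \<le> 1\<close> and
  \<open>l (1 + \<parallel>w\<parallel>\<^sub>\<infinity>) \<le> 1 + w \<cdot> r\<close>, so that \<open>W = (I + w \<cdot> \<sigma>) / (1 + \<parallel>w\<parallel>\<^sub>\<infinity>)\<close> is a witness for \<open>l\<close>. Everything
  follows once the tensor product of such witnesses has expectation at most 1 in every stabiliser
  state. Writing the state as the average of its stabiliser group and peeling off the first qubit,
  either the group contains a Pauli operator acting on that qubit alone and the bound factorises, or
  measuring any Pauli operator \<open>P\<close> on it leads to a stabiliser group on the remaining qubits. In the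
  latter case the induction hypothesis for these groups says that the Bloch coefficients
  \<open>t, s\<^sub>X, s\<^sub>Y, s\<^sub>Z\<close> left on the first qubit satisfy \<open>0 \<le> t \<plusminus> s\<^sub>P \<le> 1\<close>, which suffices.
\<close>

unbundle no vec_syntax

section \<open>Kronecker products and sandwiched traces\<close>

text \<open>A witness \<open>W\<close> is always handled through a Hermitian square root
  \<open>B\<close>, as the trace of \<open>B * A * B\<close>. Positivity is then built in, and a
  bound on the norms of \<open>B L\<close> and \<open>B R\<close> for stabiliser vectors L, R bounds
  the value on the dyad of L and R; this lets one witness serve all three monotones. The root of I +
  w \<cdot> \<sigma> is explicit when |w| = 1, being a multiple of the operator itself, which is why
  duality is run over unit vectors together with w = 0. The obstacle is entanglement: a product
  witness cannot be tested factor by factor on stabiliser states of several qubits. What saves the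
  induction is numerical: all Pauli coefficients of the witness and of the rest are at most 1/2, and
  three products of such coefficients still fit below 1, with equality possible. The monotones
  themselves are never multiplied. Only certificates are: a witness and a decomposition with the
  same value \<open>l\<close>. That \<open>l\<close> is the generalized robustness of the qubit
  comes out at the end, from a product with one factor.\<close>

lemma sum_div_mod:
  fixes f :: "nat \<Rightarrow> nat \<Rightarrow> 'a::comm_monoid_add"
  shows "(\<Sum>k<m * n. f (k div n) (k mod n)) = (\<Sum>i<m. \<Sum>j<n. f i j)"
proof -
  have "(\<Sum>k<m * n. f (k div n) (k mod n)) = (\<Sum>i<m. \<Sum>k\<in>{i * n..<i * n + n}. f (k div n) (k mod n))"
    by (rule sum.nat_group[symmetric])
  also have "\<dots> = (\<Sum>i<m. \<Sum>j<n. f i j)"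
  proof (rule sum.cong[OF refl])
    fix i
    have "(\<Sum>k\<in>{i * n..<i * n + n}. f (k div n) (k mod n)) = (\<Sum>j\<in>{0..<n}. f ((j + i * n) div n) ((j + i * n) mod n))"
      using sum.shift_bounds_nat_ivl[of "\<lambda>k. f (k div n) (k mod n)" 0 "i * n" n] by (simp add: add.commute)
    then show "(\<Sum>k\<in>{i * n..<i * n + n}. f (k div n) (k mod n)) = (\<Sum>j<n. f i j)"
      by (simp add: atLeast0LessThan)
  qed
  finally show ?thesis .
qed

lemma less_mult_div_mod:
  assumes "i < m * n"
  shows "i div n < m" "i mod n < (n::nat)"
  using assms by (auto simp: less_mult_imp_div_less intro!: mod_less_divisor gr0I)

lemma sum_lessThan_2: "(\<Sum>i<2. f i) = f 0 + f (Suc 0)"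
  by (simp add: numeral_2_eq_2)

lemma all_less_2: "(\<forall>i<2. P i) \<longleftrightarrow> P 0 \<and> P (Suc 0)"
  by (auto simp: numeral_2_eq_2 less_Suc_eq)

lemma mult_mat_index_sum:
  assumes "A \<in> carrier_mat a b" "B \<in> carrier_mat b c" "i < a" "j < c"
  shows "(A * B) $$ (i, j) = (\<Sum>k<b. A $$ (i, k) * B $$ (k, j))"
  using assms by (auto simp: scalar_prod_def atLeast0LessThan intro!: sum.cong)

lemma mult_mat_vec_index_sum:
  assumes "A \<in> carrier_mat a b" "v \<in> carrier_vec b" "i < a"
  shows "(A *\<^sub>v v) $ i = (\<Sum>k<b. A $$ (i, k) * v $ k)"
  using assms by (auto simp: scalar_prod_def atLeast0LessThan intro!: sum.cong)

section \<open>Kronecker products of matrices and vectors\<close>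

definition kronv :: "complex vec \<Rightarrow> complex vec \<Rightarrow> complex vec" where
  "kronv x y = vec (dim_vec x * dim_vec y) (\<lambda>i. x $ (i div dim_vec y) * y $ (i mod dim_vec y))"

lemma kron_carrier [simp]:
  "A \<in> carrier_mat a b \<Longrightarrow> B \<in> carrier_mat c d \<Longrightarrow> kron A B \<in> carrier_mat (a * c) (b * d)"
  by (auto simp: kron_def)

lemma kronv_carrier [simp]:
  "x \<in> carrier_vec a \<Longrightarrow> y \<in> carrier_vec b \<Longrightarrow> kronv x y \<in> carrier_vec (a * b)"
  by (auto simp: kronv_def)

lemma kron_index:
  assumes "A \<in> carrier_mat a b" "B \<in> carrier_mat c d" "i < a * c" "j < b * d"
  shows "kron A B $$ (i, j) = A $$ (i div c, j div d) * B $$ (i mod c, j mod d)"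
  using assms by (auto simp: kron_def)

lemma kron_index_block:
  assumes "A \<in> carrier_mat a b" "B \<in> carrier_mat c d" "i < a" "j < b" "k < c" "l < d"
  shows "kron A B $$ (i * c + k, j * d + l) = A $$ (i, j) * B $$ (k, l)"
proof -
  have "i * c + k < a * c" "j * d + l < b * d"
    using assms mult_le_mono1[of "Suc i" a c] mult_le_mono1[of "Suc j" b d] by auto
  then show ?thesis using assms by (subst kron_index[OF assms(1,2)]) auto
qed

lemma kronv_index:
  assumes "x \<in> carrier_vec a" "y \<in> carrier_vec b" "i < a * b"
  shows "kronv x y $ i = x $ (i div b) * y $ (i mod b)"
  using assms by (auto simp: kronv_def)

lemma kron_mult:
  assumes "A \<in> carrier_mat a b" "C \<in> carrier_mat b c" "B \<in> carrier_mat a' b'" "D \<in> carrier_mat b' c'"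
  shows "kron A B * kron C D = kron (A * C) (B * D)"
proof (rule eq_matI)
  fix i j assume "i < dim_row (kron (A * C) (B * D))" "j < dim_col (kron (A * C) (B * D))"
  then have ij: "i < a * a'" "j < c * c'" using assms by (auto simp: kron_def)
  note d = less_mult_div_mod[OF ij(1)] less_mult_div_mod[OF ij(2)]
  have "(kron A B * kron C D) $$ (i, j) = (\<Sum>k<b * b'. kron A B $$ (i, k) * kron C D $$ (k, j))"
    by (rule mult_mat_index_sum[OF kron_carrier kron_carrier]) (use assms ij in auto)
  also have "\<dots> = (\<Sum>k<b * b'. A $$ (i div a', k div b') * B $$ (i mod a', k mod b')
      * (C $$ (k div b', j div c') * D $$ (k mod b', j mod c')))"
    using ij by (intro sum.cong) (auto simp: kron_index[OF assms(1,3)] kron_index[OF assms(2,4)])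
  also have "\<dots> = (\<Sum>k<b. \<Sum>l<b'. A $$ (i div a', k) * B $$ (i mod a', l)
      * (C $$ (k, j div c') * D $$ (l, j mod c')))"
    by (rule sum_div_mod)
  also have "\<dots> = (A * C) $$ (i div a', j div c') * (B * D) $$ (i mod a', j mod c')"
    by (simp add: mult_mat_index_sum[OF assms(1,2) d(1,3)] mult_mat_index_sum[OF assms(3,4) d(2,4)]
        sum_product mult_ac)
  also have "\<dots> = kron (A * C) (B * D) $$ (i, j)"
    by (rule kron_index[symmetric]) (use assms ij in auto)
  finally show "(kron A B * kron C D) $$ (i, j) = kron (A * C) (B * D) $$ (i, j)" .
qed (use assms in \<open>auto simp: kron_def\<close>)

lemma kron_mult_kronv:
  assumes "A \<in> carrier_mat a b" "B \<in> carrier_mat a' b'" "x \<in> carrier_vec b" "y \<in> carrier_vec b'"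
  shows "kron A B *\<^sub>v kronv x y = kronv (A *\<^sub>v x) (B *\<^sub>v y)"
proof (rule eq_vecI)
  fix i assume "i < dim_vec (kronv (A *\<^sub>v x) (B *\<^sub>v y))"
  then have i: "i < a * a'" using assms by (auto simp: kronv_def)
  note d = less_mult_div_mod[OF i]
  have "(kron A B *\<^sub>v kronv x y) $ i = (\<Sum>k<b * b'. kron A B $$ (i, k) * kronv x y $ k)"
    by (rule mult_mat_vec_index_sum[OF kron_carrier kronv_carrier]) (use assms i in auto)
  also have "\<dots> = (\<Sum>k<b * b'. A $$ (i div a', k div b') * B $$ (i mod a', k mod b')
      * (x $ (k div b') * y $ (k mod b')))"
    using i by (intro sum.cong) (auto simp: kron_index[OF assms(1,2)] kronv_index[OF assms(3,4)])
  also have "\<dots> = (\<Sum>k<b. \<Sum>l<b'. A $$ (i div a', k) * B $$ (i mod a', l) * (x $ k * y $ l))"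
    by (rule sum_div_mod)
  also have "\<dots> = (A *\<^sub>v x) $ (i div a') * (B *\<^sub>v y) $ (i mod a')"
    by (simp add: mult_mat_vec_index_sum[OF assms(1,3) d(1)] mult_mat_vec_index_sum[OF assms(2,4) d(2)]
        sum_product mult_ac)
  also have "\<dots> = kronv (A *\<^sub>v x) (B *\<^sub>v y) $ i"
    by (rule kronv_index[symmetric]) (use assms i in auto)
  finally show "(kron A B *\<^sub>v kronv x y) $ i = kronv (A *\<^sub>v x) (B *\<^sub>v y) $ i" .
qed (use assms in \<open>auto simp: kronv_def kron_def\<close>)

lemma kron_smult_left: "kron (c \<cdot>\<^sub>m A) B = c \<cdot>\<^sub>m kron A B"
  by (rule eq_matI) (auto simp: kron_def less_mult_div_mod)

lemma kron_smult_right: "kron A (c \<cdot>\<^sub>m B) = c \<cdot>\<^sub>m kron A B"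
  by (rule eq_matI) (auto simp: kron_def less_mult_div_mod)

lemma kron_one_right: "kron A (1\<^sub>m 1) = A"
  by (rule eq_matI) (auto simp: kron_def)

lemma kron_one_one: "kron (1\<^sub>m a) (1\<^sub>m b) = 1\<^sub>m (a * b)"
proof (rule eq_matI)
  fix i j assume "i < dim_row (1\<^sub>m (a * b) :: complex mat)" "j < dim_col (1\<^sub>m (a * b) :: complex mat)"
  then have ij: "i < a * b" "j < a * b" by auto
  note d = less_mult_div_mod[OF ij(1)] less_mult_div_mod[OF ij(2)]
  have "i = j \<longleftrightarrow> i div b = j div b \<and> i mod b = j mod b" by (metis div_mult_mod_eq)
  then show "kron (1\<^sub>m a) (1\<^sub>m b) $$ (i, j) = 1\<^sub>m (a * b) $$ (i, j)"
    using d ij by (auto simp: kron_def)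
qed (auto simp: kron_def)

lemma outer_carrier [simp]:
  "x \<in> carrier_vec a \<Longrightarrow> y \<in> carrier_vec b \<Longrightarrow> outer x y \<in> carrier_mat a b"
  by (auto simp: outer_def)

lemma outer_index:
  "x \<in> carrier_vec a \<Longrightarrow> y \<in> carrier_vec b \<Longrightarrow> i < a \<Longrightarrow> j < b \<Longrightarrow> outer x y $$ (i, j) = x $ i * cnj (y $ j)"
  by (auto simp: outer_def)

lemma outer_kronv: "outer (kronv x y) (kronv x' y') = kron (outer x x') (outer y y')"
proof (rule eq_matI)
  fix i j assume "i < dim_row (kron (outer x x') (outer y y'))" "j < dim_col (kron (outer x x') (outer y y'))"
  then have ij: "i < dim_vec x * dim_vec y" "j < dim_vec x' * dim_vec y'"
    by (auto simp: kron_def outer_def)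
  then show "outer (kronv x y) (kronv x' y') $$ (i, j) = kron (outer x x') (outer y y') $$ (i, j)"
    using less_mult_div_mod[OF ij(1)] less_mult_div_mod[OF ij(2)]
    by (simp add: kron_def kronv_def outer_def)
qed (auto simp: kron_def kronv_def outer_def)

lemma mtrace_kron:
  assumes "A \<in> carrier_mat a a" "B \<in> carrier_mat b b"
  shows "mtrace (kron A B) = mtrace A * mtrace B"
proof -
  have "mtrace (kron A B) = (\<Sum>i<a * b. A $$ (i div b, i div b) * B $$ (i mod b, i mod b))"
    using assms by (auto simp: mtrace_def kron_def intro!: sum.cong)
  also have "\<dots> = (\<Sum>i<a. \<Sum>j<b. A $$ (i, i) * B $$ (j, j))" by (rule sum_div_mod)
  finally show ?thesis using assms by (simp add: mtrace_def sum_product)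
qed

definition norm_sq :: "complex vec \<Rightarrow> real" where
  "norm_sq v = (\<Sum>i<dim_vec v. (cmod (v $ i))\<^sup>2)"

lemma unit_vec_norm_sq: "unit_vec n v \<longleftrightarrow> v \<in> carrier_vec (2 ^ n) \<and> norm_sq v = 1"
  by (auto simp: unit_vec_def norm_sq_def)

lemma norm_sq_kronv: "norm_sq (kronv x y) = norm_sq x * norm_sq y"
proof -
  have "norm_sq (kronv x y) = (\<Sum>i<dim_vec x * dim_vec y. (cmod (x $ (i div dim_vec y)))\<^sup>2 * (cmod (y $ (i mod dim_vec y)))\<^sup>2)"
    by (auto simp: norm_sq_def kronv_def norm_mult power_mult_distrib intro!: sum.cong)
  also have "\<dots> = (\<Sum>i<dim_vec x. \<Sum>j<dim_vec y. (cmod (x $ i))\<^sup>2 * (cmod (y $ j))\<^sup>2)"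
    by (rule sum_div_mod)
  finally show ?thesis by (simp add: norm_sq_def sum_product)
qed

lemma unit_vec_kronv: "unit_vec 1 x \<Longrightarrow> unit_vec n y \<Longrightarrow> unit_vec (Suc n) (kronv x y)"
  using kronv_carrier[of x 2 y "2 ^ n"] by (auto simp: unit_vec_norm_sq norm_sq_kronv)

text \<open>By cyclicity this is the trace of \<open>B * B\<close> against \<open>A\<close>. The
  symmetric form makes it a squared norm of \<open>B x\<close> when \<open>B\<close> is Hermitian
  and \<open>A\<close> is \<open>outer x x\<close>.\<close>

definition sandwich :: "complex mat \<Rightarrow> complex mat \<Rightarrow> complex" where
  "sandwich B A = mtrace (B * A * B)"

lemma sandwich_sum:
  assumes "B \<in> carrier_mat d d" "A \<in> carrier_mat d d"
  shows "sandwich B A = (\<Sum>i<d. \<Sum>j<d. \<Sum>k<d. B $$ (i, j) * A $$ (j, k) * B $$ (k, i))"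
proof -
  have BA: "B * A \<in> carrier_mat d d" using assms by auto
  have "sandwich B A = (\<Sum>i<d. \<Sum>k<d. \<Sum>j<d. B $$ (i, j) * A $$ (j, k) * B $$ (k, i))"
    unfolding sandwich_def mtrace_def using assms
    by (auto intro!: sum.cong
        simp: mult_mat_index_sum[OF BA assms(1)] mult_mat_index_sum[OF assms] sum_distrib_right
        simp del: assoc_mult_mat index_mult_mat(1))
  also have "\<dots> = (\<Sum>i<d. \<Sum>j<d. \<Sum>k<d. B $$ (i, j) * A $$ (j, k) * B $$ (k, i))"
    by (rule sum.cong[OF refl], rule sum.swap)
  finally show ?thesis .
qed

text \<open>The linear combination is assumed entrywise, so that one rule serves sums over a group,
  \<open>msum\<close>, scalar multiples and differences.\<close>

lemma sandwich_linear:
  assumes "B \<in> carrier_mat d d" "A \<in> carrier_mat d d" "\<And>k. k \<in> I \<Longrightarrow> F k \<in> carrier_mat d d"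
    "\<And>i j. i < d \<Longrightarrow> j < d \<Longrightarrow> A $$ (i, j) = (\<Sum>k\<in>I. c k * F k $$ (i, j))"
  shows "sandwich B A = (\<Sum>k\<in>I. c k * sandwich B (F k))"
proof -
  have "sandwich B A = (\<Sum>i<d. \<Sum>j<d. \<Sum>l<d. \<Sum>k\<in>I. c k * (B $$ (i, j) * F k $$ (j, l) * B $$ (l, i)))"
    using assms by (auto simp: sandwich_sum sum_distrib_left sum_distrib_right mult_ac intro!: sum.cong)
  also have "\<dots> = (\<Sum>k\<in>I. \<Sum>i<d. \<Sum>j<d. \<Sum>l<d. c k * (B $$ (i, j) * F k $$ (j, l) * B $$ (l, i)))"
    by (simp only: sum.swap[of _ I])
  also have "\<dots> = (\<Sum>k\<in>I. c k * sandwich B (F k))"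
    using assms by (simp add: sandwich_sum sum_distrib_left)
  finally show ?thesis .
qed

lemma sandwich_smult:
  assumes "B \<in> carrier_mat d d" "A \<in> carrier_mat d d"
  shows "sandwich B (c \<cdot>\<^sub>m A) = c * sandwich B A"
  using sandwich_linear[OF assms(1), of "c \<cdot>\<^sub>m A" "{()}" "\<lambda>_. A" "\<lambda>_. c"] assms by simp

lemma sandwich_kron:
  assumes "B \<in> carrier_mat a a" "A \<in> carrier_mat a a" "B' \<in> carrier_mat b b" "A' \<in> carrier_mat b b"
  shows "sandwich (kron B B') (kron A A') = sandwich B A * sandwich B' A'"
  unfolding sandwich_def using assms
  by (simp add: kron_mult[where a=a and b=a and c=a and a'=b and b'=b and c'=b] del: assoc_mult_mat)
    (rule mtrace_kron[where a=a and b=b]; simp)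

definition herm :: "nat \<Rightarrow> complex mat \<Rightarrow> bool" where
  "herm d A \<longleftrightarrow> A \<in> carrier_mat d d \<and> (\<forall>i<d. \<forall>j<d. A $$ (j, i) = cnj (A $$ (i, j)))"

lemma herm_carrier [simp]: "herm d A \<Longrightarrow> A \<in> carrier_mat d d"
  by (simp add: herm_def)

lemma herm_cnj: "herm d A \<Longrightarrow> i < d \<Longrightarrow> j < d \<Longrightarrow> cnj (A $$ (i, j)) = A $$ (j, i)"
  unfolding herm_def by metis

lemma herm_kron:
  assumes "herm a A" "herm b B"
  shows "herm (a * b) (kron A B)"
  unfolding herm_def using assms
  by (simp add: kron_index[where a=a and b=a and c=b and d=b] less_mult_div_mod
      herm_cnj[OF assms(1)] herm_cnj[OF assms(2)])

lemma sandwich_outer: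
  assumes "herm d B" "x \<in> carrier_vec d" "y \<in> carrier_vec d"
  shows "sandwich B (outer x y) = (\<Sum>i<d. (B *\<^sub>v x) $ i * cnj ((B *\<^sub>v y) $ i))"
proof -
  have "(B *\<^sub>v x) $ i * cnj ((B *\<^sub>v y) $ i) = (\<Sum>j<d. \<Sum>k<d. B $$ (i, j) * outer x y $$ (j, k) * B $$ (k, i))"
    if "i < d" for i
  proof -
    have "(B *\<^sub>v y) $ i = (\<Sum>k<d. B $$ (i, k) * y $ k)" "(B *\<^sub>v x) $ i = (\<Sum>k<d. B $$ (i, k) * x $ k)"
      using assms that by (auto intro!: mult_mat_vec_index_sum[of _ d])
    moreover have "B $$ (k, i) = cnj (B $$ (i, k))" if "k < d" for k
      using herm_cnj[OF assms(1)] that \<open>i < d\<close> by simp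
    ultimately show ?thesis using assms
      by (auto simp: sum_product outer_index mult_ac intro!: sum.cong)
  qed
  then show ?thesis using assms by (subst sandwich_sum[of _ d]) auto
qed

lemma sandwich_outer_self:
  assumes "herm d B" "x \<in> carrier_vec d"
  shows "sandwich B (outer x x) = complex_of_real (norm_sq (B *\<^sub>v x))"
proof -
  have "dim_vec (B *\<^sub>v x) = d" using herm_carrier[OF assms(1)] by simp
  then show ?thesis
    unfolding sandwich_outer[OF assms assms(2)] norm_sq_def of_real_sum
    by (simp only: complex_norm_square)
qed

text \<open>The entrywise inequality a b \<le> (a^2 + b^2) / 2 is enough: since both squared norms
  are at most 1, so is their mean.\<close>

lemma cmod_sandwich_outer_le:
  assumes "herm d B" "x \<in> carrier_vec d" "y \<in> carrier_vec d" "norm_sq (B *\<^sub>v x) \<le> 1" "norm_sq (B *\<^sub>v y) \<le> 1"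
  shows "cmod (sandwich B (outer x y)) \<le> 1"
proof -
  have dd: "dim_vec (B *\<^sub>v v) = d" for v using herm_carrier[OF assms(1)] by simp
  have "cmod (sandwich B (outer x y)) \<le> (\<Sum>i<d. cmod ((B *\<^sub>v x) $ i) * cmod ((B *\<^sub>v y) $ i))"
    unfolding sandwich_outer[OF assms(1-3)] by (rule order_trans[OF norm_sum]) (auto simp: norm_mult)
  also have "\<dots> \<le> (\<Sum>i<d. ((cmod ((B *\<^sub>v x) $ i))\<^sup>2 + (cmod ((B *\<^sub>v y) $ i))\<^sup>2) / 2)"
  proof (rule sum_mono)
    show "cmod ((B *\<^sub>v x) $ i) * cmod ((B *\<^sub>v y) $ i) \<le> ((cmod ((B *\<^sub>v x) $ i))\<^sup>2 + (cmod ((B *\<^sub>v y) $ i))\<^sup>2) / 2" for i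
      using sum_squares_bound[of "cmod ((B *\<^sub>v x) $ i)" "cmod ((B *\<^sub>v y) $ i)"] by simp
  qed
  also have "\<dots> = (norm_sq (B *\<^sub>v x) + norm_sq (B *\<^sub>v y)) / 2"
    unfolding norm_sq_def dd sum_divide_distrib[symmetric] sum.distrib ..
  finally show ?thesis using assms by simp
qed

text \<open>The trace splits over the columns of \<open>B\<close>: each contributes the quadratic
  form of \<open>A\<close> at that column, because the rows of a Hermitian matrix are its conjugated
  columns.\<close>

lemma Re_sandwich_psd:
  assumes "herm d B" "psd d A"
  shows "0 \<le> Re (sandwich B A)"
proof -
  define Q where "Q v = (\<Sum>j<d. \<Sum>k<d. cnj (v $ j) * A $$ (j, k) * v $ k)" for v
  have A: "A \<in> carrier_mat d d" and Q: "0 \<le> Re (Q v)" if "v \<in> carrier_vec d" for v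
    using assms(2) that unfolding psd_def Let_def Q_def by blast+
  have "sandwich B A = (\<Sum>i<d. Q (vec d (\<lambda>k. B $$ (k, i))))"
    unfolding sandwich_sum[OF herm_carrier[OF assms(1)] A[OF zero_carrier_vec]] Q_def
    by (intro sum.cong refl) (simp add: herm_cnj[OF assms(1)])
  then show ?thesis using Q by (simp add: sum_nonneg)
qed

section \<open>The Pauli group\<close>

text \<open>\<open>t\<close> times the identity plus the combination of X, Y and Z with coefficients
  \<open>v\<close>. The state with Bloch vector \<open>r\<close> is therefore
  \<open>bloch (1 / 2) ((1 / 2) *\<^sub>R r)\<close>.\<close>

definition bloch :: "real \<Rightarrow> real \<times> real \<times> real \<Rightarrow> complex mat" where
  "bloch t v = (case v of (a, b, c) \<Rightarrow> mat 2 2 (\<lambda>(i, j).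
     if i = 0 then (if j = 0 then complex_of_real (t + c) else Complex a (- b))
     else (if j = 0 then Complex a b else complex_of_real (t - c))))"

lemma bloch_carrier [simp]: "bloch t v \<in> carrier_mat 2 2"
  by (auto simp: bloch_def split: prod.split)

lemma bloch_index [simp]:
  "bloch t (a, b, c) $$ (0, 0) = complex_of_real (t + c)" "bloch t (a, b, c) $$ (0, Suc 0) = Complex a (- b)"
  "bloch t (a, b, c) $$ (Suc 0, 0) = Complex a b" "bloch t (a, b, c) $$ (Suc 0, Suc 0) = complex_of_real (t - c)"
  by (auto simp: bloch_def)

lemma mat2_eqI:
  assumes "A \<in> carrier_mat 2 2" "B \<in> carrier_mat 2 2" "A $$ (0, 0) = B $$ (0, 0)" "A $$ (0, Suc 0) = B $$ (0, Suc 0)"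
    "A $$ (Suc 0, 0) = B $$ (Suc 0, 0)" "A $$ (Suc 0, Suc 0) = B $$ (Suc 0, Suc 0)"
  shows "A = B"
  using assms by (intro eq_matI) (auto simp: numeral_2_eq_2 less_Suc_eq)

lemma pauli_eq_bloch:
  "pauli_I = bloch 1 (0, 0, 0)" "pauli_X = bloch 0 (1, 0, 0)"
  "pauli_Y = bloch 0 (0, 1, 0)" "pauli_Z = bloch 0 (0, 0, 1)"
  by (rule mat2_eqI; simp add: pauli_I_def pauli_X_def pauli_Y_def pauli_Z_def complex_eq_iff)+

lemma bloch_eq_iff: "bloch t v = bloch t' w \<longleftrightarrow> t = t' \<and> v = w"
proof
  assume "bloch t v = bloch t' w"
  then have "bloch t v $$ (i, j) = bloch t' w $$ (i, j)" for i j by simp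
  from this[of 0 0] this[of 0 "Suc 0"] this[of "Suc 0" "Suc 0"] show "t = t' \<and> v = w"
    by (cases v; cases w) (auto simp: complex_eq_iff)
qed simp

lemma herm_bloch: "herm 2 (bloch t v)"
  by (cases v) (simp add: herm_def all_less_2 complex_eq_iff)

lemma mult_mat_2_index:
  assumes "A \<in> carrier_mat 2 2" "B \<in> carrier_mat 2 2" "i < 2" "j < 2"
  shows "(A * B) $$ (i, j) = A $$ (i, 0) * B $$ (0, j) + A $$ (i, Suc 0) * B $$ (Suc 0, j)"
  using mult_mat_index_sum[OF assms] by (simp add: sum_lessThan_2)

text \<open>Since distinct Paulis anticommute, the square of \<open>bloch x y\<close> has identity
  coefficient x^2 + |y|^2 and Pauli coefficients 2 x y; the trace against \<open>bloch t v\<close>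
  is twice the sum of products of matching coefficients.\<close>

lemma sandwich_bloch:
  "sandwich (bloch x (y1, y2, y3)) (bloch t (a, b, c))
    = complex_of_real (2 * t * (x\<^sup>2 + y1\<^sup>2 + y2\<^sup>2 + y3\<^sup>2) + 4 * x * (y1 * a + y2 * b + y3 * c))"
  by (subst sandwich_sum[of _ 2])
    (simp_all add: sum_lessThan_2 complex_eq_iff power2_eq_square algebra_simps)

definition paulis :: "complex mat set" where
  "paulis = {pauli_I, pauli_X, pauli_Y, pauli_Z}"

lemma pauli_in_paulis [simp]: "pauli_I \<in> paulis" "pauli_X \<in> paulis" "pauli_Y \<in> paulis" "pauli_Z \<in> paulis"
  by (auto simp: paulis_def)

lemma finite_paulis: "finite paulis"
  by (simp add: paulis_def)

lemma pauli_carrier [simp]: "P \<in> paulis \<Longrightarrow> P \<in> carrier_mat 2 2"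
  by (auto simp: paulis_def pauli_eq_bloch)

lemma pauli_I_eq_one: "pauli_I = 1\<^sub>m 2"
  by (auto simp: pauli_I_def intro!: eq_matI)

lemma herm_pauli: "P \<in> paulis \<Longrightarrow> herm 2 P"
  by (auto simp: paulis_def pauli_eq_bloch herm_bloch)

lemma pauli_square: "P \<in> paulis \<Longrightarrow> P * P = 1\<^sub>m 2"
  by (rule mat2_eqI)
    (auto simp: paulis_def pauli_eq_bloch mult_mat_2_index complex_eq_iff intro!: mult_carrier_mat[of _ 2 2])

text \<open>Distinct Pauli matrices are linearly independent. The scalars stand for entries of the
  second tensor factors when two Kronecker products are compared.\<close>

lemma pauli_proportional:
  assumes "P \<in> paulis" "Q \<in> paulis" "c \<noteq> 0" "\<And>i j. i < 2 \<Longrightarrow> j < 2 \<Longrightarrow> P $$ (i, j) * c = Q $$ (i, j) * d"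
  shows "P = Q"
  using assms(1-3) assms(4)[of 0 0] assms(4)[of 0 "Suc 0"] assms(4)[of "Suc 0" 0] assms(4)[of "Suc 0" "Suc 0"]
  by (auto simp: paulis_def pauli_eq_bloch complex_eq_iff)

lemma pauli_commuteD:
  assumes "P \<in> paulis" "Q \<in> paulis" "P * Q = Q * P"
  shows "P = pauli_I \<or> Q = pauli_I \<or> P = Q"
proof -
  have "(P * Q) $$ (0, 0) = (Q * P) $$ (0, 0)" "(P * Q) $$ (0, Suc 0) = (Q * P) $$ (0, Suc 0)"
    using assms(3) by auto
  then show ?thesis
    using assms(1,2) by (auto simp: paulis_def pauli_eq_bloch mult_mat_2_index complex_eq_iff simp del: index_mult_mat(1))
qed

lemma paulis_distinct:
  "pauli_I \<noteq> pauli_X" "pauli_I \<noteq> pauli_Y" "pauli_I \<noteq> pauli_Z"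
  "pauli_X \<noteq> pauli_Y" "pauli_X \<noteq> pauli_Z" "pauli_Y \<noteq> pauli_Z"
  by (simp_all add: pauli_eq_bloch bloch_eq_iff)

lemma kron_list_simps [simp]: "kron_list [] = 1\<^sub>m 1" "kron_list (A # As) = kron A (kron_list As)"
  by (simp_all add: kron_list_def)

lemma kron_list_carrier:
  "(\<And>A. A \<in> set As \<Longrightarrow> A \<in> carrier_mat 2 2) \<Longrightarrow> kron_list As \<in> carrier_mat (2 ^ length As) (2 ^ length As)"
  by (induction As) auto

lemma herm_kron_list: "(\<And>A. A \<in> set As \<Longrightarrow> herm 2 A) \<Longrightarrow> herm (2 ^ length As) (kron_list As)"
  by (induction As) (auto simp: herm_kron, simp add: herm_def)

lemma pauli_group_0: "pauli_group 0 = {(\<i> ^ k) \<cdot>\<^sub>m 1\<^sub>m 1 | k. True}"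
  by (auto simp: pauli_group_def)

lemma pauli_group_Suc: "pauli_group (Suc n) = {kron P g | P g. P \<in> paulis \<and> g \<in> pauli_group n}"
proof -
  have "\<exists>Q g. (\<i> ^ k) \<cdot>\<^sub>m kron_list Ps = kron Q g \<and> Q \<in> paulis \<and> g \<in> pauli_group n"
    if len: "length Ps = Suc n" and sub: "set Ps \<subseteq> paulis" for k Ps
  proof -
    obtain Q Qs where "Ps = Q # Qs" using len by (cases Ps) auto
    then show ?thesis
      using len sub by (intro exI[of _ Q] exI[of _ "(\<i> ^ k) \<cdot>\<^sub>m kron_list Qs"])
        (auto simp: kron_smult_right pauli_group_def paulis_def)
  qed
  moreover have "kron P ((\<i> ^ k) \<cdot>\<^sub>m kron_list Ps) \<in> pauli_group (Suc n)"
    if "P \<in> paulis" "length Ps = n" "set Ps \<subseteq> paulis" for P k Ps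
    unfolding pauli_group_def using that
    by (auto simp: paulis_def kron_smult_right intro!: exI[of _ k] exI[of _ "P # Ps"])
  ultimately show ?thesis
    unfolding pauli_group_def[of "Suc n"] paulis_def[symmetric]
    by (auto simp: pauli_group_def paulis_def[symmetric])
qed

lemma pauli_group_carrier: "g \<in> pauli_group n \<Longrightarrow> g \<in> carrier_mat (2 ^ n) (2 ^ n)"
  by (induction n arbitrary: g) (auto simp: pauli_group_0 pauli_group_Suc)

lemma i_power_cases: "\<i> ^ k \<in> {1, \<i>, -1, -\<i>}"
  by (induction k) auto

lemma finite_pauli_group: "finite (pauli_group n)"
proof (induction n)
  case 0
  have "pauli_group 0 \<subseteq> (\<lambda>c. c \<cdot>\<^sub>m 1\<^sub>m 1) ` {1, \<i>, -1, -\<i>}"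
    unfolding pauli_group_0 using i_power_cases by blast
  then show ?case by (rule finite_subset) simp
next
  case (Suc n)
  have "pauli_group (Suc n) = (\<lambda>(P, g). kron P g) ` (paulis \<times> pauli_group n)"
    by (auto simp: pauli_group_Suc)
  then show ?case using Suc finite_paulis by simp
qed

lemma pauli_group_smult_sign:
  assumes "g \<in> pauli_group n" "s = 1 \<or> s = -1"
  shows "s \<cdot>\<^sub>m g \<in> pauli_group n"
proof -
  from assms(1) obtain k Ps where g: "g = (\<i> ^ k) \<cdot>\<^sub>m kron_list Ps"
    "length Ps = n" "set Ps \<subseteq> {pauli_I, pauli_X, pauli_Y, pauli_Z}" by (auto simp: pauli_group_def)
  have "s \<cdot>\<^sub>m g = (\<i> ^ (if s = 1 then k else k + 2)) \<cdot>\<^sub>m kron_list Ps"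
    using assms(2) by (auto simp: g(1) power_add intro!: eq_matI)
  then show ?thesis using g unfolding pauli_group_def by blast
qed

text \<open>An element is a power of \<i> times a Hermitian involution, so one sign decides both
  whether it squares to the identity and whether it is Hermitian. Excluding the minus sign for
  squares thus yields Hermiticity as well.\<close>

lemma pauli_group_square:
  assumes "g \<in> pauli_group n"
  obtains s where "s = 1 \<or> s = (-1::complex)" "g * g = s \<cdot>\<^sub>m 1\<^sub>m (2 ^ n)"
    "\<And>i j. i < 2 ^ n \<Longrightarrow> j < 2 ^ n \<Longrightarrow> cnj (g $$ (i, j)) = s * g $$ (j, i)"
proof -
  have "\<exists>s. (s = 1 \<or> s = (-1::complex)) \<and> g * g = s \<cdot>\<^sub>m 1\<^sub>m (2 ^ n) \<and>
    (\<forall>i<2 ^ n. \<forall>j<2 ^ n. cnj (g $$ (i, j)) = s * g $$ (j, i))"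
    using assms
  proof (induction n arbitrary: g)
    case 0
    then obtain k where g: "g = (\<i> ^ k) \<cdot>\<^sub>m 1\<^sub>m 1" by (auto simp: pauli_group_0)
    have "g * g = (\<i> ^ k * \<i> ^ k) \<cdot>\<^sub>m 1\<^sub>m 1"
      by (rule eq_matI) (auto simp: g scalar_prod_def)
    moreover obtain c where "\<i> ^ k = c" by blast
    ultimately show ?case using i_power_cases[of k]
      by (intro exI[of _ "c * c"]) (auto simp: g simp del: complex_cnj_power)
  next
    case (Suc n)
    then obtain P h where g: "g = kron P h" "P \<in> paulis" "h \<in> pauli_group n" by (auto simp: pauli_group_Suc)
    from Suc.IH[OF g(3)] obtain s where s: "s = 1 \<or> s = (-1::complex)" "h * h = s \<cdot>\<^sub>m 1\<^sub>m (2 ^ n)"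
      "\<And>i j. i < 2 ^ n \<Longrightarrow> j < 2 ^ n \<Longrightarrow> cnj (h $$ (i, j)) = s * h $$ (j, i)" by blast
    note c = pauli_carrier[OF g(2)] pauli_group_carrier[OF g(3)]
    have "g * g = s \<cdot>\<^sub>m 1\<^sub>m (2 ^ Suc n)"
      using kron_mult[OF c(1) c(1) c(2) c(2)] by (simp add: g(1) pauli_square[OF g(2)] s(2) kron_smult_right kron_one_one)
    moreover have "cnj (g $$ (i, j)) = s * g $$ (j, i)" if "i < 2 ^ Suc n" "j < 2 ^ Suc n" for i j
    proof -
      have ij: "i < 2 * 2 ^ n" "j < 2 * 2 ^ n" using that by auto
      show ?thesis unfolding g(1) kron_index[OF c ij] kron_index[OF c ij(2) ij(1)]
        using less_mult_div_mod[OF ij(1)] less_mult_div_mod[OF ij(2)]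
        by (simp add: herm_cnj[OF herm_pauli[OF g(2)]] s(3))
    qed
    ultimately show ?case using s(1) by blast
  qed
  then show ?thesis using that by blast
qed

lemma pauli_group_nonzero:
  assumes "g \<in> pauli_group n"
  obtains i j where "i < 2 ^ n" "j < 2 ^ n" "g $$ (i, j) \<noteq> 0"
proof (rule ccontr)
  assume "\<not> thesis"
  with that have z: "g $$ (i, j) = 0" if "i < 2 ^ n" "j < 2 ^ n" for i j using \<open>i < 2 ^ n\<close> \<open>j < 2 ^ n\<close> by blast
  obtain s where s: "s = 1 \<or> s = (-1::complex)" "g * g = s \<cdot>\<^sub>m 1\<^sub>m (2 ^ n)"
    using pauli_group_square[OF assms] by metis
  have "(g * g) $$ (0, 0) = (\<Sum>k<2 ^ n. g $$ (0, k) * g $$ (k, 0))"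
    using pauli_group_carrier[OF assms] by (intro mult_mat_index_sum) auto
  also have "\<dots> = 0" using z by simp
  finally show False using s by auto
qed

lemma kron_pauli_right_cancel:
  assumes "P \<in> paulis" "A \<in> carrier_mat a b" "B \<in> carrier_mat a b" "kron P A = kron P B"
  shows "A = B"
proof -
  obtain j where j: "j < 2" "P $$ (0, j) \<noteq> 0"
    using assms(1) that[of 0] that[of "Suc 0"] by (auto simp: paulis_def pauli_eq_bloch complex_eq_iff)
  have "A $$ (k, l) = B $$ (k, l)" if "k < a" "l < b" for k l
    using kron_index_block[OF pauli_carrier[OF assms(1)] assms(2) _ j(1) that, of 0] j(2)
      kron_index_block[OF pauli_carrier[OF assms(1)] assms(3) _ j(1) that, of 0] assms(4) by simp
  then show ?thesis using assms(2,3) by (intro eq_matI) auto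
qed

text \<open>Comparing the blocks at a nonzero entry of \<open>g\<close> makes \<open>P\<close> and
  \<open>Q\<close> proportional, hence equal. Phases live in the second factor only, so splitting a
  Pauli operator into first qubit and rest is unique.\<close>

lemma kron_pauli_cancel:
  assumes "P \<in> paulis" "Q \<in> paulis" "g \<in> pauli_group n" "h \<in> carrier_mat (2 ^ n) (2 ^ n)" "kron P g = kron Q h"
  shows "P = Q" "g = h"
proof -
  note c = pauli_carrier[OF assms(1)] pauli_group_carrier[OF assms(3)] pauli_carrier[OF assms(2)] assms(4)
  obtain k l where kl: "k < 2 ^ n" "l < 2 ^ n" "g $$ (k, l) \<noteq> 0" using pauli_group_nonzero[OF assms(3)] .
  have "P $$ (i, j) * g $$ (k, l) = Q $$ (i, j) * h $$ (k, l)" if "i < 2" "j < 2" for i j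
    using kron_index_block[OF c(1,2) that kl(1,2)] kron_index_block[OF c(3,4) that kl(1,2)] assms(5) by simp
  then show "P = Q" using pauli_proportional[OF assms(1,2) kl(3)] by metis
  then show "g = h" using kron_pauli_right_cancel[OF assms(1) c(2,4)] assms(5) by simp
qed

lemma pauli_group_kronD:
  assumes "kron P A \<in> pauli_group (Suc n)" "P \<in> paulis" "A \<in> carrier_mat (2 ^ n) (2 ^ n)"
  shows "A \<in> pauli_group n"
proof -
  from assms(1) obtain Q g where "kron P A = kron Q g" "Q \<in> paulis" "g \<in> pauli_group n"
    by (auto simp: pauli_group_Suc)
  then show ?thesis using kron_pauli_cancel(2)[of Q P g n A] assms by simp
qed

section \<open>Stabiliser groups\<close>

text \<open>A stabiliser group of arbitrary order. The condition on scalars excludes minus the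
  identity without mentioning a fixed vector, so it can be checked for the groups on fewer qubits
  met in the induction. Every element turns out to be its own inverse.\<close>

definition good_group :: "nat \<Rightarrow> complex mat set \<Rightarrow> bool" where
  "good_group n G \<longleftrightarrow> G \<subseteq> pauli_group n \<and> 1\<^sub>m (2 ^ n) \<in> G \<and> (\<forall>g\<in>G. \<forall>h\<in>G. g * h \<in> G) \<and>
     (\<forall>g\<in>G. \<forall>h\<in>G. g * h = h * g) \<and> (\<forall>c. c \<cdot>\<^sub>m 1\<^sub>m (2 ^ n) \<in> G \<longrightarrow> c = 1)"

lemma good_groupD:
  assumes "good_group n G"
  shows "G \<subseteq> pauli_group n" "1\<^sub>m (2 ^ n) \<in> G" "g \<in> G \<Longrightarrow> h \<in> G \<Longrightarrow> g * h \<in> G"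
    "g \<in> G \<Longrightarrow> h \<in> G \<Longrightarrow> g * h = h * g" "c \<cdot>\<^sub>m 1\<^sub>m (2 ^ n) \<in> G \<Longrightarrow> c = 1"
    "g \<in> G \<Longrightarrow> g \<in> carrier_mat (2 ^ n) (2 ^ n)" "finite G"
proof -
  show G: "G \<subseteq> pauli_group n" using assms unfolding good_group_def by (elim conjE)
  show "1\<^sub>m (2 ^ n) \<in> G" using assms unfolding good_group_def by (elim conjE)
  show "g * h \<in> G" if "g \<in> G" "h \<in> G" using assms that unfolding good_group_def by blast
  show "g * h = h * g" if "g \<in> G" "h \<in> G" using assms that unfolding good_group_def by blast
  have "\<forall>c. c \<cdot>\<^sub>m 1\<^sub>m (2 ^ n) \<in> G \<longrightarrow> c = 1"
    using assms unfolding good_group_def by (elim conjE)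
  from spec[OF this, of c] show "c = 1" if "c \<cdot>\<^sub>m 1\<^sub>m (2 ^ n) \<in> G" using that by (rule mp)
  show "g \<in> carrier_mat (2 ^ n) (2 ^ n)" if "g \<in> G" using pauli_group_carrier[OF subsetD[OF G that]] .
  show "finite G" using G by (rule finite_subset[OF _ finite_pauli_group])
qed

lemma good_group_square:
  assumes "good_group n G" "g \<in> G"
  shows "g * g = 1\<^sub>m (2 ^ n)" "herm (2 ^ n) g"
proof -
  obtain s where s: "g * g = s \<cdot>\<^sub>m 1\<^sub>m (2 ^ n)"
    "\<And>i j. i < 2 ^ n \<Longrightarrow> j < 2 ^ n \<Longrightarrow> cnj (g $$ (i, j)) = s * g $$ (j, i)"
    using pauli_group_square[OF subsetD[OF good_groupD(1)[OF assms(1)] assms(2)]] by metis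
  \<comment> \<open>The square is a scalar matrix lying in \<open>G\<close>, and the only such
    scalar is 1.\<close>
  have "s = 1" using good_groupD(3)[OF assms(1) assms(2) assms(2)] good_groupD(5)[OF assms(1)] s(1) by simp
  then show "g * g = 1\<^sub>m (2 ^ n)" "herm (2 ^ n) g"
    using s good_groupD(6)[OF assms] by (auto simp: herm_def intro!: eq_matI)
qed

definition group_sum :: "nat \<Rightarrow> complex mat set \<Rightarrow> complex mat" where
  "group_sum n G = mat (2 ^ n) (2 ^ n) (\<lambda>(i, j). \<Sum>g\<in>G. g $$ (i, j))"

lemma group_sum_carrier [simp]: "group_sum n G \<in> carrier_mat (2 ^ n) (2 ^ n)"
  by (simp add: group_sum_def)

lemma group_sum_index: "i < 2 ^ n \<Longrightarrow> j < 2 ^ n \<Longrightarrow> group_sum n G $$ (i, j) = (\<Sum>g\<in>G. g $$ (i, j))"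
  by (simp add: group_sum_def)

lemma herm_group_sum:
  assumes "good_group n G"
  shows "herm (2 ^ n) (group_sum n G)"
  unfolding herm_def
  by (simp add: group_sum_index herm_cnj[OF good_group_square(2)[OF assms]] cong: sum.cong)

text \<open>Multiplication by \<open>g\<close> is an involution of \<open>G\<close>, so it only
  permutes the summands.\<close>

lemma mult_group_sum:
  assumes "good_group n G" "g \<in> G"
  shows "g * group_sum n G = group_sum n G"
proof (rule eq_matI)
  fix i j assume "i < dim_row (group_sum n G)" "j < dim_col (group_sum n G)"
  then have ij: "i < 2 ^ n" "j < 2 ^ n" by (auto simp: group_sum_def)
  note gc = good_groupD(6)[OF assms]
  have inv: "g * (g * h) = h" if "h \<in> G" for h
    using assoc_mult_mat[OF gc gc good_groupD(6)[OF assms(1) that]] good_group_square(1)[OF assms]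
      good_groupD(6)[OF assms(1) that] by simp
  have bij: "bij_betw (\<lambda>h. g * h) G G"
    by (rule bij_betwI[where g = "\<lambda>h. g * h"]) (use inv good_groupD(3)[OF assms] in auto)
  have "(g * group_sum n G) $$ (i, j) = (\<Sum>k<2 ^ n. \<Sum>h\<in>G. g $$ (i, k) * h $$ (k, j))"
    using mult_mat_index_sum[OF gc group_sum_carrier ij] ij
    by (simp add: group_sum_index sum_distrib_left)
  also have "\<dots> = (\<Sum>h\<in>G. \<Sum>k<2 ^ n. g $$ (i, k) * h $$ (k, j))" by (rule sum.swap)
  also have "\<dots> = (\<Sum>h\<in>G. (g * h) $$ (i, j))"
    by (intro sum.cong refl mult_mat_index_sum[symmetric, OF gc good_groupD(6)[OF assms(1)]] ij)
  also have "\<dots> = (\<Sum>h\<in>G. h $$ (i, j))"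
    using bij by (rule sum.reindex_bij_betw)
  finally show "(g * group_sum n G) $$ (i, j) = group_sum n G $$ (i, j)"
    by (simp only: group_sum_index[OF ij])
qed (use good_groupD(6)[OF assms] in \<open>auto simp: group_sum_def\<close>)

lemma group_sum_square:
  assumes "good_group n G"
  shows "group_sum n G * group_sum n G = of_nat (card G) \<cdot>\<^sub>m group_sum n G"
proof (rule eq_matI)
  fix i j assume "i < dim_row (of_nat (card G) \<cdot>\<^sub>m group_sum n G)" "j < dim_col (of_nat (card G) \<cdot>\<^sub>m group_sum n G)"
  then have ij: "i < 2 ^ n" "j < 2 ^ n" by (auto simp: group_sum_def)
  let ?S = "group_sum n G"
  have "(?S * ?S) $$ (i, j) = (\<Sum>k<2 ^ n. \<Sum>g\<in>G. g $$ (i, k) * ?S $$ (k, j))"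
    using mult_mat_index_sum[OF group_sum_carrier group_sum_carrier ij] ij
    by (simp add: group_sum_index sum_distrib_right)
  also have "\<dots> = (\<Sum>g\<in>G. \<Sum>k<2 ^ n. g $$ (i, k) * ?S $$ (k, j))" by (rule sum.swap)
  also have "\<dots> = (\<Sum>g\<in>G. (g * ?S) $$ (i, j))"
    by (intro sum.cong refl mult_mat_index_sum[symmetric, OF good_groupD(6)[OF assms] group_sum_carrier] ij)
  also have "\<dots> = of_nat (card G) * ?S $$ (i, j)"
    using mult_group_sum[OF assms] by simp
  finally show "(?S * ?S) $$ (i, j) = (of_nat (card G) \<cdot>\<^sub>m ?S) $$ (i, j)"
    using ij by (simp add: group_sum_def)
qed (auto simp: group_sum_def)

text \<open>For a good group this is the expectation of \<open>B * B\<close> in the normalised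
  projector onto the space fixed by \<open>G\<close>: whatever the order of \<open>G\<close>, that
  projector divided by its trace is the group sum over 2^n.\<close>

definition group_val :: "nat \<Rightarrow> complex mat set \<Rightarrow> complex mat \<Rightarrow> real" where
  "group_val n G B = Re (\<Sum>g\<in>G. sandwich B g) / 2 ^ n"

text \<open>The group sum S is Hermitian and its square is \<open>card G\<close> times itself, so
  the squared Frobenius norm of \<open>B * S\<close>, being the trace of B S S B, is
  \<open>card G\<close> times the trace of B S B.\<close>

lemma frobenius_group_sum:
  assumes "good_group n G" "herm (2 ^ n) B"
  shows "(\<Sum>i<2 ^ n. \<Sum>j<2 ^ n. (cmod ((B * group_sum n G) $$ (i, j)))\<^sup>2) = card G * (2 ^ n * group_val n G B)"
proof -
  define d :: nat where "d = 2 ^ n"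
  define S where "S = group_sum n G"
  have B: "herm d B" and S: "herm d S" and SS: "S * S = of_nat (card G) \<cdot>\<^sub>m S"
    using assms herm_group_sum group_sum_square by (auto simp: d_def S_def)
  note c = herm_carrier[OF B] herm_carrier[OF S]
  have "sandwich B (S * S) = mtrace ((B * S) * (S * B))"
    unfolding sandwich_def using c assoc_mult_mat[of B d d "S * S" d B d] assoc_mult_mat[of S d d S d B d]
      assoc_mult_mat[of B d d S d "S * B" d] by (simp del: assoc_mult_mat)
  also have "\<dots> = (\<Sum>i<d. \<Sum>j<d. (B * S) $$ (i, j) * (S * B) $$ (j, i))"
    unfolding mtrace_def using c mult_mat_index_sum[of "B * S" d d "S * B" d]
    by (auto intro!: sum.cong simp del: assoc_mult_mat index_mult_mat(1))
  also have "\<dots> = (\<Sum>i<d. \<Sum>j<d. complex_of_real ((cmod ((B * S) $$ (i, j)))\<^sup>2))"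
  proof (intro sum.cong refl)
    fix i j assume "i \<in> {..<d}" "j \<in> {..<d}"
    then have ij: "i < d" "j < d" by auto
    have "(S * B) $$ (j, i) = cnj ((B * S) $$ (i, j))"
      unfolding mult_mat_index_sum[OF c(2) c(1) ij(2,1)] mult_mat_index_sum[OF c ij] cnj_sum
      using ij by (intro sum.cong refl) (simp add: herm_cnj[OF B] herm_cnj[OF S])
    then show "(B * S) $$ (i, j) * (S * B) $$ (j, i) = complex_of_real ((cmod ((B * S) $$ (i, j)))\<^sup>2)"
      by (simp only: complex_norm_square)
  qed
  finally have *: "sandwich B (S * S) = complex_of_real (\<Sum>i<d. \<Sum>j<d. (cmod ((B * S) $$ (i, j)))\<^sup>2)"
    by simp
  have "sandwich B (S * S) = of_nat (card G) * sandwich B S"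
    unfolding SS by (rule sandwich_smult[OF c])
  also have "sandwich B S = (\<Sum>g\<in>G. 1 * sandwich B g)"
    by (rule sandwich_linear[OF c]) (use good_groupD(6)[OF assms(1)] in \<open>auto simp: S_def d_def group_sum_index\<close>)
  finally have "Re (complex_of_real (\<Sum>i<d. \<Sum>j<d. (cmod ((B * S) $$ (i, j)))\<^sup>2))
      = Re (of_nat (card G) * (\<Sum>g\<in>G. sandwich B g))"
    unfolding * by simp
  then show ?thesis by (simp add: group_val_def S_def d_def)
qed

lemma group_val_nonneg:
  assumes "good_group n G" "herm (2 ^ n) B"
  shows "0 \<le> group_val n G B"
proof -
  have "0 < card G" using good_groupD(2,7)[OF assms(1)] card_gt_0_iff by blast
  moreover have "0 \<le> card G * (2 ^ n * group_val n G B)"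
    unfolding frobenius_group_sum[OF assms, symmetric] by (intro sum_nonneg) auto
  ultimately have "0 \<le> 2 ^ n * group_val n G B" by (simp add: zero_le_mult_iff)
  then show ?thesis using mult_le_cancel_left_pos[of "2 ^ n" 0 "group_val n G B"] by simp
qed

text \<open>The group sum fixes \<open>\<phi>\<close> up to the factor \<open>card G\<close>, so Cauchy--Schwarz bounds
  the image of \<open>\<phi>\<close> by a Frobenius norm. This avoids identifying the projector onto \<open>\<phi>\<close>
  with the normalised group sum.\<close>

lemma norm_sq_le_group_val:
  assumes "good_group n G" "herm (2 ^ n) B" "unit_vec n \<phi>" "card G = 2 ^ n" "\<And>g. g \<in> G \<Longrightarrow> g *\<^sub>v \<phi> = \<phi>"
  shows "norm_sq (B *\<^sub>v \<phi>) \<le> group_val n G B"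
proof -
  define d :: nat where "d = 2 ^ n"
  define S where "S = group_sum n G"
  have \<phi>: "\<phi> \<in> carrier_vec d" "(\<Sum>i<d. (cmod (\<phi> $ i))\<^sup>2) = 1"
    using assms(3) by (auto simp: unit_vec_def d_def)
  have B: "B \<in> carrier_mat d d" and S: "S \<in> carrier_mat d d"
    using herm_carrier[OF assms(2)] by (auto simp: d_def S_def)
  have "S *\<^sub>v \<phi> = of_nat d \<cdot>\<^sub>v \<phi>"
  proof (rule eq_vecI)
    fix i assume "i < dim_vec (of_nat d \<cdot>\<^sub>v \<phi>)"
    then have i: "i < d" using \<phi> by simp
    have "(S *\<^sub>v \<phi>) $ i = (\<Sum>k<d. \<Sum>g\<in>G. g $$ (i, k) * \<phi> $ k)"
      using mult_mat_vec_index_sum[OF S \<phi>(1) i] i by (simp add: S_def d_def group_sum_index sum_distrib_right)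
    also have "\<dots> = (\<Sum>g\<in>G. \<Sum>k<d. g $$ (i, k) * \<phi> $ k)" by (rule sum.swap)
    also have "\<dots> = (\<Sum>g\<in>G. (g *\<^sub>v \<phi>) $ i)"
      using good_groupD(6)[OF assms(1)] i \<phi>(1)
      by (intro sum.cong refl mult_mat_vec_index_sum[symmetric]) (auto simp: d_def)
    also have "\<dots> = of_nat d * \<phi> $ i" using assms(4,5) by (simp add: d_def)
    finally show "(S *\<^sub>v \<phi>) $ i = (of_nat d \<cdot>\<^sub>v \<phi>) $ i" using i \<phi>(1) by simp
  qed (use S \<phi> in auto)
  then have "(B * S) *\<^sub>v \<phi> = of_nat d \<cdot>\<^sub>v (B *\<^sub>v \<phi>)"
    using B S \<phi>(1) mult_mat_vec[OF B \<phi>(1)] by simp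
  then have "of_nat d * (B *\<^sub>v \<phi>) $ i = (\<Sum>j<d. (B * S) $$ (i, j) * \<phi> $ j)" if "i < d" for i
    using mult_mat_vec_index_sum[of "B * S" d d \<phi> i] that B S \<phi>(1) by (metis carrier_matD(1) dim_mult_mat_vec index_smult_vec(1) mult_carrier_mat)
  then have "(real d * cmod ((B *\<^sub>v \<phi>) $ i))\<^sup>2 \<le> (\<Sum>j<d. (cmod ((B * S) $$ (i, j)))\<^sup>2)" if "i < d" for i
  proof -
    have "real d * cmod ((B *\<^sub>v \<phi>) $ i) = cmod (\<Sum>j<d. (B * S) $$ (i, j) * \<phi> $ j)"
      using \<open>\<And>i. i < d \<Longrightarrow> _\<close>[OF that] by (metis norm_mult norm_of_nat)
    also have "\<dots> \<le> (\<Sum>j<d. cmod ((B * S) $$ (i, j)) * cmod (\<phi> $ j))"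
      by (rule order_trans[OF norm_sum]) (simp add: norm_mult)
    finally have "(real d * cmod ((B *\<^sub>v \<phi>) $ i))\<^sup>2 \<le> (\<Sum>j<d. cmod ((B * S) $$ (i, j)) * cmod (\<phi> $ j))\<^sup>2"
      by (intro power_mono) auto
    also have "\<dots> \<le> (\<Sum>j<d. (cmod ((B * S) $$ (i, j)))\<^sup>2) * (\<Sum>j<d. (cmod (\<phi> $ j))\<^sup>2)"
      by (rule Cauchy_Schwarz_ineq_sum)
    finally show ?thesis using \<phi>(2) by simp
  qed
  then have "(\<Sum>i<d. (real d * cmod ((B *\<^sub>v \<phi>) $ i))\<^sup>2) \<le> (\<Sum>i<d. \<Sum>j<d. (cmod ((B * S) $$ (i, j)))\<^sup>2)"
    by (intro sum_mono) auto
  also have "\<dots> = real d * (real d * group_val n G B)"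
    using frobenius_group_sum[OF assms(1,2)] assms(4) by (simp add: S_def d_def)
  also have "(\<Sum>i<d. (real d * cmod ((B *\<^sub>v \<phi>) $ i))\<^sup>2) = real d * (real d * norm_sq (B *\<^sub>v \<phi>))"
    using B by (simp add: norm_sq_def power_mult_distrib power2_eq_square[of "real d"] sum_distrib_left mult.assoc)
  finally show ?thesis by (simp add: d_def)
qed

text \<open>A scalar in the group also fixes \<phi>, and a nonzero coordinate of \<phi> forces it to
  be 1.\<close>

lemma stab_state_good_group:
  assumes "\<phi> \<in> stab_states n"
  obtains G where "good_group n G" "card G = 2 ^ n" "\<And>g. g \<in> G \<Longrightarrow> g *\<^sub>v \<phi> = \<phi>"
proof -
  from assms obtain G where G: "unit_vec n \<phi>" "abelian_pauli_subgroup n G" "card G = 2 ^ n" "\<forall>g\<in>G. g *\<^sub>v \<phi> = \<phi>"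
    by (auto simp: stab_states_def)
  have \<phi>: "\<phi> \<in> carrier_vec (2 ^ n)" and "(\<Sum>i<2 ^ n. (cmod (\<phi> $ i))\<^sup>2) \<noteq> 0"
    using G(1) by (auto simp: unit_vec_def)
  then obtain i where i: "i < 2 ^ n" "\<phi> $ i \<noteq> 0"
    by (auto elim: sum.not_neutral_contains_not_neutral)
  have "c = 1" if "c \<cdot>\<^sub>m 1\<^sub>m (2 ^ n) \<in> G" for c
  proof -
    have "\<phi> $ i = ((c \<cdot>\<^sub>m 1\<^sub>m (2 ^ n)) *\<^sub>v \<phi>) $ i" using that G(4) by simp
    also have "\<dots> = (\<Sum>k<2 ^ n. (c \<cdot>\<^sub>m 1\<^sub>m (2 ^ n)) $$ (i, k) * \<phi> $ k)"
      using \<phi> i by (intro mult_mat_vec_index_sum) auto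
    also have "\<dots> = (\<Sum>k<2 ^ n. if k = i then c * \<phi> $ k else 0)"
      using i by (intro sum.cong) auto
    also have "\<dots> = c * \<phi> $ i" using i by (subst sum.delta) auto
    finally show ?thesis using i by simp
  qed
  then have "\<forall>c. c \<cdot>\<^sub>m 1\<^sub>m (2 ^ n) \<in> G \<longrightarrow> c = 1" by simp
  with G(2) have "good_group n G"
    unfolding good_group_def abelian_pauli_subgroup_def by (elim conjE) (intro conjI)
  then show ?thesis using G(3) bspec[OF G(4)] by (rule that)
qed

section \<open>Product witnesses on stabiliser states\<close>

text \<open>The elements of \<open>G\<close> acting as \<open>P\<close> on the first qubit, with
  that factor stripped; all phases stay in what remains.\<close>

definition group_part :: "nat \<Rightarrow> complex mat set \<Rightarrow> complex mat \<Rightarrow> complex mat set" where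
  "group_part n G P = {g \<in> carrier_mat (2 ^ n) (2 ^ n). kron P g \<in> G}"

lemma group_partD:
  assumes "g \<in> group_part n G P"
  shows "g \<in> carrier_mat (2 ^ n) (2 ^ n)" "kron P g \<in> G"
  using assms by (simp_all add: group_part_def)

lemma group_part_subset:
  assumes "good_group (Suc n) G" "P \<in> paulis"
  shows "group_part n G P \<subseteq> pauli_group n"
  using pauli_group_kronD[OF subsetD[OF good_groupD(1)[OF assms(1)]] assms(2)] by (auto simp: group_part_def)

lemma one_smult_mat: "(1::complex) \<cdot>\<^sub>m A = A"
  by (auto intro!: eq_matI)

lemma smult_smult_times: "c \<cdot>\<^sub>m (d \<cdot>\<^sub>m A) = (c * d :: complex) \<cdot>\<^sub>m A"
  by (auto intro!: eq_matI)

lemma smult_inverse_sign: "s = 1 \<or> s = (-1::complex) \<Longrightarrow> s \<cdot>\<^sub>m (s \<cdot>\<^sub>m g) = g"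
  by (auto intro!: eq_matI)

lemma finite_group_part: "good_group (Suc n) G \<Longrightarrow> P \<in> paulis \<Longrightarrow> finite (group_part n G P)"
  using group_part_subset finite_pauli_group by (rule finite_subset)

text \<open>The group splits disjointly by the Pauli on the first qubit, and each summand
  factorises. The 2 in the hypothesis is the dimension of that qubit; it cancels against the step
  from \<open>2 ^ n\<close> to \<open>2 ^ Suc n\<close>.\<close>

lemma group_val_Suc:
  assumes G: "good_group (Suc n) G" and B: "B \<in> carrier_mat 2 2" and K: "K \<in> carrier_mat (2 ^ n) (2 ^ n)"
    and real: "\<And>P. P \<in> paulis \<Longrightarrow> sandwich B P = complex_of_real (2 * T P)"
  shows "group_val (Suc n) G (kron B K) = (\<Sum>P\<in>paulis. T P * group_val n (group_part n G P) K)"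
proof -
  have un: "G = (\<Union>P\<in>paulis. kron P ` group_part n G P)"
  proof (intro equalityI subsetI)
    fix x assume x: "x \<in> G"
    then have "x \<in> pauli_group (Suc n)" using good_groupD(1)[OF G] by (rule subsetD[rotated])
    then obtain P g where "x = kron P g" "P \<in> paulis" "g \<in> pauli_group n" by (auto simp: pauli_group_Suc)
    then show "x \<in> (\<Union>P\<in>paulis. kron P ` group_part n G P)"
      using x pauli_group_carrier[of g n] by (auto simp: group_part_def)
  qed (auto simp: group_part_def)
  have "(\<Sum>g\<in>G. sandwich (kron B K) g) = (\<Sum>g\<in>(\<Union>P\<in>paulis. kron P ` group_part n G P). sandwich (kron B K) g)"
    using un by (rule arg_cong)
  also have "\<dots> = (\<Sum>P\<in>paulis. \<Sum>g\<in>kron P ` group_part n G P. sandwich (kron B K) g)"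
  proof (rule sum.UNION_disjoint)
    show "\<forall>P\<in>paulis. \<forall>Q\<in>paulis. P \<noteq> Q \<longrightarrow> kron P ` group_part n G P \<inter> kron Q ` group_part n G Q = {}"
    proof (intro ballI impI equals0I)
      fix P Q x assume PQ: "P \<in> paulis" "Q \<in> paulis" "P \<noteq> Q" "x \<in> kron P ` group_part n G P \<inter> kron Q ` group_part n G Q"
      then obtain g h where gh: "g \<in> group_part n G P" "h \<in> group_part n G Q" "kron P g = kron Q h" by auto
      from kron_pauli_cancel(1)[OF PQ(1,2) subsetD[OF group_part_subset[OF G PQ(1)] gh(1)] group_partD(1)[OF gh(2)] gh(3)]
      show False using PQ(3) by simp
    qed
  qed (auto simp: finite_paulis finite_group_part[OF G])
  also have "\<dots> = (\<Sum>P\<in>paulis. \<Sum>g\<in>group_part n G P. sandwich (kron B K) (kron P g))"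
  proof (rule sum.cong[OF refl])
    fix P assume P: "P \<in> paulis"
    have "inj_on (kron P) (group_part n G P)"
      by (rule inj_onI) (rule kron_pauli_right_cancel[OF P group_partD(1) group_partD(1)])
    then show "(\<Sum>g\<in>kron P ` group_part n G P. sandwich (kron B K) g)
        = (\<Sum>g\<in>group_part n G P. sandwich (kron B K) (kron P g))"
      by (rule sum.reindex[unfolded o_def])
  qed
  also have "\<dots> = (\<Sum>P\<in>paulis. \<Sum>g\<in>group_part n G P. complex_of_real (2 * T P) * sandwich K g)"
    using sandwich_kron[OF B _ K] group_partD(1) real by (intro sum.cong refl) simp
  finally have "(\<Sum>g\<in>G. sandwich (kron B K) g)
      = (\<Sum>P\<in>paulis. complex_of_real (2 * T P) * (\<Sum>g\<in>group_part n G P. sandwich K g))"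
    by (simp add: sum_distrib_left)
  then have "group_val (Suc n) G (kron B K) = (\<Sum>P\<in>paulis. (2 * T P) * Re (\<Sum>g\<in>group_part n G P. sandwich K g)) / 2 ^ Suc n"
    by (simp add: group_val_def)
  also have "\<dots> = (\<Sum>P\<in>paulis. T P * group_val n (group_part n G P) K)"
    unfolding sum_divide_distrib group_val_def by (intro sum.cong refl) simp
  finally show ?thesis .
qed

text \<open>The stabiliser group, on the remaining qubits, after measuring \<open>P\<close> on the first one
  with outcome \<open>s\<close>.\<close>

definition group_merge :: "nat \<Rightarrow> complex mat set \<Rightarrow> complex mat \<Rightarrow> complex \<Rightarrow> complex mat set" where
  "group_merge n G P s = group_part n G pauli_I \<union> (\<lambda>g. s \<cdot>\<^sub>m g) ` group_part n G P"

lemma kron_smult_pauli_mult: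
  assumes "P \<in> paulis" "Q \<in> paulis" "g \<in> carrier_mat d d" "h \<in> carrier_mat d d"
  shows "kron P (s \<cdot>\<^sub>m g) * kron Q (t \<cdot>\<^sub>m h) = kron (P * Q) ((s * t) \<cdot>\<^sub>m (g * h))"
proof -
  have "(s \<cdot>\<^sub>m g) * (t \<cdot>\<^sub>m h) = (s * t) \<cdot>\<^sub>m (g * h)"
    using assms(3,4) by (intro eq_matI) (auto simp: scalar_prod_def sum_distrib_left mult_ac)
  then show ?thesis
    using kron_mult[OF pauli_carrier[OF assms(1)] pauli_carrier[OF assms(2)], of "s \<cdot>\<^sub>m g" d d "t \<cdot>\<^sub>m h" d] assms(3,4)
    by simp
qed

lemma group_merge_iff:
  assumes "s = 1 \<or> s = -1"
  shows "h \<in> group_merge n G P s \<longleftrightarrow> h \<in> carrier_mat (2 ^ n) (2 ^ n) \<and> (kron pauli_I (1 \<cdot>\<^sub>m h) \<in> G \<or> kron P (s \<cdot>\<^sub>m h) \<in> G)"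
proof -
  have "h \<in> (\<lambda>g. s \<cdot>\<^sub>m g) ` group_part n G P \<longleftrightarrow> h \<in> carrier_mat (2 ^ n) (2 ^ n) \<and> kron P (s \<cdot>\<^sub>m h) \<in> G"
    using smult_inverse_sign[OF assms] by (auto simp: group_part_def image_iff intro!: exI[of _ "s \<cdot>\<^sub>m h"])
  then show ?thesis by (auto simp: group_merge_def group_part_def one_smult_mat)
qed

text \<open>The pairs (\<open>pauli_I\<close>, 1) and (\<open>P\<close>, \<open>s\<close>) multiply
  like a group of order two, so dropping them from elements of \<open>G\<close> respects products;
  as these first factors commute, commutation in \<open>G\<close> passes to the remaining factors. A
  scalar other than 1 in the merged group would come from \<open>P\<close> tensored with a scalar
  other than \<open>s\<close>, which \<open>uniq\<close> excludes.\<close>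

lemma good_group_merge:
  assumes G: "good_group (Suc n) G" and P: "P \<in> paulis" and s: "s = 1 \<or> s = -1"
    and uniq: "\<And>c. kron P (c \<cdot>\<^sub>m 1\<^sub>m (2 ^ n)) \<in> G \<Longrightarrow> c = s"
  shows "good_group n (group_merge n G P s)"
proof -
  let ?H = "group_merge n G P s"
  let ?d = "2 ^ n :: nat"
  have ss: "s * s = 1" using s by auto
  have car: "h \<in> carrier_mat ?d ?d" if "h \<in> ?H" for h using that group_merge_iff[OF s] by simp
  have ex: "\<exists>Q t. (Q = pauli_I \<and> t = 1 \<or> Q = P \<and> t = s) \<and> kron Q (t \<cdot>\<^sub>m h) \<in> G" if "h \<in> ?H" for h
    using that group_merge_iff[OF s, of h n G P] by auto
  have one: "pauli_I * Q = Q" "Q * pauli_I = Q" if "Q \<in> paulis" for Q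
    using pauli_carrier[OF that] by (auto simp: pauli_I_eq_one)
  have PP: "P * P = pauli_I" using pauli_square[OF P] by (simp add: pauli_I_eq_one)
  have prod: "g * h \<in> ?H \<and> g * h = h * g" if gh: "g \<in> ?H" "h \<in> ?H" for g h
  proof -
    from ex[OF gh(1)] obtain Q t where Q: "Q = pauli_I \<and> t = 1 \<or> Q = P \<and> t = s" "kron Q (t \<cdot>\<^sub>m g) \<in> G" by metis
    from ex[OF gh(2)] obtain R u where R: "R = pauli_I \<and> u = 1 \<or> R = P \<and> u = s" "kron R (u \<cdot>\<^sub>m h) \<in> G" by metis
    have QR: "Q \<in> paulis" "R \<in> paulis" "R * Q = Q * R" "Q * R = pauli_I \<and> t * u = 1 \<or> Q * R = P \<and> t * u = s" "t * u \<noteq> 0"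
      using Q(1) R(1) P one PP ss s by auto
    note c = car[OF gh(1)] car[OF gh(2)]
    have "kron (Q * R) ((t * u) \<cdot>\<^sub>m (g * h)) \<in> G"
      using good_groupD(3)[OF G Q(2) R(2)] kron_smult_pauli_mult[OF QR(1,2) c] by simp
    then have 1: "g * h \<in> ?H" using QR(4) c group_merge_iff[OF s, of "g * h" n G P] by auto
    have "kron (Q * R) ((t * u) \<cdot>\<^sub>m (g * h)) = kron (R * Q) ((u * t) \<cdot>\<^sub>m (h * g))"
      using good_groupD(4)[OF G Q(2) R(2)] kron_smult_pauli_mult[OF QR(1,2) c] kron_smult_pauli_mult[OF QR(2,1) c(2,1)] by simp
    then have "kron (Q * R) ((t * u) \<cdot>\<^sub>m (g * h)) = kron (Q * R) ((t * u) \<cdot>\<^sub>m (h * g))"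
      by (simp add: QR(3) mult.commute)
    moreover have "Q * R \<in> paulis" using QR(4) P by auto
    ultimately have eq: "(t * u) \<cdot>\<^sub>m (g * h) = (t * u) \<cdot>\<^sub>m (h * g)"
      using kron_pauli_right_cancel[of "Q * R" "(t * u) \<cdot>\<^sub>m (g * h)" ?d ?d "(t * u) \<cdot>\<^sub>m (h * g)"] c by simp
    have "t * u = 1 \<or> t * u = -1" using QR(4) s by auto
    then have "g * h = h * g" using eq smult_inverse_sign[of "t * u"] by metis
    with 1 show ?thesis by simp
  qed
  have "?H \<subseteq> pauli_group n"
    using group_part_subset[OF G pauli_in_paulis(1)] group_part_subset[OF G P] pauli_group_smult_sign[OF _ s]
    by (auto simp: group_merge_def)
  moreover have "1\<^sub>m ?d \<in> ?H"
    using good_groupD(2)[OF G] kron_one_one[of 2 ?d] by (simp add: group_merge_def group_part_def pauli_I_eq_one)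
  moreover have "\<forall>c. c \<cdot>\<^sub>m 1\<^sub>m ?d \<in> ?H \<longrightarrow> c = 1"
  proof (intro allI impI)
    fix c assume "c \<cdot>\<^sub>m 1\<^sub>m ?d \<in> ?H"
    then consider "kron pauli_I (c \<cdot>\<^sub>m 1\<^sub>m ?d) \<in> G" | "kron P ((s * c) \<cdot>\<^sub>m 1\<^sub>m ?d) \<in> G"
      using group_merge_iff[OF s, of "c \<cdot>\<^sub>m 1\<^sub>m ?d" n G P] by (auto simp: smult_smult_times)
    then show "c = 1"
    proof cases
      case 1
      then show ?thesis using good_groupD(5)[OF G, of c] kron_one_one[of 2 ?d]
        by (simp add: kron_smult_right pauli_I_eq_one)
    next
      case 2
      then show ?thesis using uniq[OF 2] s by auto
    qed
  qed
  ultimately show ?thesis using prod unfolding good_group_def by (intro conjI ballI) simp_all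
qed

lemma group_val_union_disjoint:
  assumes "finite G" "finite H" "G \<inter> H = {}"
  shows "group_val n (G \<union> H) B = group_val n G B + group_val n H B"
  using assms by (simp add: group_val_def sum.union_disjoint add_divide_distrib)

lemma group_val_smult:
  assumes "B \<in> carrier_mat (2 ^ n) (2 ^ n)" "\<And>g. g \<in> G \<Longrightarrow> g \<in> carrier_mat (2 ^ n) (2 ^ n)" "e = 1 \<or> e = -1"
  shows "group_val n ((\<lambda>g. complex_of_real e \<cdot>\<^sub>m g) ` G) B = e * group_val n G B"
proof -
  have "inj_on (\<lambda>g. complex_of_real e \<cdot>\<^sub>m g) G"
    by (rule inj_on_inverseI[of _ "\<lambda>g. complex_of_real e \<cdot>\<^sub>m g"])
      (rule smult_inverse_sign, use assms(3) in auto)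
  then have "(\<Sum>g\<in>(\<lambda>g. complex_of_real e \<cdot>\<^sub>m g) ` G. sandwich B g) = (\<Sum>g\<in>G. complex_of_real e * sandwich B g)"
    using sandwich_smult[OF assms(1) assms(2)] by (simp add: sum.reindex)
  then show ?thesis by (simp add: group_val_def flip: sum_distrib_left)
qed

lemma group_part_square_scalar:
  assumes G: "good_group (Suc n) G" and P: "P \<in> paulis" and c: "kron P (c \<cdot>\<^sub>m 1\<^sub>m (2 ^ n)) \<in> G"
  shows "c = 1 \<or> c = -1"
proof -
  have "kron P (c \<cdot>\<^sub>m 1\<^sub>m (2 ^ n)) * kron P (c \<cdot>\<^sub>m 1\<^sub>m (2 ^ n)) = (c * c) \<cdot>\<^sub>m 1\<^sub>m (2 ^ Suc n)"
    using kron_smult_pauli_mult[OF P P one_carrier_mat one_carrier_mat, of c "2 ^ n" c] kron_one_one[of 2 "2 ^ n"]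
    by (simp add: pauli_square[OF P] kron_smult_right)
  then have "(c * c) \<cdot>\<^sub>m 1\<^sub>m (2 ^ Suc n) \<in> G" using good_groupD(3)[OF G c c] by simp
  then have "c * c = 1" by (rule good_groupD(5)[OF G])
  then show ?thesis using square_eq_1_iff by blast
qed

text \<open>A common element would put both \<open>P\<close> tensor h and \<open>pauli_I\<close>
  tensor s h into \<open>G\<close>. Since h squares to a scalar, their product is \<open>P\<close>
  tensor a scalar.\<close>

lemma group_part_disjoint:
  assumes G: "good_group (Suc n) G" and P: "P \<in> paulis" and s: "s = 1 \<or> s = -1"
    and none: "\<And>c. kron P (c \<cdot>\<^sub>m 1\<^sub>m (2 ^ n)) \<notin> G"
  shows "group_part n G pauli_I \<inter> (\<lambda>g. s \<cdot>\<^sub>m g) ` group_part n G P = {}"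
proof (rule equals0I)
  fix x assume "x \<in> group_part n G pauli_I \<inter> (\<lambda>g. s \<cdot>\<^sub>m g) ` group_part n G P"
  then obtain h where h: "s \<cdot>\<^sub>m h \<in> group_part n G pauli_I" "h \<in> group_part n G P" by auto
  note one_smult_mat[of h]
  then have "kron pauli_I (s \<cdot>\<^sub>m h) * kron P h = kron P (s \<cdot>\<^sub>m (h * h))"
    using kron_smult_pauli_mult[OF pauli_in_paulis(1) P group_partD(1)[OF h(2)] group_partD(1)[OF h(2)], of s 1] pauli_carrier[OF P]
    by (simp add: pauli_I_eq_one)
  moreover obtain c where "h * h = c \<cdot>\<^sub>m 1\<^sub>m (2 ^ n)"
    using pauli_group_square[OF subsetD[OF group_part_subset[OF G P] h(2)]] by metis
  ultimately have "kron pauli_I (s \<cdot>\<^sub>m h) * kron P h = kron P ((s * c) \<cdot>\<^sub>m 1\<^sub>m (2 ^ n))"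
    by (simp add: smult_smult_times)
  then show False using good_groupD(3)[OF G group_partD(2)[OF h(1)] group_partD(2)[OF h(2)]] none by simp
qed

text \<open>An element acting as \<open>P\<close> on the first qubit alone commutes with all of
  \<open>G\<close>, whereas a different nontrivial Pauli \<open>Q\<close> does not commute with
  \<open>P\<close>.\<close>

lemma group_part_empty:
  assumes G: "good_group (Suc n) G" and PQ: "P \<in> paulis" "Q \<in> paulis" "P \<noteq> pauli_I" "Q \<noteq> pauli_I" "P \<noteq> Q"
    and c: "kron P (c \<cdot>\<^sub>m 1\<^sub>m (2 ^ n)) \<in> G"
  shows "group_part n G Q = {}"
proof (rule equals0I)
  fix h assume h: "h \<in> group_part n G Q"
  note hc = group_partD(1)[OF h]
  have c0: "c \<noteq> 0" using group_part_square_scalar[OF G PQ(1) c] by auto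
  note one_smult_mat[of h]
  then have eq: "kron (P * Q) (c \<cdot>\<^sub>m h) = kron (Q * P) (c \<cdot>\<^sub>m h)"
    using good_groupD(4)[OF G c group_partD(2)[OF h]] hc
      kron_smult_pauli_mult[OF PQ(1,2) one_carrier_mat hc, of c 1]
      kron_smult_pauli_mult[OF PQ(2,1) hc one_carrier_mat, of 1 c] by simp
  obtain k l where kl: "k < 2 ^ n" "l < 2 ^ n" "h $$ (k, l) \<noteq> 0"
    using pauli_group_nonzero[OF subsetD[OF group_part_subset[OF G PQ(2)] h]] .
  have ca: "P * Q \<in> carrier_mat 2 2" "Q * P \<in> carrier_mat 2 2" "c \<cdot>\<^sub>m h \<in> carrier_mat (2 ^ n) (2 ^ n)"
    using pauli_carrier[OF PQ(1)] pauli_carrier[OF PQ(2)] hc by auto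
  have "(P * Q) $$ (i, j) = (Q * P) $$ (i, j)" if "i < 2" "j < 2" for i j
  proof -
    have "(P * Q) $$ (i, j) * (c \<cdot>\<^sub>m h) $$ (k, l) = (Q * P) $$ (i, j) * (c \<cdot>\<^sub>m h) $$ (k, l)"
      using kron_index_block[OF ca(1,3) that kl(1,2)] kron_index_block[OF ca(2,3) that kl(1,2)] eq by metis
    moreover have "(c \<cdot>\<^sub>m h) $$ (k, l) \<noteq> 0" using kl c0 hc by simp
    ultimately show ?thesis by (rule mult_right_cancel[THEN iffD1, rotated])
  qed
  then have "P * Q = Q * P"
    using ca pauli_carrier[OF PQ(1)] pauli_carrier[OF PQ(2)] by (intro eq_matI) (auto simp del: index_mult_mat(1))
  then show False using pauli_commuteD[OF PQ(1,2)] PQ(3-5) by simp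
qed

text \<open>Multiplication by \<open>P\<close> tensor the scalar \<open>c\<close> exchanges the two
  parts, since both \<open>P\<close> and \<open>c\<close> square to one.\<close>

lemma group_part_eq_smult:
  assumes G: "good_group (Suc n) G" and P: "P \<in> paulis" and c: "kron P (c \<cdot>\<^sub>m 1\<^sub>m (2 ^ n)) \<in> G"
  shows "group_part n G P = (\<lambda>g. c \<cdot>\<^sub>m g) ` group_part n G pauli_I"
proof -
  have c1: "c = 1 \<or> c = -1" using group_part_square_scalar[OF G P c] .
  have 1: "c \<cdot>\<^sub>m h \<in> group_part n G pauli_I" if "h \<in> group_part n G P" for h
    using good_groupD(3)[OF G group_partD(2)[OF that] c] group_partD(1)[OF that] pauli_square[OF P]
      kron_smult_pauli_mult[OF P P group_partD(1)[OF that] one_carrier_mat, of 1 c]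
    by (simp add: group_part_def one_smult_mat pauli_I_eq_one)
  have 2: "c \<cdot>\<^sub>m h \<in> group_part n G P" if "h \<in> group_part n G pauli_I" for h
    using good_groupD(3)[OF G group_partD(2)[OF that] c] group_partD(1)[OF that] pauli_carrier[OF P]
      kron_smult_pauli_mult[OF pauli_in_paulis(1) P group_partD(1)[OF that] one_carrier_mat, of 1 c]
    by (simp add: group_part_def one_smult_mat pauli_I_eq_one)
  show ?thesis
  proof (intro equalityI subsetI)
    fix h assume "h \<in> group_part n G P"
    then show "h \<in> (\<lambda>g. c \<cdot>\<^sub>m g) ` group_part n G pauli_I"
      using 1 smult_inverse_sign[OF c1, of h] by (intro image_eqI[of _ _ "c \<cdot>\<^sub>m h"]) auto
  qed (use 2 in auto)
qed

text \<open>The capital letters are the Pauli coefficients of a squared witness, the small ones what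
  the remaining qubits contribute; both families obey the same constraints. Bounding them by
  \<open>M\<close> and \<open>m\<close> leaves (1 - M) t + 3 M m, which is affine in M for M between
  0 and 1/2 and at most 1 at both ends. Equality holds when all eight numbers are 1/2.\<close>

lemma bloch_coefficient_bound:
  fixes A0 A1 A2 A3 t s1 s2 s3 :: real
  assumes A: "\<bar>A1\<bar> \<le> A0" "\<bar>A2\<bar> \<le> A0" "\<bar>A3\<bar> \<le> A0" "A0 + \<bar>A1\<bar> \<le> 1" "A0 + \<bar>A2\<bar> \<le> 1" "A0 + \<bar>A3\<bar> \<le> 1"
    and s: "\<bar>s1\<bar> \<le> t" "\<bar>s2\<bar> \<le> t" "\<bar>s3\<bar> \<le> t" "t + \<bar>s1\<bar> \<le> 1" "t + \<bar>s2\<bar> \<le> 1" "t + \<bar>s3\<bar> \<le> 1"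
  shows "A0 * t + A1 * s1 + A2 * s2 + A3 * s3 \<le> 1"
proof -
  define M where "M = max \<bar>A1\<bar> (max \<bar>A2\<bar> \<bar>A3\<bar>)"
  define m where "m = min t (1 - t)"
  have t: "0 \<le> t" "t \<le> 1" using s(1,4) by linarith+
  have M: "\<bar>A1\<bar> \<le> M" "\<bar>A2\<bar> \<le> M" "\<bar>A3\<bar> \<le> M" "A0 \<le> 1 - M" "M \<le> 1 / 2" "0 \<le> M"
    using A by (auto simp: M_def max_def)
  have m: "\<bar>s1\<bar> \<le> m" "\<bar>s2\<bar> \<le> m" "\<bar>s3\<bar> \<le> m" "0 \<le> m" "m \<le> t" "m \<le> 1 - t" "0 \<le> t"
    using s(1-3) t s(4-6)[unfolded le_diff_eq[symmetric] add.commute[of t]] by (simp_all add: m_def)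
  have "a * b \<le> M * m" if "\<bar>a\<bar> \<le> M" "\<bar>b\<bar> \<le> m" for a b
  proof -
    have "a * b \<le> \<bar>a\<bar> * \<bar>b\<bar>" using abs_ge_self[of "a * b"] by (simp only: abs_mult)
    also have "\<dots> \<le> M * m" using that M(6) by (intro mult_mono) simp_all
    finally show ?thesis .
  qed
  from this[OF M(1) m(1)] this[OF M(2) m(2)] this[OF M(3) m(3)]
  have "A0 * t + A1 * s1 + A2 * s2 + A3 * s3 \<le> (1 - M) * t + 3 * (M * m)"
    using mult_right_mono[OF M(4) m(7)] by linarith
  also have "\<dots> = t + M * (3 * m - t)" by (simp add: algebra_simps)
  also have "\<dots> \<le> 1"
  proof (cases "0 \<le> 3 * m - t")
    case True
    then have "M * (3 * m - t) \<le> 1 / 2 * (3 * m - t)" using M(5) by (rule mult_right_mono[rotated])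
    \<comment> \<open>This reads 3 m + t \<le> 2: add m \<le> t and twice m \<le> 1 - t.\<close>
    also have "\<dots> \<le> 1 - t" using m(5,6) by (simp add: field_simps)
    finally show ?thesis by simp
  next
    case False
    then have "M * (3 * m - t) \<le> 0" using M(6) by (simp add: mult_nonneg_nonpos)
    then show ?thesis using t by simp
  qed
  finally show ?thesis .
qed

text \<open>\<open>B\<close> is the root of the witness. Writing A0 for the sum of the four squares,
  \<open>B * B\<close> has expectations A0 + 2 x y and A0 - 2 x y in the two stabiliser states on an
  axis. The condition thus bounds the witness by 1 on the six single-qubit stabiliser
  states.\<close>

definition qubit_witness :: "complex mat \<Rightarrow> bool" where
  "qubit_witness B \<longleftrightarrow> (\<exists>x y1 y2 y3. B = bloch x (y1, y2, y3) \<and>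
     (\<forall>y\<in>{y1, y2, y3}. x\<^sup>2 + y1\<^sup>2 + y2\<^sup>2 + y3\<^sup>2 + 2 * \<bar>x * y\<bar> \<le> 1))"

lemma qubit_witness_herm: "qubit_witness B \<Longrightarrow> herm 2 B"
  by (auto simp: qubit_witness_def herm_bloch)

lemma sum_paulis: "(\<Sum>P\<in>paulis. f P) = f pauli_I + f pauli_X + f pauli_Y + f pauli_Z"
  using paulis_distinct by (simp add: paulis_def add.assoc)

text \<open>Groups of every order are covered, not only those of states, because the part of a
  stabiliser group that acts trivially on the first qubit need not be maximal on the others.\<close>

lemma group_val_kron_list_le_1:
  assumes "good_group n G" "length Bs = n" "\<And>B. B \<in> set Bs \<Longrightarrow> qubit_witness B"
  shows "group_val n G (kron_list Bs) \<le> 1"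
  using assms
proof (induction Bs arbitrary: n G)
  case Nil
  have "G \<subseteq> {1\<^sub>m 1}"
  proof
    fix g assume g: "g \<in> G"
    obtain c where c: "g = c \<cdot>\<^sub>m 1\<^sub>m 1"
      using subsetD[OF good_groupD(1)[OF Nil(1)] g] Nil(2) by (auto simp: pauli_group_0)
    then have "c = 1" using good_groupD(5)[OF Nil(1), of c] g Nil(2) by simp
    then show "g \<in> {1\<^sub>m 1}" using c by (simp add: one_smult_mat)
  qed
  moreover have "{1\<^sub>m 1} \<subseteq> G" using good_groupD(2)[OF Nil(1)] Nil(2) by simp
  ultimately have "G = {1\<^sub>m 1}" by (rule equalityI)
  then show ?case using Nil(2) by (simp add: group_val_def sandwich_def mtrace_def)
next
  case (Cons B Bs)
  obtain n' where n: "n = Suc n'" and len: "length Bs = n'" using Cons.prems(2) by auto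
  note G = Cons.prems(1)[unfolded n]
  define K where "K = kron_list Bs"
  have K: "herm (2 ^ n') K" using herm_kron_list[of Bs] qubit_witness_herm Cons.prems(3) len by (auto simp: K_def)
  have H: "0 \<le> group_val n' H K" "group_val n' H K \<le> 1" if "good_group n' H" for H
    using group_val_nonneg[OF that K] Cons.IH[OF that len] Cons.prems(3) by (auto simp: K_def)
  obtain x y1 y2 y3 where B: "B = bloch x (y1, y2, y3)"
    and y: "\<And>y. y \<in> {y1, y2, y3} \<Longrightarrow> x\<^sup>2 + y1\<^sup>2 + y2\<^sup>2 + y3\<^sup>2 + 2 * \<bar>x * y\<bar> \<le> 1"
    using Cons.prems(3)[of B] by (auto simp: qubit_witness_def)
  define A0 where "A0 = x\<^sup>2 + y1\<^sup>2 + y2\<^sup>2 + y3\<^sup>2"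
  have xy: "2 * \<bar>x * y\<bar> \<le> x\<^sup>2 + y\<^sup>2" for y
    using sum_squares_bound[of "\<bar>x\<bar>" "\<bar>y\<bar>"] by (simp add: abs_mult mult.assoc)
  \<comment> \<open>These are the constraints of \<open>bloch_coefficient_bound\<close> on the
    coefficients of \<open>B * B\<close>: the first reflects its positivity, the second is the
    witness condition.\<close>
  have A: "\<bar>2 * (x * y)\<bar> \<le> A0" "A0 + \<bar>2 * (x * y)\<bar> \<le> 1" if "y \<in> {y1, y2, y3}" for y
  proof -
    have "y\<^sup>2 \<le> y1\<^sup>2 + y2\<^sup>2 + y3\<^sup>2" using that by auto
    then show "\<bar>2 * (x * y)\<bar> \<le> A0" using xy[of y] by (simp add: A0_def abs_mult)
    show "A0 + \<bar>2 * (x * y)\<bar> \<le> 1" using y[OF that] by (simp add: A0_def abs_mult)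
  qed
  define T where "T P = (if P = pauli_I then A0 else if P = pauli_X then 2 * (x * y1)
    else if P = pauli_Y then 2 * (x * y2) else 2 * (x * y3))" for P
  define v where "v P = group_val n' (group_part n' G P) K" for P
  have T: "T pauli_I = A0" "T pauli_X = 2 * (x * y1)" "T pauli_Y = 2 * (x * y2)" "T pauli_Z = 2 * (x * y3)"
    using paulis_distinct by (auto simp: T_def)
  have "sandwich B P = complex_of_real (2 * T P)" if "P \<in> paulis" for P
    using that unfolding paulis_def
    by (elim insertE emptyE; simp only: T) (simp_all add: pauli_eq_bloch B sandwich_bloch A0_def)
  then have val: "group_val n G (kron_list (B # Bs)) = (\<Sum>P\<in>paulis. T P * v P)"
    unfolding v_def n kron_list_simps K_def[symmetric]
    by (intro group_val_Suc[OF G _ herm_carrier[OF K]]) (auto simp: B)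
  \<comment> \<open>The part over \<open>pauli_I\<close> is the merge for the trivial measurement,
    with sign 1, so the induction hypothesis applies to it.\<close>
  have vI: "0 \<le> v pauli_I" "v pauli_I \<le> 1"
  proof -
    have "group_merge n' G pauli_I 1 = group_part n' G pauli_I"
      by (simp add: group_merge_def one_smult_mat)
    moreover have "good_group n' (group_merge n' G pauli_I 1)"
    proof (rule good_group_merge[OF G])
      fix c assume "kron pauli_I (c \<cdot>\<^sub>m 1\<^sub>m (2 ^ n')) \<in> G"
      then show "c = 1" using good_groupD(5)[OF G, of c] kron_one_one[of 2 "2 ^ n'"]
        by (simp add: kron_smult_right pauli_I_eq_one)
    qed auto
    ultimately show "0 \<le> v pauli_I" "v pauli_I \<le> 1" using H by (auto simp: v_def)
  qed
  show ?case
  proof (cases "\<exists>P\<in>paulis. P \<noteq> pauli_I \<and> (\<exists>c. kron P (c \<cdot>\<^sub>m 1\<^sub>m (2 ^ n')) \<in> G)")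
    case True
    \<comment> \<open>The first qubit is in an eigenstate of \<open>P\<close>: only the parts over
      \<open>pauli_I\<close> and \<open>P\<close> are nonempty, and the second repeats the first up
      to the sign \<open>e\<close>.\<close>
    then obtain P c where P: "P \<in> paulis" "P \<noteq> pauli_I" "kron P (c \<cdot>\<^sub>m 1\<^sub>m (2 ^ n')) \<in> G" by auto
    obtain e where e: "e = 1 \<or> e = (-1::real)" "c = complex_of_real e"
      using group_part_square_scalar[OF G P(1,3)] by (metis of_real_1 of_real_minus)
    have vP: "v P = e * v pauli_I"
      using group_val_smult[OF herm_carrier[OF K] group_partD(1) e(1)] group_part_eq_smult[OF G P(1,3)]
      by (simp add: v_def e(2))
    have vQ: "v Q = 0" if "Q \<in> paulis" "Q \<noteq> pauli_I" "P \<noteq> Q" for Q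
      using group_part_empty[OF G P(1) that(1) P(2) that(2,3) P(3)] by (simp add: v_def group_val_def)
    have "(\<Sum>P\<in>paulis. T P * v P) = (T pauli_I + e * T P) * v pauli_I"
      using P(1,2) vP vQ[of pauli_X] vQ[of pauli_Y] vQ[of pauli_Z] paulis_distinct
      unfolding sum_paulis by (auto simp: paulis_def algebra_simps)
    also have "T pauli_I + e * T P \<le> 1"
    proof -
      have "A0 + \<bar>T P\<bar> \<le> 1" using P(1,2) A(2) T by (auto simp: paulis_def)
      then show ?thesis using e(1) T(1) by auto
    qed
    then have "(T pauli_I + e * T P) * v pauli_I \<le> 1 * v pauli_I"
      using vI(1) by (rule mult_right_mono)
    finally show ?thesis using vI(2) val by simp
  next
    case False
    have s: "\<bar>v P\<bar> \<le> v pauli_I \<and> v pauli_I + \<bar>v P\<bar> \<le> 1" if P: "P \<in> paulis" "P \<noteq> pauli_I" for P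
    proof -
      have none: "kron P (c \<cdot>\<^sub>m 1\<^sub>m (2 ^ n')) \<notin> G" for c using False P by auto
      \<comment> \<open>The two values of \<open>e\<close> are the outcomes of measuring
        \<open>P\<close>. Both together bound the absolute value of \<open>v P\<close>.\<close>
      have "0 \<le> v pauli_I + e * v P \<and> v pauli_I + e * v P \<le> 1" if e: "e = 1 \<or> e = -1" for e
      proof -
        have e': "complex_of_real e = 1 \<or> complex_of_real e = -1" using e by auto
        have "group_val n' (group_merge n' G P (complex_of_real e)) K = v pauli_I + e * v P"
          unfolding group_merge_def v_def
            group_val_union_disjoint[OF finite_group_part[OF G pauli_in_paulis(1)]
              finite_imageI[OF finite_group_part[OF G P(1)]] group_part_disjoint[OF G P(1) e' none]]
          by (simp only: group_val_smult[OF herm_carrier[OF K] group_partD(1) e])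
        moreover have "good_group n' (group_merge n' G P (complex_of_real e))"
          using none by (intro good_group_merge[OF G P(1) e']) auto
        ultimately show ?thesis using H by metis
      qed
      from this[of 1] this[of "-1"] show ?thesis by auto
    qed
    have "A0 * v pauli_I + 2 * (x * y1) * v pauli_X + 2 * (x * y2) * v pauli_Y + 2 * (x * y3) * v pauli_Z \<le> 1"
      using A[of y1] A[of y2] A[of y3] s[of pauli_X] s[of pauli_Y] s[of pauli_Z] paulis_distinct
      by (intro bloch_coefficient_bound) auto
    then show ?thesis unfolding val sum_paulis T .
  qed
qed

lemma witness_norm_sq_le_1:
  assumes "\<phi> \<in> stab_states n" "length Bs = n" "\<And>B. B \<in> set Bs \<Longrightarrow> qubit_witness B"
  shows "norm_sq (kron_list Bs *\<^sub>v \<phi>) \<le> 1"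
proof -
  obtain G where G: "good_group n G" "card G = 2 ^ n" "\<And>g. g \<in> G \<Longrightarrow> g *\<^sub>v \<phi> = \<phi>"
    using stab_state_good_group[OF assms(1)] by metis
  have "herm (2 ^ n) (kron_list Bs)"
    using herm_kron_list[of Bs] qubit_witness_herm assms by auto
  moreover have "unit_vec n \<phi>" using assms(1) by (simp add: stab_states_def)
  ultimately have "norm_sq (kron_list Bs *\<^sub>v \<phi>) \<le> group_val n G (kron_list Bs)"
    using norm_sq_le_group_val[OF G(1) _ _ G(2,3)] by simp
  also have "\<dots> \<le> 1" by (rule group_val_kron_list_le_1[OF G(1) assms(2,3)])
  finally show ?thesis .
qed

section \<open>Level sets of the Bloch ball\<close>

type_synonym vec3 = "real \<times> real \<times> real"

text \<open>The Bloch vectors of the six single-qubit stabiliser states; positions 4 and 5 belong to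
  the computational basis.\<close>

definition octv :: "nat \<Rightarrow> vec3" where
  "octv k = [(1, 0, 0), (-1, 0, 0), (0, 1, 0), (0, -1, 0), (0, 0, 1), (0, 0, -1)] ! k"

text \<open>The support function of the octahedron with vertices \<open>octv\<close>.\<close>

definition linf :: "vec3 \<Rightarrow> real" where
  "linf w = (case w of (a, b, c) \<Rightarrow> max \<bar>a\<bar> (max \<bar>b\<bar> \<bar>c\<bar>))"

lemma lessThan_6: "{..<6} = {0, 1, 2, 3, 4, 5 :: nat}"
  by auto

lemma norm_vec3_sq: "(norm ((a, b, c) :: vec3))\<^sup>2 = a\<^sup>2 + b\<^sup>2 + c\<^sup>2"
  by (simp add: norm_Pair)

lemma norm_octv: "k < 6 \<Longrightarrow> norm (octv k) = 1"
  by (auto simp: octv_def norm_Pair less_Suc_eq numeral_eq_Suc)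

lemma inj_octv: "inj_on octv {..<6}"
  unfolding lessThan_6 by (simp add: octv_def)

lemma linf_attained: "\<exists>k<6. inner w (octv k) = linf w"
proof -
  obtain a b c where w: "w = (a, b, c)" by (cases w)
  have "linf w \<in> {a, -a, b, -b, c, -c}" by (auto simp: w linf_def max_def abs_if)
  then obtain k where "k \<in> {..<6}" "inner w (octv k) = linf w"
    unfolding lessThan_6 by (force simp: w octv_def)
  then show ?thesis by auto
qed

lemma linf_nonneg: "0 \<le> linf w"
  by (auto simp: linf_def split: prod.split)

lemma linf_zero: "linf 0 = 0"
  by (simp add: linf_def zero_prod_def)

lemma continuous_on_linf: "continuous_on S linf"
proof -
  have *: "linf = (\<lambda>w. max \<bar>fst w\<bar> (max \<bar>fst (snd w)\<bar> \<bar>snd (snd w)\<bar>))"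
    by (auto simp: linf_def split: prod.split)
  show ?thesis unfolding * by (intro continuous_intros)
qed

text \<open>Membership in the Minkowski sum of \<open>l\<close> times the octahedron and \<open>l - 1\<close> times the unit ball:
  these are the Bloch vectors of the states with generalized robustness at most \<open>l\<close>.\<close>

definition in_level :: "real \<Rightarrow> (nat \<Rightarrow> real) \<Rightarrow> vec3 \<Rightarrow> bool" where
  "in_level l q r \<longleftrightarrow> (\<forall>k<6. 0 \<le> q k) \<and> (\<Sum>k<6. q k) = 1 \<and> norm (r - l *\<^sub>R (\<Sum>k<6. q k *\<^sub>R octv k)) \<le> l - 1"

text \<open>\<open>l\<close> is the maximum of (1 + w \<cdot> r) / (1 + linf w) over the unit
  sphere, raised to 1, which is the value at w = 0. Were \<open>r\<close> outside the Minkowski sum,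
  a separating direction w of length 1 would satisfy w \<cdot> r > l linf w + l - 1, the right side
  being the support function of the sum, and its quotient would exceed \<open>l\<close>.\<close>

lemma level_duality:
  fixes r :: vec3
  obtains l q w where "1 \<le> l" "in_level l q r" "w = 0 \<or> norm w = 1" "l * (1 + linf w) \<le> 1 + inner w r"
proof -
  define f where "f w = (1 + inner w r) / (1 + linf w)" for w
  have pos: "0 < 1 + linf w" for w using linf_nonneg[of w] by simp
  have "sphere 0 1 \<noteq> ({} :: vec3 set)"
    using norm_octv[of 0] by (metis empty_iff mem_sphere_0 zero_less_numeral)
  moreover have "continuous_on (sphere 0 1) f"
    unfolding f_def by (intro continuous_intros continuous_on_linf) (simp add: less_imp_neq[OF pos, symmetric])
  ultimately obtain w0 where w0: "norm w0 = 1" "\<And>w. norm w = 1 \<Longrightarrow> f w \<le> f w0"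
    using continuous_attains_sup[OF compact_sphere, of 0 1 f] by (auto simp: sphere_def)
  define l where "l = max 1 (f w0)"
  have l: "1 \<le> l" "f w0 \<le> l" by (auto simp: l_def)
  have dual: "\<exists>w. (w = 0 \<or> norm w = 1) \<and> l * (1 + linf w) \<le> 1 + inner w r"
  proof (cases "1 \<le> f w0")
    case True
    then show ?thesis using w0(1) pos[of w0] by (intro exI[of _ w0]) (simp add: l_def f_def)
  next
    case False
    then show ?thesis by (intro exI[of _ 0]) (simp add: l_def linf_zero)
  qed
  define H where "H = (\<lambda>x. l *\<^sub>R x) ` (convex hull (octv ` {..<6}))"
  define L where "L = (\<Union>x\<in>H. \<Union>y\<in>cball 0 (l - 1). {x + y})"
  have "compact H" unfolding H_def by (intro compact_scaling finite_imp_compact_convex_hull) simp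
  then have "closed L" unfolding L_def by (intro compact_imp_closed compact_sums' compact_cball)
  have "convex H" unfolding H_def by (intro convex_scaling convex_convex_hull)
  then have "convex L" unfolding L_def by (intro convex_sums convex_cball)
  have "r \<in> L"
  proof (rule ccontr)
    assume "r \<notin> L"
    then obtain a b where ab: "inner a r < b" "\<forall>x\<in>L. inner a x > b"
      using separating_hyperplane_closed_point[OF \<open>convex L\<close> \<open>closed L\<close>] by metis
    have mem: "l *\<^sub>R octv k + y \<in> L" if "k < 6" "norm y \<le> l - 1" for k y
    proof -
      have "octv k \<in> convex hull (octv ` {..<6})" using that by (intro hull_inc) simp
      then have "l *\<^sub>R octv k \<in> H" unfolding H_def by (rule imageI)
      moreover have "y \<in> cball 0 (l - 1)" using that by simp
      ultimately show ?thesis unfolding L_def by blast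
    qed
    have "a \<noteq> 0"
    proof
      assume "a = 0"
      then show False using ab(1) bspec[OF ab(2) mem[of 0 0]] l(1) by simp
    qed
    \<comment> \<open>The hyperplane leaves \<open>L\<close> on the upper side of \<open>a\<close>;
      reversing the direction places \<open>r\<close> beyond \<open>L\<close>.\<close>
    define w where "w = - (a /\<^sub>R norm a)"
    have w: "norm w = 1" using \<open>a \<noteq> 0\<close> by (simp add: w_def)
    have aw: "inner a x = - norm a * inner w x" for x using \<open>a \<noteq> 0\<close> by (simp add: w_def)
    obtain k where k: "k < 6" "inner w (octv k) = linf w" using linf_attained by blast
    \<comment> \<open>The tested point maximises the inner product with \<open>w\<close> over
      \<open>L\<close>: best vertex of the octahedron plus the extreme point of the ball in
      direction \<open>w\<close>.\<close>
    have "inner a r < inner a (l *\<^sub>R octv k + (l - 1) *\<^sub>R w)"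
      using ab(1) bspec[OF ab(2) mem[OF k(1), of "(l - 1) *\<^sub>R w"]] w l(1) by simp
    then have "inner w (l *\<^sub>R octv k + (l - 1) *\<^sub>R w) < inner w r"
      unfolding aw using \<open>a \<noteq> 0\<close> by simp
    then have "l * linf w + (l - 1) < inner w r"
      using k(2) w by (simp add: inner_add_right power2_norm_eq_inner[symmetric])
    then have "l < f w" using pos[of w] by (simp add: f_def field_simps)
    then show False using w0(2)[OF w] l(2) by simp
  qed
  then obtain s y where s: "s \<in> convex hull (octv ` {..<6})" "norm y \<le> l - 1" "r = l *\<^sub>R s + y"
    by (auto simp: L_def H_def)
  from s(1) obtain u where u: "\<forall>x\<in>octv ` {..<6}. 0 \<le> u x" "sum u (octv ` {..<6}) = 1"
    "(\<Sum>x\<in>octv ` {..<6}. u x *\<^sub>R x) = s"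
    by (auto simp: convex_hull_finite)
  have "in_level l (\<lambda>k. u (octv k)) r"
    using u s by (simp add: in_level_def sum.reindex[OF inj_octv])
  then show ?thesis using that l(1) dual by blast
qed

lemma level_pull:
  fixes r :: vec3
  assumes "in_level l q r" "norm r \<le> 1" "1 \<le> l"
  obtains N :: nat and p z Q where "\<forall>k<N. 0 \<le> p k \<and> norm (z k) = 1 \<and> in_level l (Q k) (z k)"
    "(\<Sum>k<N. p k) = 1" "r = (\<Sum>k<N. p k *\<^sub>R z k)"
proof (cases "norm r = 1")
  case True
  show ?thesis
    by (rule that[of 1 "\<lambda>_. 1" "\<lambda>_. r" "\<lambda>_. q"]) (use True assms in auto)
next
  case False
  then have r1: "norm r < 1" using assms(2) by simp
  define s where "s = (\<Sum>k<6. q k *\<^sub>R octv k)"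
  define d where "d = r - l *\<^sub>R s"
  have d: "norm d \<le> l - 1" and q: "\<And>k. k < 6 \<Longrightarrow> 0 \<le> q k" "(\<Sum>k<6. q k) = 1"
    using assms(1) by (auto simp: in_level_def d_def s_def)
  define y where "y k = l *\<^sub>R octv k + d" for k
  have "1 \<le> norm (y k)" if "k < 6" for k
  proof -
    have "l = norm (l *\<^sub>R octv k)" using norm_octv[OF that] assms(3) by simp
    also have "\<dots> \<le> norm (y k) + norm d" using norm_triangle_ineq4[of "y k" d] by (simp add: y_def)
    finally show ?thesis using d by simp
  qed
  \<comment> \<open>The segment from \<open>r\<close> to \<open>y k\<close> starts inside the unit
    sphere and ends on or outside it.\<close>
  then have "\<exists>t. 0 \<le> t \<and> t \<le> 1 \<and> norm (r + t *\<^sub>R (y k - r)) = 1" if "k < 6" for k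
    using r1 that by (intro IVT') (auto intro!: continuous_intros)
  then obtain t where t: "\<And>k. k < 6 \<Longrightarrow> 0 \<le> t k \<and> t k \<le> 1 \<and> norm (r + t k *\<^sub>R (y k - r)) = 1" by metis
  have tpos: "0 < t k" if "k < 6" for k
  proof -
    have "t k \<noteq> 0" using t[OF that] r1 by auto
    then show ?thesis using t[OF that] by simp
  qed
  define D where "D = (\<Sum>k<6. q k / t k)"
  have "(\<Sum>k<6. q k) \<le> D" unfolding D_def
  proof (rule sum_mono)
    fix k :: nat assume "k \<in> {..<6}"
    then have k: "k < 6" by simp
    have "q k * t k \<le> q k * 1" using q(1)[OF k] t[OF k] by (intro mult_left_mono) auto
    then show "q k \<le> q k / t k" using tpos[OF k] by (simp add: pos_le_divide_eq)
  qed
  then have D: "0 < D" using q(2) by simp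
  define z where "z k = r + t k *\<^sub>R (y k - r)" for k
  \<comment> \<open>Pulling shrinks the difference \<open>y k - r\<close> by the factor
    \<open>t k\<close>; dividing the weight by \<open>t k\<close> undoes this, so the weighted
    differences still cancel. \<open>D\<close> normalises.\<close>
  define p where "p k = q k / t k / D" for k
  \<comment> \<open>Pulling changes the octahedron part from \<open>s\<close> to the mixture of
    \<open>s\<close> and vertex \<open>k\<close> with weights \<open>1 - t k\<close> and
    \<open>t k\<close>, while the remainder \<open>d\<close> stays the same; hence the level is
    kept.\<close>
  define Q where "Q k j = (1 - t k) * q j + (if j = k then t k else 0)" for k j
  have p1: "(\<Sum>k<6. p k) = 1" unfolding p_def sum_divide_distrib[symmetric] D_def[symmetric] using D by simp
  have "(\<Sum>k<6. q k *\<^sub>R y k) = l *\<^sub>R s + d"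
    using q(2) by (simp add: y_def s_def scaleR_add_right sum.distrib scaleR_sum_right mult.commute flip: scaleR_sum_left)
  then have "(\<Sum>k<6. q k *\<^sub>R (y k - r)) = 0"
    using q(2) by (simp add: scaleR_diff_right sum_subtractf d_def flip: scaleR_sum_left)
  moreover have "(\<Sum>k<6. p k *\<^sub>R z k) = (\<Sum>k<6. p k) *\<^sub>R r + (1 / D) *\<^sub>R (\<Sum>k<6. q k *\<^sub>R (y k - r))"
    unfolding scaleR_sum_left scaleR_sum_right sum.distrib[symmetric]
    by (intro sum.cong refl) (use tpos in \<open>auto simp: z_def p_def scaleR_add_right less_imp_neq[symmetric]\<close>)
  ultimately have rz: "r = (\<Sum>k<6. p k *\<^sub>R z k)" using p1 by simp
  have lev: "in_level l (Q k) (z k)" if k: "k < 6" for k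
  proof -
    have *: "(\<Sum>j<6. if j = k then t k *\<^sub>R octv k else 0) = t k *\<^sub>R octv k" "(\<Sum>j<6. if j = k then t k else 0) = t k"
      using k by simp_all
    have "(\<Sum>j<6. Q k j *\<^sub>R octv j) = (\<Sum>j<6. (1 - t k) *\<^sub>R (q j *\<^sub>R octv j) + (if j = k then t k *\<^sub>R octv k else 0))"
      by (intro sum.cong refl) (auto simp: Q_def scaleR_add_left)
    also have "\<dots> = (1 - t k) *\<^sub>R s + t k *\<^sub>R octv k"
      unfolding sum.distrib * scaleR_sum_right[symmetric] s_def ..
    finally have sum: "(\<Sum>j<6. Q k j *\<^sub>R octv j) = (1 - t k) *\<^sub>R s + t k *\<^sub>R octv k" .
    have "z k - l *\<^sub>R (\<Sum>j<6. Q k j *\<^sub>R octv j) = d"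
      unfolding sum by (simp add: z_def y_def d_def algebra_simps)
    moreover have "(\<Sum>j<6. Q k j) = 1"
      unfolding Q_def sum.distrib * sum_distrib_left[symmetric] q(2) by simp
    ultimately show ?thesis unfolding in_level_def using d q(1) t[OF k] by (auto simp: Q_def)
  qed
  show ?thesis
  proof (rule that[of 6 p z Q])
    have "0 \<le> p k" if "k < 6" for k using q(1)[OF that] tpos[OF that] D by (simp add: p_def)
    moreover have "norm (z k) = 1" if "k < 6" for k using t[OF that] by (simp add: z_def)
    ultimately show "\<forall>k<6. 0 \<le> p k \<and> norm (z k) = 1 \<and> in_level l (Q k) (z k)" using lev by simp
  qed (use p1 rz in auto)
qed

section \<open>Single-qubit decompositions and witnesses\<close>

lemma bloch_index_gen:
  "bloch t v $$ (0, 0) = complex_of_real (t + snd (snd v))" "bloch t v $$ (0, Suc 0) = Complex (fst v) (- fst (snd v))"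
  "bloch t v $$ (Suc 0, 0) = Complex (fst v) (fst (snd v))" "bloch t v $$ (Suc 0, Suc 0) = complex_of_real (t - snd (snd v))"
  by (cases v; simp)+

lemma less_2_cases_Suc: "i < 2 \<longleftrightarrow> i = 0 \<or> i = Suc 0"
  by auto

lemma bloch_sum:
  assumes "i < 2" "j < 2"
  shows "(\<Sum>k\<in>I. complex_of_real (c k) * bloch (t k) (v k) $$ (i, j))
    = bloch (\<Sum>k\<in>I. c k * t k) (\<Sum>k\<in>I. c k *\<^sub>R v k) $$ (i, j)"
  using assms unfolding less_2_cases_Suc
  by (auto simp: bloch_index_gen complex_eq_iff fst_sum snd_sum sum_subtractf sum.distrib sum_negf
      distrib_left right_diff_distrib)

definition pure_bloch :: "complex vec \<Rightarrow> vec3 \<Rightarrow> bool" where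
  "pure_bloch \<psi> z \<longleftrightarrow> \<psi> \<in> carrier_vec 2 \<and> outer \<psi> \<psi> = bloch (1 / 2) ((1 / 2) *\<^sub>R z)"

lemma vec2_eqI: "x \<in> carrier_vec 2 \<Longrightarrow> y \<in> carrier_vec 2 \<Longrightarrow> x $ 0 = y $ 0 \<Longrightarrow> x $ Suc 0 = y $ Suc 0 \<Longrightarrow> x = y"
  by (intro eq_vecI) (auto simp: less_2_cases_Suc)

lemma pure_blochD:
  assumes "pure_bloch \<psi> z"
  shows "\<psi> \<in> carrier_vec 2" "i < 2 \<Longrightarrow> j < 2 \<Longrightarrow> \<psi> $ i * cnj (\<psi> $ j) = bloch (1 / 2) ((1 / 2) *\<^sub>R z) $$ (i, j)"
    "unit_vec 1 \<psi>" "\<psi> $ 0 * cnj (\<psi> $ 0) + \<psi> $ Suc 0 * cnj (\<psi> $ Suc 0) = 1"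
proof -
  show c: "\<psi> \<in> carrier_vec 2" using assms by (simp add: pure_bloch_def)
  show e: "\<psi> $ i * cnj (\<psi> $ j) = bloch (1 / 2) ((1 / 2) *\<^sub>R z) $$ (i, j)" if "i < 2" "j < 2" for i j
    using assms outer_index[OF c c that] by (simp add: pure_bloch_def)
  show s: "\<psi> $ 0 * cnj (\<psi> $ 0) + \<psi> $ Suc 0 * cnj (\<psi> $ Suc 0) = 1"
    using e[of 0 0] e[of "Suc 0" "Suc 0"] by (simp add: bloch_index_gen complex_eq_iff)
  have "complex_of_real ((cmod (\<psi> $ 0))\<^sup>2 + (cmod (\<psi> $ Suc 0))\<^sup>2) = 1"
    using s by (simp only: of_real_add complex_norm_square)
  then show "unit_vec 1 \<psi>" using c by (simp only: of_real_eq_1_iff) (simp add: unit_vec_def sum_lessThan_2)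
qed

text \<open>The phase is chosen so that the first amplitude is the nonnegative number sqrt ((1 + c)
  / 2). The second is obtained by dividing by it, so the south pole needs its own vector.\<close>

lemma pure_bloch_exists:
  assumes "norm (z :: vec3) = 1"
  obtains \<psi> where "pure_bloch \<psi> z"
proof -
  obtain a b c where z: "z = (a, b, c)" by (cases z)
  have n: "a\<^sup>2 + b\<^sup>2 + c\<^sup>2 = 1" using norm_vec3_sq[of a b c] assms z by simp
  have c1: "-1 \<le> c" using n abs_le_square_iff[of c 1] sum_power2_ge_zero[of a b] by simp
  show ?thesis
  proof (cases "c = -1")
    case True
    then have "a = 0" "b = 0" using n by (auto simp: sum_power2_eq_zero_iff)
    then have "pure_bloch (vec 2 (\<lambda>i. if i = 0 then 0 else 1)) z"
      unfolding pure_bloch_def by (auto simp: z True outer_def complex_eq_iff intro!: mat2_eqI)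
    then show ?thesis by (rule that)
  next
    case False
    define h where "h = sqrt ((1 + c) / 2)"
    have h: "h * h = (1 + c) / 2" "h > 0" using c1 False by (auto simp: h_def)
    define a' where "a' = a / (2 * h)"
    define b' where "b' = b / (2 * h)"
    have ab: "h * a' = a / 2" "h * b' = b / 2" using h(2) by (auto simp: a'_def b'_def)
    have "a' * a' + b' * b' = (a * a + b * b) / (4 * (h * h))"
      by (simp add: a'_def b'_def add_divide_distrib)
    also have "a * a + b * b = (1 + c) * (1 - c)" using n by (simp add: power2_eq_square algebra_simps)
    also have "(1 + c) * (1 - c) / (4 * (h * h)) = (1 - c) / 2"
    proof -
      have *: "4 * (h * h) = (1 + c) * 2" "1 + c \<noteq> 0" using h by auto
      show ?thesis unfolding *(1) by (rule mult_divide_mult_cancel_left[OF *(2)])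
    qed
    finally have c: "a' * a' + b' * b' = 1 / 2 - c / 2" by (simp only: diff_divide_distrib)
    have h1: "h * h = 1 / 2 + c / 2" unfolding h(1) by (rule add_divide_distrib)
    have ba: "a' * h = a / 2" "b' * h = b / 2" "b' * a' = a' * b'" using ab by (simp_all only: mult.commute)
    have "pure_bloch (vec 2 (\<lambda>i. if i = 0 then complex_of_real h else Complex a' b')) z"
      unfolding pure_bloch_def z
      by (intro conjI mat2_eqI; simp add: outer_def complex_eq_iff h1 ab ba c)
    then show ?thesis by (rule that)
  qed
qed

section \<open>Quadratic forms of one qubit and the Bloch ball\<close>

definition bloch_form :: "complex mat \<Rightarrow> complex vec \<Rightarrow> complex" where
  "bloch_form A x = (\<Sum>i<2. \<Sum>j<2. cnj (x $ i) * A $$ (i, j) * x $ j)"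

text \<open>The form equals t |B| + v \<cdot> B, where \<open>B\<close> is the unnormalised Bloch
  vector of \<open>x\<close> and its length is the squared norm of \<open>x\<close>; Cauchy-Schwarz
  does the rest.\<close>

lemma bloch_form_nonneg:
  assumes "norm v \<le> t"
  shows "0 \<le> Re (bloch_form (bloch t v) x)"
proof -
  obtain v1 v2 v3 where v: "v = (v1, v2, v3)" by (cases v)
  obtain a b c d where x: "x $ 0 = Complex a b" "x $ Suc 0 = Complex c d" by (metis complex.exhaust)
  define X where "X = a\<^sup>2 + b\<^sup>2"
  define Y where "Y = c\<^sup>2 + d\<^sup>2"
  define B :: vec3 where "B = (2 * (a * c + b * d), 2 * (a * d - b * c), X - Y)"
  have XY: "0 \<le> X" "0 \<le> Y" by (auto simp: X_def Y_def)
  have "(norm B)\<^sup>2 = (X + Y)\<^sup>2"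
    unfolding B_def norm_vec3_sq X_def Y_def by (simp add: power2_eq_square algebra_simps)
  then have nB: "norm B = X + Y" using XY by (simp add: power2_eq_iff_nonneg)
  have "Re (bloch_form (bloch t v) x) = t * (X + Y) + inner v B"
    by (simp add: bloch_form_def sum_lessThan_2 v x B_def X_def Y_def power2_eq_square algebra_simps)
  moreover have "\<bar>inner v B\<bar> \<le> norm v * norm B" by (rule Cauchy_Schwarz_ineq2)
  moreover have "norm v * norm B \<le> t * (X + Y)" unfolding nB using assms XY by (intro mult_right_mono) auto
  ultimately show ?thesis by linarith
qed

lemma bloch_form_pure:
  assumes "pure_bloch \<psi> z"
  shows "bloch_form (bloch t v) \<psi> = complex_of_real (t + inner v z)"
proof -
  have "bloch_form (bloch t v) \<psi> = (\<Sum>i<2. \<Sum>j<2. bloch t v $$ (i, j) * (\<psi> $ j * cnj (\<psi> $ i)))"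
    unfolding bloch_form_def by (intro sum.cong refl) (simp add: mult_ac)
  also have "\<dots> = (\<Sum>i<2. \<Sum>j<2. bloch t v $$ (i, j) * bloch (1 / 2) ((1 / 2) *\<^sub>R z) $$ (j, i))"
    by (intro sum.cong refl) (simp add: pure_blochD(2)[OF assms])
  also have "\<dots> = complex_of_real (t + inner v z)"
    by (cases v; cases z) (simp add: sum_lessThan_2 complex_eq_iff field_simps)
  finally show ?thesis .
qed

text \<open>Hermiticity is read off from the form being real at four vectors. The length of
  \<open>r\<close> is bounded by testing on the pure state with the opposite Bloch
  direction.\<close>

lemma density_bloch:
  assumes "density 1 \<rho>"
  obtains r where "norm r \<le> 1" "\<rho> = bloch (1 / 2) ((1 / 2) *\<^sub>R r)"
proof -
  have c: "\<rho> \<in> carrier_mat 2 2" and tr: "mtrace \<rho> = 1"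
    and psd: "\<And>v. v \<in> carrier_vec 2 \<Longrightarrow> Im (bloch_form \<rho> v) = 0 \<and> 0 \<le> Re (bloch_form \<rho> v)"
    using assms unfolding density_def psd_def bloch_form_def Let_def by simp_all
  have im: "Im (bloch_form \<rho> (vec 2 (\<lambda>i. if i = 0 then a else b))) = 0" for a b using psd[OF vec_carrier] by simp
  have t: "\<rho> $$ (0, 0) + \<rho> $$ (Suc 0, Suc 0) = 1" using tr c by (simp add: mtrace_def sum_lessThan_2)
  define r where "r = (2 * Re (\<rho> $$ (0, Suc 0)), - 2 * Im (\<rho> $$ (0, Suc 0)), 2 * Re (\<rho> $$ (0, 0)) - 1)"
  have \<rho>: "\<rho> = bloch (1 / 2) ((1 / 2) *\<^sub>R r)"
    using im[of 1 0] im[of 0 1] im[of 1 1] im[of 1 \<i>] t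
    by (intro mat2_eqI c bloch_carrier) (auto simp: r_def bloch_form_def sum_lessThan_2 complex_eq_iff field_simps)
  have "norm r \<le> 1"
  proof (cases "r = 0")
    case False
    then have "norm (- (r /\<^sub>R norm r)) = 1" by simp
    then obtain \<psi> where \<psi>: "pure_bloch \<psi> (- (r /\<^sub>R norm r))" by (rule pure_bloch_exists)
    have i: "inner ((1 / 2) *\<^sub>R r) (- (r /\<^sub>R norm r)) = - (norm r / 2)"
      using False by (simp add: power2_norm_eq_inner[symmetric] power2_eq_square)
    have "0 \<le> Re (bloch_form \<rho> \<psi>)" using psd[OF pure_blochD(1)[OF \<psi>]] by simp
    then show ?thesis unfolding \<rho> bloch_form_pure[OF \<psi>] i by simp
  qed simp
  then show ?thesis using \<rho> by (rule that)
qed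

text \<open>For |s| < 1 the matrix is invertible. For |s| = 1 it has rank one, but squaring |z - l
  s| \<le> l - 1 then gives z \<cdot> s \<ge> 1, so z = s: the matrix is \<open>l\<close> times the
  projector onto \<psi>, and \<psi> / l is a solution.\<close>

lemma level_bloch_solve:
  assumes "pure_bloch \<psi> z" "norm z = 1" "norm s \<le> 1" "norm (z - l *\<^sub>R s) \<le> l - 1" "1 \<le> l"
  obtains x0 x1 where
    "bloch (l / 2) ((l / 2) *\<^sub>R s) $$ (0, 0) * x0 + bloch (l / 2) ((l / 2) *\<^sub>R s) $$ (0, Suc 0) * x1 = \<psi> $ 0"
    "bloch (l / 2) ((l / 2) *\<^sub>R s) $$ (Suc 0, 0) * x0 + bloch (l / 2) ((l / 2) *\<^sub>R s) $$ (Suc 0, Suc 0) * x1 = \<psi> $ Suc 0"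
proof (cases "norm s = 1")
  case True
  have "(norm (z - l *\<^sub>R s))\<^sup>2 \<le> (l - 1)\<^sup>2" using assms(4) by (intro power_mono) auto
  moreover have "(norm (z - l *\<^sub>R s))\<^sup>2 = 1 - 2 * l * inner z s + l\<^sup>2"
    using assms(2) True unfolding power2_norm_eq_inner power2_eq_square[of l]
    by (simp add: inner_diff_left inner_diff_right inner_commute[of s z] norm_eq_1 algebra_simps)
  ultimately have "l * 1 \<le> l * inner z s" by (simp add: power2_eq_square algebra_simps)
  then have "1 \<le> inner z s" using assms(5) by simp
  moreover have "(norm (z - s))\<^sup>2 = 2 - 2 * inner z s"
    using assms(2) True unfolding power2_norm_eq_inner
    by (simp add: inner_diff_left inner_diff_right inner_commute[of s z] norm_eq_1)
  ultimately have "(norm (z - s))\<^sup>2 \<le> 0" by simp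
  then have zs: "z = s" by simp
  have A: "bloch (l / 2) ((l / 2) *\<^sub>R s) $$ (i, j) = l * (\<psi> $ i * cnj (\<psi> $ j))" if "i < 2" "j < 2" for i j
    using that unfolding pure_blochD(2)[OF assms(1) that] zs less_2_cases_Suc
    by (auto simp: bloch_index_gen complex_eq_iff algebra_simps)
  have "bloch (l / 2) ((l / 2) *\<^sub>R s) $$ (i, 0) * (\<psi> $ 0 / l) + bloch (l / 2) ((l / 2) *\<^sub>R s) $$ (i, Suc 0) * (\<psi> $ Suc 0 / l)
      = \<psi> $ i" if "i < 2" for i
  proof -
    have "bloch (l / 2) ((l / 2) *\<^sub>R s) $$ (i, 0) * (\<psi> $ 0 / l) + bloch (l / 2) ((l / 2) *\<^sub>R s) $$ (i, Suc 0) * (\<psi> $ Suc 0 / l)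
        = \<psi> $ i * (\<psi> $ 0 * cnj (\<psi> $ 0) + \<psi> $ Suc 0 * cnj (\<psi> $ Suc 0))"
      using A[OF that, of 0] A[OF that, of "Suc 0"] assms(5) by (simp add: field_simps)
    then show ?thesis using pure_blochD(4)[OF assms(1)] by simp
  qed
  from that[OF this[of 0] this[of "Suc 0"]] show ?thesis by simp
next
  case False
  obtain s1 s2 s3 where s: "s = (s1, s2, s3)" by (cases s)
  have "(norm s)\<^sup>2 < 1" using False assms(3) by (simp add: power_less_one_iff)
  then have D: "1 - (s1\<^sup>2 + s2\<^sup>2 + s3\<^sup>2) > 0" by (simp add: s norm_vec3_sq)
  \<comment> \<open>Up to the factor l^2 / 4 this is the determinant of the system, solved below by
    Cramer's rule.\<close>
  define D where "D = complex_of_real (1 - (s1\<^sup>2 + s2\<^sup>2 + s3\<^sup>2))"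
  define L where "L = complex_of_real l"
  have D0: "D \<noteq> 0" "L \<noteq> 0" using D assms(5) by (auto simp: D_def L_def complex_eq_iff)
  define u where "u = Complex s1 s2"
  define u' where "u' = Complex s1 (- s2)"
  define p where "p = complex_of_real s3"
  have Deq: "D = (1 + p) * (1 - p) - u' * u"
    by (simp add: D_def p_def u_def u'_def complex_eq_iff power2_eq_square algebra_simps)
  have B: "bloch (l / 2) ((l / 2) *\<^sub>R s) $$ (0, 0) = L / 2 * (1 + p)" "bloch (l / 2) ((l / 2) *\<^sub>R s) $$ (0, Suc 0) = L / 2 * u'"
    "bloch (l / 2) ((l / 2) *\<^sub>R s) $$ (Suc 0, 0) = L / 2 * u" "bloch (l / 2) ((l / 2) *\<^sub>R s) $$ (Suc 0, Suc 0) = L / 2 * (1 - p)"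
    by (simp_all add: s L_def p_def u_def u'_def complex_eq_iff algebra_simps)
  show ?thesis
  proof (rule that[of "2 / (L * D) * ((1 - p) * \<psi> $ 0 - u' * \<psi> $ Suc 0)" "2 / (L * D) * ((1 + p) * \<psi> $ Suc 0 - u * \<psi> $ 0)"])
    show "bloch (l / 2) ((l / 2) *\<^sub>R s) $$ (0, 0) * (2 / (L * D) * ((1 - p) * \<psi> $ 0 - u' * \<psi> $ Suc 0))
       + bloch (l / 2) ((l / 2) *\<^sub>R s) $$ (0, Suc 0) * (2 / (L * D) * ((1 + p) * \<psi> $ Suc 0 - u * \<psi> $ 0)) = \<psi> $ 0"
      unfolding B using D0 by (simp add: divide_simps) (simp add: Deq algebra_simps)
    show "bloch (l / 2) ((l / 2) *\<^sub>R s) $$ (Suc 0, 0) * (2 / (L * D) * ((1 - p) * \<psi> $ 0 - u' * \<psi> $ Suc 0))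
       + bloch (l / 2) ((l / 2) *\<^sub>R s) $$ (Suc 0, Suc 0) * (2 / (L * D) * ((1 + p) * \<psi> $ Suc 0 - u * \<psi> $ 0)) = \<psi> $ Suc 0"
      unfolding B using D0 by (simp add: divide_simps) (simp add: Deq algebra_simps)
  qed
qed

text \<open>Writing \<open>A\<close> for \<open>l\<close> times the stabiliser mixture that dominates \<open>\<psi>\<psi>\<^sup>*\<close>, a solution \<open>x\<close> of
  \<open>A x = \<psi>\<close> yields the coefficients \<open>l q\<^sub>j \<langle>\<phi>\<^sub>j, x\<rangle>\<close>; testing \<open>\<psi>\<psi>\<^sup>* \<le> A\<close> on \<open>x\<close> bounds them.\<close>

lemma level_pure_decomposition:
  assumes \<psi>: "pure_bloch \<psi> z" and z: "norm z = 1" and lev: "in_level l q z" and l: "1 \<le> l"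
    and \<phi>: "\<And>j. j < 6 \<Longrightarrow> pure_bloch (\<phi> j) (octv j)"
  obtains c where "\<psi> = vsum 2 6 (\<lambda>j. c j \<cdot>\<^sub>v \<phi> j)" "(\<Sum>j<6. cmod (c j))\<^sup>2 \<le> l"
proof -
  define s where "s = (\<Sum>k<6. q k *\<^sub>R octv k)"
  define A where "A = bloch (l / 2) ((l / 2) *\<^sub>R s)"
  have q: "\<And>k. k < 6 \<Longrightarrow> 0 \<le> q k" "(\<Sum>k<6. q k) = 1" and d: "norm (z - l *\<^sub>R s) \<le> l - 1"
    using lev by (auto simp: in_level_def s_def)
  have "norm s \<le> (\<Sum>k<6. q k)"
    unfolding s_def by (rule order_trans[OF norm_sum], intro sum_mono) (use q norm_octv in auto)
  then have "norm s \<le> 1" using q(2) by simp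
  then obtain x0 x1 where x0: "A $$ (0, 0) * x0 + A $$ (0, Suc 0) * x1 = \<psi> $ 0"
    and x1: "A $$ (Suc 0, 0) * x0 + A $$ (Suc 0, Suc 0) * x1 = \<psi> $ Suc 0"
    unfolding A_def by (rule level_bloch_solve[OF \<psi> z _ d l])
  define f where "f j = cnj (\<phi> j $ 0) * x0 + cnj (\<phi> j $ Suc 0) * x1" for j
  define c where "c j = complex_of_real (l * q j) * f j" for j
  have Asum: "A $$ (i, k) = (\<Sum>j<6. complex_of_real (l * q j) * (\<phi> j $ i * cnj (\<phi> j $ k)))" if ik: "i < 2" "k < 2" for i k
  proof -
    have "(\<Sum>j<6. complex_of_real (l * q j) * (\<phi> j $ i * cnj (\<phi> j $ k)))
        = (\<Sum>j<6. complex_of_real (l * q j) * bloch (1 / 2) ((1 / 2) *\<^sub>R octv j) $$ (i, k))"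
      by (intro sum.cong refl) (simp add: pure_blochD(2)[OF \<phi> ik])
    also have "\<dots> = bloch (\<Sum>j<6. l * q j * (1 / 2)) (\<Sum>j<6. (l * q j) *\<^sub>R ((1 / 2) *\<^sub>R octv j)) $$ (i, k)"
      by (rule bloch_sum[OF ik])
    also have "(\<Sum>j<6. l * q j * (1 / 2)) = l / 2"
      using q(2) by (simp flip: sum_divide_distrib sum_distrib_left)
    also have "(\<Sum>j<6. (l * q j) *\<^sub>R ((1 / 2) *\<^sub>R octv j)) = (l / 2) *\<^sub>R s"
      by (simp add: s_def scaleR_sum_right)
    finally show ?thesis by (simp add: A_def)
  qed
  have cf: "(\<Sum>j<6. c j * \<phi> j $ i) = A $$ (i, 0) * x0 + A $$ (i, Suc 0) * x1" if "i < 2" for i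
    unfolding Asum[OF that zero_less_numeral] Asum[OF that less_2_cases_Suc[THEN iffD2, OF disjI2[OF refl]]]
      sum_distrib_right sum.distrib[symmetric]
    by (intro sum.cong refl) (simp add: c_def f_def algebra_simps)
  have 1: "\<psi> = vsum 2 6 (\<lambda>j. c j \<cdot>\<^sub>v \<phi> j)"
  proof (rule eq_vecI)
    fix i assume "i < dim_vec (vsum 2 6 (\<lambda>j. c j \<cdot>\<^sub>v \<phi> j))"
    then have i: "i < 2" by (simp add: vsum_def)
    have "vsum 2 6 (\<lambda>j. c j \<cdot>\<^sub>v \<phi> j) $ i = (\<Sum>j<6. c j * \<phi> j $ i)"
      using i by (auto simp: vsum_def carrier_vecD[OF pure_blochD(1)[OF \<phi>]] intro!: sum.cong)
    also have "\<dots> = \<psi> $ i" unfolding cf[OF i] using i x0 x1 by (auto simp: less_2_cases_Suc)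
    finally show "\<psi> $ i = vsum 2 6 (\<lambda>j. c j \<cdot>\<^sub>v \<phi> j) $ i" ..
  qed (use pure_blochD(1)[OF \<psi>] in \<open>auto simp: vsum_def\<close>)
  \<comment> \<open>This is the quadratic form of \<open>A\<close> at the solution x and, as A x =
    \<psi>, also the inner product of x with \<psi>.\<close>
  define K where "K = (\<Sum>j<6. l * q j * (cmod (f j))\<^sup>2)"
  have K0: "0 \<le> K" unfolding K_def using q(1) l by (intro sum_nonneg) auto
  have "complex_of_real K = (\<Sum>j<6. complex_of_real (l * q j) * (f j * cnj (f j)))"
    unfolding K_def of_real_sum of_real_mult[of "l * _"] complex_norm_square ..
  also have "\<dots> = (\<Sum>j<6. cnj x0 * (c j * \<phi> j $ 0) + cnj x1 * (c j * \<phi> j $ Suc 0))"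
    by (intro sum.cong refl) (simp add: c_def f_def algebra_simps)
  also have "\<dots> = cnj x0 * \<psi> $ 0 + cnj x1 * \<psi> $ Suc 0"
    unfolding sum.distrib sum_distrib_left[symmetric] using cf[of 0] cf[of "Suc 0"] x0 x1 by simp
  finally have K: "complex_of_real K = cnj x0 * \<psi> $ 0 + cnj x1 * \<psi> $ Suc 0" .
  define x where "x = vec 2 (\<lambda>i. if i = 0 then x0 else x1)"
  \<comment> \<open>This is \<open>A\<close> minus the projector onto \<psi>. Its positivity is
    exactly the level condition |l s - z| \<le> l - 1, and its form at \<open>x\<close> is K -
    K^2.\<close>
  define R where "R = bloch ((l - 1) / 2) ((1 / 2) *\<^sub>R (l *\<^sub>R s - z))"
  have Rij: "R $$ (i, j) = A $$ (i, j) - \<psi> $ i * cnj (\<psi> $ j)" if "i < 2" "j < 2" for i j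
    using that unfolding pure_blochD(2)[OF \<psi> that] less_2_cases_Suc R_def A_def
    by (auto simp: bloch_index_gen complex_eq_iff field_simps)
  have "bloch_form R x = cnj x0 * (A $$ (0, 0) * x0 + A $$ (0, Suc 0) * x1) + cnj x1 * (A $$ (Suc 0, 0) * x0 + A $$ (Suc 0, Suc 0) * x1)
      - (cnj x0 * \<psi> $ 0 + cnj x1 * \<psi> $ Suc 0) * cnj (cnj x0 * \<psi> $ 0 + cnj x1 * \<psi> $ Suc 0)"
    by (simp add: bloch_form_def sum_lessThan_2 x_def Rij algebra_simps)
  also have "\<dots> = complex_of_real (K - K * K)"
    unfolding x0 x1 K[symmetric] by simp
  finally have "K * K \<le> K"
    using bloch_form_nonneg[of "(1 / 2) *\<^sub>R (l *\<^sub>R s - z)" "(l - 1) / 2" x] d by (simp add: R_def norm_minus_commute)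
  then have K1: "K \<le> 1" using K0 by (cases "K = 0") (auto simp: mult_le_cancel_right1)
  \<comment> \<open>The split prepares Cauchy-Schwarz with weights \<open>l * q j\<close>, whose sum
    is \<open>l\<close>; the other factor becomes \<open>K\<close>.\<close>
  have "(\<Sum>j<6. cmod (c j)) = (\<Sum>j<6. sqrt (l * q j) * (sqrt (l * q j) * cmod (f j)))"
  proof (intro sum.cong refl)
    fix j :: nat assume "j \<in> {..<6}"
    then have "0 \<le> l * q j" using q(1) l by simp
    then show "cmod (c j) = sqrt (l * q j) * (sqrt (l * q j) * cmod (f j))"
      by (simp add: c_def norm_mult mult.assoc[symmetric] del: of_real_mult) 
  qed
  then have "(\<Sum>j<6. cmod (c j))\<^sup>2 \<le> (\<Sum>j<6. (sqrt (l * q j))\<^sup>2) * (\<Sum>j<6. (sqrt (l * q j) * cmod (f j))\<^sup>2)"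
    using Cauchy_Schwarz_ineq_sum by metis
  also have "(\<Sum>j<6. (sqrt (l * q j))\<^sup>2) = (\<Sum>j<6. l * q j)"
    using q(1) l by (intro sum.cong) auto
  also have "\<dots> = l" using q(2) by (simp flip: sum_distrib_left)
  also have "(\<Sum>j<6. (sqrt (l * q j) * cmod (f j))\<^sup>2) = K"
    unfolding K_def using q(1) l by (intro sum.cong refl) (simp add: power_mult_distrib)
  also have "l * K \<le> l * 1" using K1 l by (intro mult_left_mono) auto
  finally have "(\<Sum>j<6. cmod (c j))\<^sup>2 \<le> l" by simp
  with 1 show ?thesis by (rule that)
qed

text \<open>For |w| = 1 the square of I + w \<cdot> \<sigma> is twice itself, so x (I + w \<cdot>
  \<sigma>) with 2 x^2 = a is a root of a (I + w \<cdot> \<sigma>), where a = 1 / (1 + linf w). For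
  w = 0 the hypothesis says l \<le> 1 and the identity serves.\<close>

lemma witness_exists:
  assumes w: "w = 0 \<or> norm w = 1" and l: "l * (1 + linf w) \<le> 1 + inner w r"
  obtains B v where "qubit_witness B" "sandwich B (bloch (1 / 2) ((1 / 2) *\<^sub>R r)) = complex_of_real v" "l \<le> v"
proof -
  obtain r1 r2 r3 where r: "r = (r1, r2, r3)" by (cases r)
  show ?thesis
  proof (cases "w = 0")
    case True
    have "qubit_witness (bloch 1 (0, 0, 0))"
      unfolding qubit_witness_def by (intro exI[of _ 1] exI[of _ 0]) simp
    moreover have "sandwich (bloch 1 (0, 0, 0)) (bloch (1 / 2) ((1 / 2) *\<^sub>R r)) = complex_of_real 1"
      by (simp add: r sandwich_bloch)
    moreover have "l \<le> 1" using l True linf_zero by simp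
    ultimately show ?thesis by (rule that)
  next
    case False
    obtain w1 w2 w3 where we: "w = (w1, w2, w3)" by (cases w)
    have n: "w1\<^sup>2 + w2\<^sup>2 + w3\<^sup>2 = 1" using w False norm_vec3_sq[of w1 w2 w3] by (simp add: we)
    define a where "a = 1 / (1 + linf w)"
    have a: "0 < a" "a * (1 + linf w) = 1" using linf_nonneg[of w] by (auto simp: a_def)
    define x where "x = sqrt (a / 2)"
    have x: "x * x = a / 2" using a by (simp add: x_def)
    define B where "B = bloch x (x * w1, x * w2, x * w3)"
    have A0: "x\<^sup>2 + (x * w1)\<^sup>2 + (x * w2)\<^sup>2 + (x * w3)\<^sup>2 = a"
    proof -
      have "x\<^sup>2 + (x * w1)\<^sup>2 + (x * w2)\<^sup>2 + (x * w3)\<^sup>2 = (x * x) * (1 + (w1\<^sup>2 + w2\<^sup>2 + w3\<^sup>2))"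
        by (simp add: power2_eq_square algebra_simps)
      then show ?thesis by (simp add: n x)
    qed
    have *: "a + 2 * \<bar>x * (x * v)\<bar> \<le> 1" if "v \<in> {w1, w2, w3}" for v
    proof -
      have "\<bar>v\<bar> \<le> linf w" using that by (auto simp: linf_def we)
      then have "a * \<bar>v\<bar> \<le> a * linf w" using a(1) by simp
      moreover have "2 * \<bar>x * (x * v)\<bar> = a * \<bar>v\<bar>"
        using a(1) by (simp add: mult.assoc[symmetric] x abs_mult)
      ultimately show ?thesis using a(2) by (simp add: algebra_simps)
    qed
    have "qubit_witness B"
      unfolding qubit_witness_def B_def
    proof (rule exI[of _ x], rule exI[of _ "x * w1"], rule exI[of _ "x * w2"], rule exI[of _ "x * w3"], intro conjI refl ballI)
      fix y assume "y \<in> {x * w1, x * w2, x * w3}"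
      then obtain v where "v \<in> {w1, w2, w3}" "y = x * v" by auto
      then show "x\<^sup>2 + (x * w1)\<^sup>2 + (x * w2)\<^sup>2 + (x * w3)\<^sup>2 + 2 * \<bar>x * y\<bar> \<le> 1" unfolding A0 using *[of v] by simp
    qed
    moreover have "sandwich B (bloch (1 / 2) ((1 / 2) *\<^sub>R r)) = complex_of_real (a * (1 + inner w r))"
    proof -
      have "2 * (1 / 2) * (x\<^sup>2 + (x * w1)\<^sup>2 + (x * w2)\<^sup>2 + (x * w3)\<^sup>2) +
          4 * x * (x * w1 * (r1 / 2) + x * w2 * (r2 / 2) + x * w3 * (r3 / 2)) = a + 2 * (x * x) * inner w r"
        unfolding A0 by (simp add: we r algebra_simps)
      then have "sandwich B (bloch (1 / 2) (r1 / 2, r2 / 2, r3 / 2)) = complex_of_real (a + 2 * (x * x) * inner w r)"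
        unfolding B_def sandwich_bloch by (rule arg_cong)
      also have "a + 2 * (x * x) * inner w r = a * (1 + inner w r)" unfolding x by (simp add: algebra_simps)
      finally show ?thesis by (simp add: r)
    qed
    moreover have "l \<le> a * (1 + inner w r)"
    proof -
      have "l = l * (a * (1 + linf w))" unfolding a(2) by simp
      also have "\<dots> = a * (l * (1 + linf w))" by (rule mult.left_commute)
      also have "\<dots> \<le> a * (1 + inner w r)" using l a(1) by (intro mult_left_mono) auto
      finally show ?thesis .
    qed
    ultimately show ?thesis by (rule that)
  qed
qed

section \<open>Products of stabiliser states\<close>

text \<open>A one-qubit stabiliser state presented by the nontrivial element
  \<open>e \<cdot>\<^sub>m P\<close> of its group, the form in which it is tensored onto further
  qubits.\<close>

definition qubit_stab :: "complex vec \<Rightarrow> bool" where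
  "qubit_stab \<phi> \<longleftrightarrow> unit_vec 1 \<phi> \<and> (\<exists>P e. P \<in> paulis \<and> P \<noteq> pauli_I \<and> (e = 1 \<or> e = -1) \<and> (e \<cdot>\<^sub>m P) *\<^sub>v \<phi> = \<phi>)"

lemma qubit_stabI:
  assumes "unit_vec 1 \<phi>" "j < 6" "bloch 0 (octv j) *\<^sub>v \<phi> = \<phi>"
  shows "qubit_stab \<phi>"
proof -
  have "\<exists>P e. P \<in> paulis \<and> P \<noteq> pauli_I \<and> (e = 1 \<or> e = -1) \<and> bloch 0 (octv j) = e \<cdot>\<^sub>m P"
  proof -
    have eq: "bloch 0 (a, b, c) = complex_of_real e \<cdot>\<^sub>m bloch 0 (x, y, z)"
      if "a = e * x" "b = e * y" "c = e * z" for a b c x y z e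
      using that by (intro mat2_eqI) (auto simp: complex_eq_iff carrier_matD[OF bloch_carrier])
    have "j \<in> {..<6}" using assms(2) by simp
    then consider "octv j = (1, 0, 0)" | "octv j = (-1, 0, 0)" | "octv j = (0, 1, 0)" | "octv j = (0, -1, 0)"
      | "octv j = (0, 0, 1)" | "octv j = (0, 0, -1)"
      unfolding lessThan_6 by (auto simp: octv_def)
    then show ?thesis
    proof cases
      case 1
      then have "bloch 0 (octv j) = (1) \<cdot>\<^sub>m pauli_X" using eq[of 1 1 1 0 0 0 0] by (simp add: pauli_eq_bloch)
      then show ?thesis using pauli_in_paulis paulis_distinct by metis
    next
      case 2
      then have "bloch 0 (octv j) = (-1) \<cdot>\<^sub>m pauli_X" using eq[of "-1" "-1" 1 0 0 0 0] by (simp add: pauli_eq_bloch)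
      then show ?thesis using pauli_in_paulis paulis_distinct by metis
    next
      case 3
      then have "bloch 0 (octv j) = (1) \<cdot>\<^sub>m pauli_Y" using eq[of 0 1 0 1 1 0 0] by (simp add: pauli_eq_bloch)
      then show ?thesis using pauli_in_paulis paulis_distinct by metis
    next
      case 4
      then have "bloch 0 (octv j) = (-1) \<cdot>\<^sub>m pauli_Y" using eq[of 0 "-1" 0 "-1" 1 0 0] by (simp add: pauli_eq_bloch)
      then show ?thesis using pauli_in_paulis paulis_distinct by metis
    next
      case 5
      then have "bloch 0 (octv j) = (1) \<cdot>\<^sub>m pauli_Z" using eq[of 0 1 0 0 0 1 1] by (simp add: pauli_eq_bloch)
      then show ?thesis using pauli_in_paulis paulis_distinct by metis
    next
      case 6
      then have "bloch 0 (octv j) = (-1) \<cdot>\<^sub>m pauli_Z" using eq[of 0 "-1" 0 0 0 "-1" 1] by (simp add: pauli_eq_bloch)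
      then show ?thesis using pauli_in_paulis paulis_distinct by metis
    qed
  qed
  then show ?thesis unfolding qubit_stab_def using assms(1,3) by metis
qed

lemma mult_mat_vec_2_index:
  "A \<in> carrier_mat 2 2 \<Longrightarrow> v \<in> carrier_vec 2 \<Longrightarrow> i < 2 \<Longrightarrow> (A *\<^sub>v v) $ i = A $$ (i, 0) * v $ 0 + A $$ (i, Suc 0) * v $ Suc 0"
  using mult_mat_vec_index_sum[of A 2 2 v i] by (simp add: sum_lessThan_2)

text \<open>Twice the projector onto \<phi> minus the identity is the Pauli matrix along the Bloch
  vector, here a signed axis, and it fixes \<phi>.\<close>

lemma pure_bloch_qubit_stab:
  assumes "pure_bloch \<phi> (octv j)" "j < 6"
  shows "qubit_stab \<phi>"
proof (rule qubit_stabI[OF pure_blochD(3)[OF assms(1)] assms(2)])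
  note c = pure_blochD(1)[OF assms(1)]
  have e: "bloch 0 (octv j) $$ (i, k) = 2 * (\<phi> $ i * cnj (\<phi> $ k)) - (if i = k then 1 else 0)" if "i < 2" "k < 2" for i k
    using that unfolding pure_blochD(2)[OF assms(1) that] less_2_cases_Suc
    by (auto simp: bloch_index_gen complex_eq_iff)
  have s: "2 * \<phi> $ i * (\<phi> $ 0 * cnj (\<phi> $ 0) + \<phi> $ Suc 0 * cnj (\<phi> $ Suc 0)) = 2 * \<phi> $ i" for i
    unfolding pure_blochD(4)[OF assms(1)] by simp
  show "bloch 0 (octv j) *\<^sub>v \<phi> = \<phi>"
  proof (rule vec2_eqI)
    show "(bloch 0 (octv j) *\<^sub>v \<phi>) $ 0 = \<phi> $ 0"
      using s[of 0] by (simp add: mult_mat_vec_2_index[OF bloch_carrier c] e algebra_simps del: index_mult_mat_vec)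
    show "(bloch 0 (octv j) *\<^sub>v \<phi>) $ Suc 0 = \<phi> $ Suc 0"
      using s[of "Suc 0"] by (simp add: mult_mat_vec_2_index[OF bloch_carrier c] e algebra_simps del: index_mult_mat_vec)
  qed (use c in \<open>auto intro!: mult_mat_vec_carrier[OF bloch_carrier]\<close>)
qed

lemma stab_states_carrier: "\<phi> \<in> stab_states n \<Longrightarrow> \<phi> \<in> carrier_vec (2 ^ n)"
  by (simp add: stab_states_def unit_vec_def)

lemma stab_states_0: "vec 1 (\<lambda>_. 1) \<in> stab_states 0"
proof -
  have "1\<^sub>m 1 \<in> pauli_group 0" unfolding pauli_group_0 using one_smult_mat[of "1\<^sub>m 1"] by (auto intro!: exI[of _ 0])
  then have "abelian_pauli_subgroup 0 {1\<^sub>m 1}" by (simp add: abelian_pauli_subgroup_def)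
  moreover have "1\<^sub>m 1 *\<^sub>v vec 1 (\<lambda>_. 1 :: complex) = vec 1 (\<lambda>_. 1)" by (rule one_mult_mat_vec) simp
  ultimately show ?thesis
    unfolding stab_states_def by (auto simp: unit_vec_def intro!: exI[of _ "{1\<^sub>m 1}"])
qed

lemma abelian_pauli_subgroupD:
  assumes "abelian_pauli_subgroup n G"
  shows "G \<subseteq> pauli_group n" "1\<^sub>m (2 ^ n) \<in> G" "\<forall>g\<in>G. \<forall>h\<in>G. g * h \<in> G"
    "\<forall>g\<in>G. \<exists>h\<in>G. g * h = 1\<^sub>m (2 ^ n)" "\<forall>g\<in>G. \<forall>h\<in>G. g * h = h * g"
  using assms unfolding abelian_pauli_subgroup_def by simp_all

text \<open>The stabiliser group of the product is the product of the two-element group of \<phi>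
  with the group of \<psi>.\<close>

lemma stab_states_kronv:
  assumes "qubit_stab \<phi>" "\<psi> \<in> stab_states n"
  shows "kronv \<phi> \<psi> \<in> stab_states (Suc n)"
proof -
  let ?d = "2 ^ n :: nat"
  obtain P e where P: "P \<in> paulis" "P \<noteq> pauli_I" "e = 1 \<or> e = -1" "(e \<cdot>\<^sub>m P) *\<^sub>v \<phi> = \<phi>" and u: "unit_vec 1 \<phi>"
    using assms(1) by (auto simp: qubit_stab_def)
  obtain H where H: "abelian_pauli_subgroup n H" "card H = ?d" and fix_H: "\<And>h. h \<in> H \<Longrightarrow> h *\<^sub>v \<psi> = \<psi>" and u': "unit_vec n \<psi>"
    using assms(2) by (auto simp: stab_states_def)
  note Hd = abelian_pauli_subgroupD[OF H(1)]
  have Hc: "h \<in> carrier_mat ?d ?d" if "h \<in> H" for h using pauli_group_carrier[OF subsetD[OF Hd(1) that]] .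
  \<comment> \<open>Signs are stored beside the Pauli matrices and moved into the second factor, so
    that \<open>kron_pauli_cancel\<close>, which needs unsigned first factors, yields injectivity
    and the group order.\<close>
  define X where "X = {(pauli_I, 1 :: complex), (P, e)}"
  define F where "F = (\<lambda>((Q, t), h). kron Q (t \<cdot>\<^sub>m h))"
  define G where "G = F ` (X \<times> H)"
  have ee: "e * e = 1" using P(3) by auto
  have one: "pauli_I * Q = Q" "Q * pauli_I = Q" if "Q \<in> paulis" for Q
    using pauli_carrier[OF that] by (auto simp: pauli_I_eq_one)
  have PP: "P * P = pauli_I" using pauli_square[OF P(1)] by (simp add: pauli_I_eq_one)
  have X: "Q \<in> paulis" "t = 1 \<or> t = -1" if "(Q, t) \<in> X" for Q t
    using that P by (auto simp: X_def)
  have XX: "(Q * R, t * v) \<in> X" "R * Q = Q * R" if "(Q, t) \<in> X" "(R, v) \<in> X" for Q t R v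
    using that P(1) one ee PP by (auto simp: X_def)
  have Gin: "kron Q (t \<cdot>\<^sub>m h) \<in> G" if "(Q, t) \<in> X" "h \<in> H" for Q t h
    unfolding G_def F_def using that by (intro image_eqI[of _ _ "((Q, t), h)"]) auto
  have Gex: "\<exists>Q t h. g = kron Q (t \<cdot>\<^sub>m h) \<and> (Q, t) \<in> X \<and> h \<in> H" if "g \<in> G" for g
    using that by (auto simp: G_def F_def)
  have mult: "kron Q (t \<cdot>\<^sub>m g) * kron R (v \<cdot>\<^sub>m h) = kron (Q * R) ((t * v) \<cdot>\<^sub>m (g * h))"
    if "(Q, t) \<in> X" "(R, v) \<in> X" "g \<in> H" "h \<in> H" for Q t R v g h
    using kron_smult_pauli_mult[OF X(1)[OF that(1)] X(1)[OF that(2)] Hc[OF that(3)] Hc[OF that(4)]] .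
  have closed: "g * h \<in> G \<and> g * h = h * g" if gh: "g \<in> G" "h \<in> G" for g h
  proof -
    obtain Q t g' where g: "g = kron Q (t \<cdot>\<^sub>m g')" "(Q, t) \<in> X" "g' \<in> H" using Gex[OF gh(1)] by metis
    obtain R v h' where h: "h = kron R (v \<cdot>\<^sub>m h')" "(R, v) \<in> X" "h' \<in> H" using Gex[OF gh(2)] by metis
    have "g' * h' \<in> H" "g' * h' = h' * g'" using bspec[OF bspec[OF Hd(3) g(3)] h(3)] bspec[OF bspec[OF Hd(5) g(3)] h(3)] .
    then show ?thesis
      using mult[OF g(2) h(2) g(3) h(3)] mult[OF h(2) g(2) h(3) g(3)] XX[OF g(2) h(2)] Gin[OF XX(1)[OF g(2) h(2)]]
      by (simp add: g(1) h(1) mult.commute)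
  qed
  have inv: "\<exists>h\<in>G. g * h = 1\<^sub>m (2 ^ Suc n)" if gG: "g \<in> G" for g
  proof -
    obtain Q t g' where g: "g = kron Q (t \<cdot>\<^sub>m g')" "(Q, t) \<in> X" "g' \<in> H" using Gex[OF gG] by metis
    obtain h' where h: "h' \<in> H" "g' * h' = 1\<^sub>m ?d" using bspec[OF Hd(4) g(3)] by (elim bexE)
    have "g * kron Q (t \<cdot>\<^sub>m h') = kron (1\<^sub>m 2) (1 \<cdot>\<^sub>m 1\<^sub>m ?d)"
      using mult[OF g(2) g(2) g(3) h(1)] pauli_square[OF X(1)[OF g(2)]] X(2)[OF g(2)] by (auto simp: g(1) h(2))
    also have "\<dots> = 1\<^sub>m (2 ^ Suc n)" using kron_one_one[of 2 ?d] by (simp add: one_smult_mat)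
    finally show ?thesis using Gin[OF g(2) h(1)] by (rule bexI)
  qed
  have "G \<subseteq> pauli_group (Suc n)"
  proof
    fix g assume "g \<in> G"
    then obtain Q t h where g: "g = kron Q (t \<cdot>\<^sub>m h)" "(Q, t) \<in> X" "h \<in> H" using Gex by metis
    then show "g \<in> pauli_group (Suc n)"
      unfolding pauli_group_Suc g(1)
      using X(1)[OF g(2)] pauli_group_smult_sign[OF subsetD[OF Hd(1) g(3)] X(2)[OF g(2)]] by blast
  qed
  moreover have "1\<^sub>m (2 ^ Suc n) \<in> G"
    using Gin[of pauli_I 1 "1\<^sub>m ?d"] Hd(2) kron_one_one[of 2 ?d] by (simp add: X_def one_smult_mat pauli_I_eq_one)
  ultimately have "abelian_pauli_subgroup (Suc n) G"
    unfolding abelian_pauli_subgroup_def using closed inv by (intro conjI ballI) simp_all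
  moreover have "card G = 2 ^ Suc n"
  proof -
    have "inj_on F (X \<times> H)"
    proof (rule inj_onI)
      fix x y assume xy: "x \<in> X \<times> H" "y \<in> X \<times> H" "F x = F y"
      obtain Q t g where x: "x = ((Q, t), g)" by (metis prod.exhaust)
      obtain R v h where y: "y = ((R, v), h)" by (metis prod.exhaust)
      have m: "(Q, t) \<in> X" "(R, v) \<in> X" "g \<in> H" "h \<in> H" using xy by (auto simp: x y)
      have "Q = R" "t \<cdot>\<^sub>m g = v \<cdot>\<^sub>m h"
        using kron_pauli_cancel[OF X(1)[OF m(1)] X(1)[OF m(2)] pauli_group_smult_sign[OF subsetD[OF Hd(1) m(3)] X(2)[OF m(1)]], of "v \<cdot>\<^sub>m h"]
          xy(3) Hc[OF m(4)] by (auto simp: x y F_def)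
      moreover have "t = v" using m(1,2) \<open>Q = R\<close> P(2) by (auto simp: X_def)
      moreover have "g = h" using smult_inverse_sign[OF X(2)[OF m(1)]] \<open>t \<cdot>\<^sub>m g = v \<cdot>\<^sub>m h\<close> \<open>t = v\<close> by metis
      ultimately show "x = y" by (simp add: x y)
    qed
    then have "card G = card X * card H" by (simp add: G_def card_image card_cartesian_product)
    also have "card X = 2" using P(2) by (auto simp: X_def)
    finally show ?thesis using H(2) by simp
  qed
  moreover have "g *\<^sub>v kronv \<phi> \<psi> = kronv \<phi> \<psi>" if gG: "g \<in> G" for g
  proof -
    obtain Q t h where g: "g = kron Q (t \<cdot>\<^sub>m h)" "(Q, t) \<in> X" "h \<in> H" using Gex[OF gG] by metis
    have "g = kron (t \<cdot>\<^sub>m Q) h" by (simp add: g(1) kron_smult_left kron_smult_right)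
    moreover have "\<phi> \<in> carrier_vec 2" "\<psi> \<in> carrier_vec ?d" using u u' by (auto simp: unit_vec_def)
    ultimately have "g *\<^sub>v kronv \<phi> \<psi> = kronv ((t \<cdot>\<^sub>m Q) *\<^sub>v \<phi>) (h *\<^sub>v \<psi>)"
      using kron_mult_kronv[of "t \<cdot>\<^sub>m Q" 2 2 h ?d ?d] pauli_carrier[OF X(1)[OF g(2)]] Hc[OF g(3)] by simp
    moreover have "(t \<cdot>\<^sub>m Q) *\<^sub>v \<phi> = \<phi>"
      using g(2) P(4) \<open>\<phi> \<in> carrier_vec 2\<close> by (auto simp: X_def one_smult_mat pauli_I_eq_one)
    ultimately show ?thesis using fix_H[OF g(3)] by simp
  qed
  ultimately show ?thesis using unit_vec_kronv[OF u u'] by (auto simp: stab_states_def)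
qed

text \<open>A basis vector is a product of eigenvectors of Z; the leading binary digit of
  \<open>i\<close> selects the first factor.\<close>

lemma basis_vec_stab: "i < 2 ^ n \<Longrightarrow> vec (2 ^ n) (\<lambda>k. if k = i then 1 else 0) \<in> stab_states n"
proof (induction n arbitrary: i)
  case 0
  have "vec 1 (\<lambda>k. if k = i then 1 else 0 :: complex) = vec 1 (\<lambda>_. 1)" using 0 by (intro eq_vecI) auto
  then show ?case using stab_states_0 by simp
next
  case (Suc n)
  let ?b = "\<lambda>d i. vec d (\<lambda>k. if k = i then 1 else 0 :: complex)"
  have i: "i < 2 * 2 ^ n" using Suc.prems by simp
  note d = less_mult_div_mod[OF i]
  have "qubit_stab (?b 2 j)" if "j < 2" for j
  proof (rule qubit_stabI)
    show "unit_vec 1 (?b 2 j)" using that by (auto simp: unit_vec_def sum_lessThan_2 less_2_cases_Suc)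
    show "(if j = 0 then 4 else 5) < (6::nat)" by simp
    show "bloch 0 (octv (if j = 0 then 4 else 5)) *\<^sub>v ?b 2 j = ?b 2 j"
      using that unfolding less_2_cases_Suc
      by (intro vec2_eqI mult_mat_vec_carrier[OF bloch_carrier])
        (auto simp: mult_mat_vec_2_index[OF bloch_carrier] octv_def complex_eq_iff simp del: index_mult_mat_vec)
  qed
  then have "kronv (?b 2 (i div 2 ^ n)) (?b (2 ^ n) (i mod 2 ^ n)) \<in> stab_states (Suc n)"
    using stab_states_kronv[OF _ Suc.IH[OF d(2)]] d(1) by simp
  also have "kronv (?b 2 (i div 2 ^ n)) (?b (2 ^ n) (i mod 2 ^ n)) = ?b (2 ^ Suc n) i"
  proof (rule eq_vecI)
    fix k assume "k < dim_vec (?b (2 ^ Suc n) i)"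
    then have k: "k < 2 * 2 ^ n" by simp
    have "k = i \<longleftrightarrow> k div 2 ^ n = i div 2 ^ n \<and> k mod 2 ^ n = i mod 2 ^ n" by (metis div_mult_mod_eq)
    then show "kronv (?b 2 (i div 2 ^ n)) (?b (2 ^ n) (i mod 2 ^ n)) $ k = ?b (2 ^ Suc n) i $ k"
      using kronv_index[of "?b 2 (i div 2 ^ n)" 2 "?b (2 ^ n) (i mod 2 ^ n)" "2 ^ n" k] k less_mult_div_mod[OF k] by auto
  qed (simp add: kronv_def)
  finally show ?case .
qed

text \<open>Makes the set in \<open>stab_extent\<close> nonempty, without which its infimum could
  not be bounded below.\<close>

lemma stab_states_span:
  assumes "\<Psi> \<in> carrier_vec (2 ^ n)"
  obtains c \<phi> where "\<forall>k<2 ^ n. \<phi> k \<in> stab_states n" "\<Psi> = vsum (2 ^ n) (2 ^ n) (\<lambda>k. c k \<cdot>\<^sub>v \<phi> k)"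
proof
  show "\<forall>k<2 ^ n. vec (2 ^ n) (\<lambda>i. if i = k then 1 else 0) \<in> stab_states n" using basis_vec_stab by simp
  show "\<Psi> = vsum (2 ^ n) (2 ^ n) (\<lambda>k. \<Psi> $ k \<cdot>\<^sub>v vec (2 ^ n) (\<lambda>i. if i = k then 1 else 0))"
    using assms by (intro eq_vecI) (auto simp: vsum_def if_distrib[of "\<lambda>x. _ * x"] cong: if_cong)
qed

section \<open>Matching upper and lower bounds\<close>

lemma msum_carrier [simp]: "msum d N f \<in> carrier_mat d d"
  by (simp add: msum_def)

lemma msum_smult_index:
  assumes "i < d" "j < d" "\<And>k. k < N \<Longrightarrow> F k \<in> carrier_mat d d"
  shows "msum d N (\<lambda>k. c k \<cdot>\<^sub>m F k) $$ (i, j) = (\<Sum>k<N. c k * F k $$ (i, j))"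
proof -
  have "(c k \<cdot>\<^sub>m F k) $$ (i, j) = c k * F k $$ (i, j)" if "k < N" for k
    using carrier_matD[OF assms(3)[OF that]] assms(1,2) by simp
  then show ?thesis using assms(1,2) by (simp add: msum_def)
qed

lemma vsum_smult_index:
  assumes "i < d" "\<And>k. k < N \<Longrightarrow> \<phi> k \<in> carrier_vec d"
  shows "vsum d N (\<lambda>k. c k \<cdot>\<^sub>v \<phi> k) $ i = (\<Sum>k<N. c k * \<phi> k $ i)"
proof -
  have "(c k \<cdot>\<^sub>v \<phi> k) $ i = c k * \<phi> k $ i" if "k < N" for k
    using carrier_vecD[OF assms(2)[OF that]] assms(1) by simp
  then show ?thesis using assms(1) by (simp add: vsum_def)
qed

lemma vsum_carrier [simp]: "vsum d N f \<in> carrier_vec d"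
  by (simp add: vsum_def)

lemma sandwich_msum:
  assumes "B \<in> carrier_mat d d" "\<And>k. k < N \<Longrightarrow> F k \<in> carrier_mat d d"
  shows "sandwich B (msum d N (\<lambda>k. c k \<cdot>\<^sub>m F k)) = (\<Sum>k<N. c k * sandwich B (F k))"
  by (rule sandwich_linear[OF assms(1) msum_carrier]) (use assms msum_smult_index in auto)

lemma outer_vsum_index:
  assumes "i < d" "j < d" "\<And>k. k < M \<Longrightarrow> \<phi> k \<in> carrier_vec d"
  shows "outer (vsum d M (\<lambda>k. c k \<cdot>\<^sub>v \<phi> k)) (vsum d M (\<lambda>k. c k \<cdot>\<^sub>v \<phi> k)) $$ (i, j)
    = (\<Sum>a<M. \<Sum>b<M. c a * cnj (c b) * outer (\<phi> a) (\<phi> b) $$ (i, j))"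
proof -
  have "outer (vsum d M (\<lambda>k. c k \<cdot>\<^sub>v \<phi> k)) (vsum d M (\<lambda>k. c k \<cdot>\<^sub>v \<phi> k)) $$ (i, j)
      = (\<Sum>k<M. c k * \<phi> k $ i) * cnj (\<Sum>k<M. c k * \<phi> k $ j)"
    using outer_index[OF vsum_carrier vsum_carrier assms(1,2)]
      vsum_smult_index[where \<phi> = \<phi>, OF assms(1) assms(3)] vsum_smult_index[where \<phi> = \<phi>, OF assms(2) assms(3)] by simp
  also have "\<dots> = (\<Sum>a<M. \<Sum>b<M. c a * cnj (c b) * outer (\<phi> a) (\<phi> b) $$ (i, j))"
    unfolding cnj_sum sum_product
    by (intro sum.cong refl) (use assms in \<open>simp add: outer_index[where a = d and b = d]\<close>)
  finally show ?thesis .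
qed

section \<open>Lower bounds from a witness\<close>

definition stab_witness :: "nat \<Rightarrow> complex mat \<Rightarrow> bool" where
  "stab_witness n B \<longleftrightarrow> herm (2 ^ n) B \<and> (\<forall>\<phi>\<in>stab_states n. norm_sq (B *\<^sub>v \<phi>) \<le> 1)"

text \<open>This is the squared triangle inequality for the seminorm \<open>B\<close> induces,
  obtained by expanding the projector into dyads of stabiliser states.\<close>

lemma witness_vsum_le:
  assumes B: "stab_witness n B" and \<phi>: "\<And>k. k < M \<Longrightarrow> \<phi> k \<in> stab_states n"
  shows "norm_sq (B *\<^sub>v vsum (2 ^ n) M (\<lambda>k. c k \<cdot>\<^sub>v \<phi> k)) \<le> (\<Sum>k<M. cmod (c k))\<^sup>2"
proof -
  let ?\<Psi> = "vsum (2 ^ n) M (\<lambda>k. c k \<cdot>\<^sub>v \<phi> k)"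
  let ?I = "{..<M} \<times> {..<M}"
  have h: "herm (2 ^ n) B" and b: "\<And>\<phi>. \<phi> \<in> stab_states n \<Longrightarrow> norm_sq (B *\<^sub>v \<phi>) \<le> 1"
    using B by (auto simp: stab_witness_def)
  note c = stab_states_carrier[OF \<phi>]
  have "sandwich B (outer ?\<Psi> ?\<Psi>) = (\<Sum>x\<in>?I. (c (fst x) * cnj (c (snd x))) * sandwich B (outer (\<phi> (fst x)) (\<phi> (snd x))))"
  proof (rule sandwich_linear[OF herm_carrier[OF h]])
    fix i j :: nat assume ij: "i < 2 ^ n" "j < 2 ^ n"
    have "outer ?\<Psi> ?\<Psi> $$ (i, j) = (\<Sum>a<M. \<Sum>b<M. c a * cnj (c b) * outer (\<phi> a) (\<phi> b) $$ (i, j))"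
      by (rule outer_vsum_index[OF ij]) (rule c)
    then show "outer ?\<Psi> ?\<Psi> $$ (i, j) = (\<Sum>x\<in>?I. (c (fst x) * cnj (c (snd x))) * outer (\<phi> (fst x)) (\<phi> (snd x)) $$ (i, j))"
      by (simp add: sum.cartesian_product case_prod_beta)
  next
    fix x assume "x \<in> ?I"
    then have "fst x < M" "snd x < M" by (auto simp: mem_Times_iff)
    then show "outer (\<phi> (fst x)) (\<phi> (snd x)) \<in> carrier_mat (2 ^ n) (2 ^ n)" by (intro outer_carrier c)
  qed (rule outer_carrier[OF vsum_carrier vsum_carrier])
  moreover have "0 \<le> norm_sq (B *\<^sub>v ?\<Psi>)" by (simp only: norm_sq_def sum_nonneg zero_le_power2)
  ultimately have "norm_sq (B *\<^sub>v ?\<Psi>) = cmod (\<Sum>x\<in>?I. (c (fst x) * cnj (c (snd x))) * sandwich B (outer (\<phi> (fst x)) (\<phi> (snd x))))"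
    unfolding sandwich_outer_self[OF h vsum_carrier]
    by (metis abs_of_nonneg norm_of_real)
  also have "\<dots> \<le> (\<Sum>x\<in>?I. cmod (c (fst x)) * cmod (c (snd x)))"
  proof (rule sum_norm_le)
    fix x assume x: "x \<in> ?I"
    then have "cmod (sandwich B (outer (\<phi> (fst x)) (\<phi> (snd x)))) \<le> 1"
      by (intro cmod_sandwich_outer_le[OF h] c b \<phi>) auto
    then show "cmod (c (fst x) * cnj (c (snd x)) * sandwich B (outer (\<phi> (fst x)) (\<phi> (snd x)))) \<le> cmod (c (fst x)) * cmod (c (snd x))"
      by (simp add: norm_mult mult_left_le)
  qed
  also have "\<dots> = (\<Sum>k<M. cmod (c k))\<^sup>2"
    unfolding power2_eq_square sum_product sum.cartesian_product by (simp add: case_prod_beta)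
  finally show ?thesis .
qed

lemma stab_extent_le:
  assumes "\<And>k. k < M \<Longrightarrow> \<phi> k \<in> stab_states n" "\<Psi> = vsum (2 ^ n) M (\<lambda>k. c k \<cdot>\<^sub>v \<phi> k)"
  shows "stab_extent n \<Psi> \<le> (\<Sum>k<M. cmod (c k))\<^sup>2"
  unfolding stab_extent_def by (rule cInf_lower) (use assms in \<open>auto intro!: bdd_belowI[of _ 0]\<close>)

lemma stab_extent_ge:
  assumes B: "stab_witness n B" and \<Psi>: "\<Psi> \<in> carrier_vec (2 ^ n)"
  shows "norm_sq (B *\<^sub>v \<Psi>) \<le> stab_extent n \<Psi>"
  unfolding stab_extent_def
proof (rule cInf_greatest)
  obtain c \<phi> where "\<forall>k<2 ^ n. \<phi> k \<in> stab_states n" "\<Psi> = vsum (2 ^ n) (2 ^ n) (\<lambda>k. c k \<cdot>\<^sub>v \<phi> k)"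
    using stab_states_span[OF \<Psi>] .
  then show "{(\<Sum>k<N. cmod (c k))\<^sup>2 | N c \<phi>. (\<forall>k<N. \<phi> k \<in> stab_states n) \<and> \<Psi> = vsum (2 ^ n) N (\<lambda>k. c k \<cdot>\<^sub>v \<phi> k)} \<noteq> {}"
    by blast
next
  fix x assume "x \<in> {(\<Sum>k<N. cmod (c k))\<^sup>2 | N c \<phi>. (\<forall>k<N. \<phi> k \<in> stab_states n) \<and> \<Psi> = vsum (2 ^ n) N (\<lambda>k. c k \<cdot>\<^sub>v \<phi> k)}"
  then obtain N c \<phi> where *: "x = (\<Sum>k<N. cmod (c k))\<^sup>2" "\<And>k. k < N \<Longrightarrow> \<phi> k \<in> stab_states n"
    "\<Psi> = vsum (2 ^ n) N (\<lambda>k. c k \<cdot>\<^sub>v \<phi> k)" by auto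
  show "norm_sq (B *\<^sub>v \<Psi>) \<le> x" unfolding *(1) *(3) by (rule witness_vsum_le[OF B *(2)])
qed

lemma pure_decompD:
  assumes "pure_decomp n \<rho> N p \<Psi>"
  shows "k < N \<Longrightarrow> 0 \<le> p k" "k < N \<Longrightarrow> unit_vec n (\<Psi> k)" "k < N \<Longrightarrow> \<Psi> k \<in> carrier_vec (2 ^ n)" "(\<Sum>k<N. p k) = 1"
    "\<rho> = msum (2 ^ n) N (\<lambda>k. complex_of_real (p k) \<cdot>\<^sub>m outer (\<Psi> k) (\<Psi> k))"
  using assms unfolding pure_decomp_def by (simp_all add: unit_vec_def)

lemma pure_decomp_ge:
  assumes B: "stab_witness n B" and d: "pure_decomp n \<rho> N p \<Psi>"
  shows "Re (sandwich B \<rho>) \<le> (\<Sum>k<N. p k * stab_extent n (\<Psi> k))"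
proof -
  have h: "herm (2 ^ n) B" using B by (simp add: stab_witness_def)
  note D = pure_decompD[OF d]
  have "sandwich B \<rho> = (\<Sum>k<N. complex_of_real (p k) * sandwich B (outer (\<Psi> k) (\<Psi> k)))"
    unfolding D(5) by (rule sandwich_msum[OF herm_carrier[OF h]]) (rule outer_carrier[OF D(3) D(3)])
  also have "\<dots> = (\<Sum>k<N. complex_of_real (p k * norm_sq (B *\<^sub>v \<Psi> k)))"
    by (intro sum.cong refl) (simp add: sandwich_outer_self[OF h D(3)])
  finally have "Re (sandwich B \<rho>) = (\<Sum>k<N. p k * norm_sq (B *\<^sub>v \<Psi> k))" by simp
  also have "\<dots> \<le> (\<Sum>k<N. p k * stab_extent n (\<Psi> k))"
    by (intro sum_mono mult_left_mono stab_extent_ge[OF B]) (use D in auto)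
  finally show ?thesis .
qed

lemma dyadic_ge:
  assumes B: "stab_witness n B" and LR: "\<And>k. k < N \<Longrightarrow> L k \<in> stab_states n" "\<And>k. k < N \<Longrightarrow> R k \<in> stab_states n"
    and \<rho>: "\<rho> = msum (2 ^ n) N (\<lambda>k. \<alpha> k \<cdot>\<^sub>m outer (L k) (R k))"
  shows "Re (sandwich B \<rho>) \<le> (\<Sum>k<N. cmod (\<alpha> k))"
proof -
  have h: "herm (2 ^ n) B" and b: "\<And>\<phi>. \<phi> \<in> stab_states n \<Longrightarrow> norm_sq (B *\<^sub>v \<phi>) \<le> 1"
    using B by (auto simp: stab_witness_def)
  note c = stab_states_carrier[OF LR(1)] stab_states_carrier[OF LR(2)]
  have S: "sandwich B \<rho> = (\<Sum>k<N. \<alpha> k * sandwich B (outer (L k) (R k)))"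
    unfolding \<rho> by (rule sandwich_msum[OF herm_carrier[OF h]]) (rule outer_carrier[OF c])
  have "Re (sandwich B \<rho>) \<le> cmod (sandwich B \<rho>)" by (rule complex_Re_le_cmod)
  also have "\<dots> \<le> (\<Sum>k<N. cmod (\<alpha> k))"
    unfolding S
  proof (rule sum_norm_le)
    fix k assume "k \<in> {..<N}"
    then have "cmod (sandwich B (outer (L k) (R k))) \<le> 1"
      by (intro cmod_sandwich_outer_le[OF h] c b LR) auto
    then show "cmod (\<alpha> k * sandwich B (outer (L k) (R k))) \<le> cmod (\<alpha> k)" by (simp add: norm_mult mult_left_le)
  qed
  finally show ?thesis .
qed

text \<open>The operator inequality gives tr W \<rho> \<le> t tr W \<sigma>, with W the square of
  \<open>B\<close>, and tr W \<sigma> lies between 0 and 1. Replacing it by 1 requires t \<ge> 0,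
  which \<open>pos\<close> supplies.\<close>

lemma robustness_ge:
  assumes B: "stab_witness n B" and \<rho>: "\<rho> \<in> carrier_mat (2 ^ n) (2 ^ n)" and pos: "0 < Re (sandwich B \<rho>)"
    and \<sigma>: "\<sigma> \<in> mixed_stab_states n" and psd: "psd (2 ^ n) (complex_of_real t \<cdot>\<^sub>m \<sigma> - \<rho>)"
  shows "Re (sandwich B \<rho>) \<le> t"
proof -
  have h: "herm (2 ^ n) B" and b: "\<And>\<phi>. \<phi> \<in> stab_states n \<Longrightarrow> norm_sq (B *\<^sub>v \<phi>) \<le> 1"
    using B by (auto simp: stab_witness_def)
  from \<sigma> obtain N p \<phi> where s: "\<sigma> = msum (2 ^ n) N (\<lambda>k. complex_of_real (p k) \<cdot>\<^sub>m outer (\<phi> k) (\<phi> k))"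
    "\<And>k. k < N \<Longrightarrow> 0 \<le> p k" "\<And>k. k < N \<Longrightarrow> \<phi> k \<in> stab_states n" "(\<Sum>k<N. p k) = 1"
    unfolding mixed_stab_states_def by auto
  note c = stab_states_carrier[OF s(3)]
  have \<sigma>c: "\<sigma> \<in> carrier_mat (2 ^ n) (2 ^ n)" unfolding s(1) by simp
  have "sandwich B \<sigma> = (\<Sum>k<N. complex_of_real (p k) * sandwich B (outer (\<phi> k) (\<phi> k)))"
    unfolding s(1) by (rule sandwich_msum[OF herm_carrier[OF h]]) (rule outer_carrier[OF c c])
  also have "\<dots> = (\<Sum>k<N. complex_of_real (p k * norm_sq (B *\<^sub>v \<phi> k)))"
    by (intro sum.cong refl) (simp add: sandwich_outer_self[OF h c])
  finally have S: "Re (sandwich B \<sigma>) = (\<Sum>k<N. p k * norm_sq (B *\<^sub>v \<phi> k))" by simp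
  have "(\<Sum>k<N. p k * norm_sq (B *\<^sub>v \<phi> k)) \<le> (\<Sum>k<N. p k)"
    by (intro sum_mono mult_left_le) (use s(2,3) b in auto)
  then have S1: "Re (sandwich B \<sigma>) \<le> 1" using S s(4) by simp
  have S0: "0 \<le> Re (sandwich B \<sigma>)"
    unfolding S by (intro sum_nonneg mult_nonneg_nonneg) (use s(2) in \<open>auto simp: norm_sq_def sum_nonneg\<close>)
  \<comment> \<open>The difference is a two-term combination indexed by \<open>bool\<close>, to fit
    \<open>sandwich_linear\<close>.\<close>
  have "sandwich B (complex_of_real t \<cdot>\<^sub>m \<sigma> - \<rho>) = (\<Sum>k\<in>{True, False}. (if k then complex_of_real t else -1) * sandwich B (if k then \<sigma> else \<rho>))"
    by (rule sandwich_linear[OF herm_carrier[OF h]]) (use \<sigma>c \<rho> in auto)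
  then have "0 \<le> t * Re (sandwich B \<sigma>) - Re (sandwich B \<rho>)"
    using Re_sandwich_psd[OF h psd] by simp
  then have *: "Re (sandwich B \<rho>) \<le> t * Re (sandwich B \<sigma>)" by simp
  then have "0 < t * Re (sandwich B \<sigma>)" using pos by linarith
  then have "0 \<le> t" using S0 by (simp add: zero_less_mult_iff)
  then have "t * Re (sandwich B \<sigma>) \<le> t" using S1 by (simp add: mult_left_le)
  with * show ?thesis by linarith
qed

section \<open>Upper bounds from a decomposition\<close>

definition qform :: "nat \<Rightarrow> complex vec \<Rightarrow> complex mat \<Rightarrow> complex" where
  "qform d v A = (\<Sum>i<d. \<Sum>j<d. cnj (v $ i) * A $$ (i, j) * v $ j)"

lemma qform_linear:
  assumes "\<And>i j. i < d \<Longrightarrow> j < d \<Longrightarrow> A $$ (i, j) = (\<Sum>k\<in>I. c k * F k $$ (i, j))"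
  shows "qform d v A = (\<Sum>k\<in>I. c k * qform d v (F k))"
proof -
  have "qform d v A = (\<Sum>i<d. \<Sum>j<d. \<Sum>k\<in>I. c k * (cnj (v $ i) * F k $$ (i, j) * v $ j))"
    unfolding qform_def
    by (intro sum.cong refl) (simp add: assms sum_distrib_left sum_distrib_right mult_ac)
  also have "\<dots> = (\<Sum>k\<in>I. \<Sum>i<d. \<Sum>j<d. c k * (cnj (v $ i) * F k $$ (i, j) * v $ j))"
    by (simp only: sum.swap[of _ I])
  finally show ?thesis by (simp add: qform_def sum_distrib_left)
qed

lemma qform_outer:
  assumes "x \<in> carrier_vec d"
  shows "qform d v (outer x x) = complex_of_real ((cmod (\<Sum>i<d. cnj (v $ i) * x $ i))\<^sup>2)"
proof -
  have "qform d v (outer x x) = (\<Sum>i<d. cnj (v $ i) * x $ i) * cnj (\<Sum>i<d. cnj (v $ i) * x $ i)"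
    unfolding qform_def cnj_sum sum_product
    by (intro sum.cong refl) (use assms in \<open>simp add: outer_index[where a = d and b = d] mult_ac\<close>)
  then show ?thesis by (simp only: complex_norm_square)
qed

lemma psdI:
  assumes "A \<in> carrier_mat d d" "\<And>v. v \<in> carrier_vec d \<Longrightarrow> \<exists>x. 0 \<le> x \<and> qform d v A = complex_of_real x"
  shows "psd d A"
  unfolding psd_def Let_def qform_def[symmetric] using assms by fastforce

text \<open>With \<open>a j\<close> the overlap of a test vector with the j-th state, this says that
  the projector onto a superposition is dominated by the l1 norm of its coefficients times the sum
  of the projectors weighted by |c j|.\<close>

lemma weighted_cauchy_schwarz:
  "(cmod (\<Sum>j<M. c j * a j))\<^sup>2 \<le> (\<Sum>j<M. cmod (c j)) * (\<Sum>j<M. cmod (c j) * (cmod (a j))\<^sup>2)"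
proof -
  have "cmod (\<Sum>j<M. c j * a j) \<le> (\<Sum>j<M. sqrt (cmod (c j)) * (sqrt (cmod (c j)) * cmod (a j)))"
    by (rule sum_norm_le) (simp add: norm_mult mult.assoc[symmetric])
  then have "(cmod (\<Sum>j<M. c j * a j))\<^sup>2 \<le> (\<Sum>j<M. sqrt (cmod (c j)) * (sqrt (cmod (c j)) * cmod (a j)))\<^sup>2"
    by (intro power_mono) auto
  also have "\<dots> \<le> (\<Sum>j<M. (sqrt (cmod (c j)))\<^sup>2) * (\<Sum>j<M. (sqrt (cmod (c j)) * cmod (a j))\<^sup>2)"
    by (rule Cauchy_Schwarz_ineq_sum)
  finally show ?thesis by (simp add: power_mult_distrib)
qed

text \<open>A certificate for the upper bound \<open>L\<close> on all three monotones. All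
  components use the same number \<open>M\<close> of terms, so that pairs of indices can be coded by
  quotient and remainder.\<close>

definition magic_decomp :: "nat \<Rightarrow> complex mat \<Rightarrow> real \<Rightarrow> nat \<Rightarrow> nat \<Rightarrow> (nat \<Rightarrow> real) \<Rightarrow> (nat \<Rightarrow> complex vec)
    \<Rightarrow> (nat \<Rightarrow> nat \<Rightarrow> complex) \<Rightarrow> (nat \<Rightarrow> nat \<Rightarrow> complex vec) \<Rightarrow> bool" where
  "magic_decomp n \<rho> L N M p \<Psi> c \<phi> \<longleftrightarrow> pure_decomp n \<rho> N p \<Psi> \<and> (\<forall>k<N. \<forall>j<M. \<phi> k j \<in> stab_states n) \<and>
     (\<forall>k<N. \<Psi> k = vsum (2 ^ n) M (\<lambda>j. c k j \<cdot>\<^sub>v \<phi> k j) \<and> (\<Sum>j<M. cmod (c k j))\<^sup>2 \<le> L)"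

lemma magic_decompD:
  assumes "magic_decomp n \<rho> L N M p \<Psi> c \<phi>"
  shows "pure_decomp n \<rho> N p \<Psi>" "k < N \<Longrightarrow> j < M \<Longrightarrow> \<phi> k j \<in> stab_states n"
    "k < N \<Longrightarrow> \<Psi> k = vsum (2 ^ n) M (\<lambda>j. c k j \<cdot>\<^sub>v \<phi> k j)" "k < N \<Longrightarrow> (\<Sum>j<M. cmod (c k j))\<^sup>2 \<le> L"
  using assms by (auto simp: magic_decomp_def)

lemma magic_decomp_sum_pos:
  assumes D: "magic_decomp n \<rho> L N M p \<Psi> c \<phi>" and k: "k < N"
  shows "0 < (\<Sum>j<M. cmod (c k j))"
proof (rule ccontr)
  assume "\<not> 0 < (\<Sum>j<M. cmod (c k j))"
  moreover have "0 \<le> (\<Sum>j<M. cmod (c k j))" by (simp add: sum_nonneg)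
  ultimately have "(\<Sum>j<M. cmod (c k j)) = 0" by linarith
  then have z: "\<forall>j<M. c k j = 0" by (subst (asm) sum_nonneg_eq_0_iff) auto
  have "\<Psi> k $ i = 0" if "i < 2 ^ n" for i
  proof -
    have "\<Psi> k $ i = (\<Sum>j<M. c k j * \<phi> k j $ i)"
      unfolding magic_decompD(3)[OF D k]
      by (rule vsum_smult_index[OF that]) (rule stab_states_carrier[OF magic_decompD(2)[OF D k]])
    then show ?thesis using z by simp
  qed
  then show False using pure_decompD(2)[OF magic_decompD(1)[OF D] k] by (simp add: unit_vec_def)
qed

lemma magic_decomp_extent:
  assumes D: "magic_decomp n \<rho> L N M p \<Psi> c \<phi>" and k: "k < N"
  shows "stab_extent n (\<Psi> k) \<le> L"
  using stab_extent_le[OF magic_decompD(2)[OF D k] magic_decompD(3)[OF D k]] magic_decompD(4)[OF D k] by linarith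

lemma magic_decomp_extent_sum:
  assumes D: "magic_decomp n \<rho> L N M p \<Psi> c \<phi>"
  shows "(\<Sum>k<N. p k * stab_extent n (\<Psi> k)) \<le> L"
proof -
  note P = pure_decompD[OF magic_decompD(1)[OF D]]
  have "(\<Sum>k<N. p k * stab_extent n (\<Psi> k)) \<le> (\<Sum>k<N. p k * L)"
    by (intro sum_mono mult_left_mono magic_decomp_extent[OF D]) (use P in auto)
  also have "\<dots> = L" using P(4) by (simp flip: sum_distrib_right)
  finally show ?thesis .
qed

lemma sum_div_mod3:
  fixes f :: "nat \<Rightarrow> nat \<Rightarrow> nat \<Rightarrow> 'a::comm_monoid_add"
  shows "(\<Sum>x<N * (M * M'). f (x div (M * M')) (x mod (M * M') div M') (x mod (M * M') mod M'))
    = (\<Sum>k<N. \<Sum>a<M. \<Sum>b<M'. f k a b)"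
  using sum_div_mod[of "\<lambda>k y. f k (y div M') (y mod M')" "M * M'" N] by (simp add: sum_div_mod)

text \<open>Expanding component k into dyads costs \<open>p k\<close> times the squared l1 norm of
  its coefficients, and these costs average to at most \<open>L\<close>.\<close>

lemma magic_decomp_dyadic:
  assumes D: "magic_decomp n \<rho> L N M p \<Psi> c \<phi>"
  shows "\<exists>K \<alpha> S R. (\<forall>k<K. S k \<in> stab_states n \<and> R k \<in> stab_states n) \<and>
    \<rho> = msum (2 ^ n) K (\<lambda>k. \<alpha> k \<cdot>\<^sub>m outer (S k) (R k)) \<and> (\<Sum>k<K. cmod (\<alpha> k)) \<le> L"
proof -
  note P = pure_decompD[OF magic_decompD(1)[OF D]]
  note st = magic_decompD(2)[OF D]
  define K where "K = N * (M * M)"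
  define \<alpha> where "\<alpha> x = (let k = x div (M * M); a = x mod (M * M) div M; b = x mod (M * M) mod M in
     complex_of_real (p k) * (c k a * cnj (c k b)))" for x
  define S where "S x = \<phi> (x div (M * M)) (x mod (M * M) div M)" for x
  define R where "R x = \<phi> (x div (M * M)) (x mod (M * M) mod M)" for x
  have SR: "S x \<in> stab_states n" "R x \<in> stab_states n" if "x < K" for x
    using less_mult_div_mod[OF that[unfolded K_def]] less_mult_div_mod[of "x mod (M * M)" M M]
    by (auto simp: S_def R_def intro!: st)
  have "\<rho> = msum (2 ^ n) K (\<lambda>k. \<alpha> k \<cdot>\<^sub>m outer (S k) (R k))"
  proof (rule eq_matI)
    fix i j assume "i < dim_row (msum (2 ^ n) K (\<lambda>k. \<alpha> k \<cdot>\<^sub>m outer (S k) (R k)))" "j < dim_col (msum (2 ^ n) K (\<lambda>k. \<alpha> k \<cdot>\<^sub>m outer (S k) (R k)))"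
    then have ij: "i < 2 ^ n" "j < 2 ^ n" by (simp_all add: msum_def)
    have "\<rho> $$ (i, j) = (\<Sum>k<N. complex_of_real (p k) * outer (\<Psi> k) (\<Psi> k) $$ (i, j))"
      by (subst P(5)) (rule msum_smult_index[OF ij], rule outer_carrier[OF P(3) P(3)])
    also have "\<dots> = (\<Sum>k<N. complex_of_real (p k) * (\<Sum>a<M. \<Sum>b<M. c k a * cnj (c k b) * outer (\<phi> k a) (\<phi> k b) $$ (i, j)))"
      by (intro sum.cong refl arg_cong2[where f = "(*)"])
        (simp add: magic_decompD(3)[OF D] outer_vsum_index[OF ij stab_states_carrier[OF st]])
    also have "\<dots> = (\<Sum>k<N. \<Sum>a<M. \<Sum>b<M. complex_of_real (p k) * (c k a * cnj (c k b)) * outer (\<phi> k a) (\<phi> k b) $$ (i, j))"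
      by (simp add: sum_distrib_left mult_ac)
    also have "\<dots> = (\<Sum>x<K. \<alpha> x * outer (S x) (R x) $$ (i, j))"
      unfolding K_def \<alpha>_def S_def R_def Let_def by (rule sum_div_mod3[symmetric])
    also have "\<dots> = msum (2 ^ n) K (\<lambda>k. \<alpha> k \<cdot>\<^sub>m outer (S k) (R k)) $$ (i, j)"
      by (rule msum_smult_index[symmetric, OF ij]) (intro outer_carrier stab_states_carrier SR)
    finally show "\<rho> $$ (i, j) = msum (2 ^ n) K (\<lambda>k. \<alpha> k \<cdot>\<^sub>m outer (S k) (R k)) $$ (i, j)" .
  qed (use P(5) in \<open>simp_all add: msum_def\<close>)
  moreover have "(\<Sum>k<K. cmod (\<alpha> k)) \<le> L"
  proof -
    have "(\<Sum>k<K. cmod (\<alpha> k)) = (\<Sum>k<N. \<Sum>a<M. \<Sum>b<M. cmod (complex_of_real (p k) * (c k a * cnj (c k b))))"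
      unfolding K_def \<alpha>_def Let_def by (rule sum_div_mod3)
    also have "\<dots> = (\<Sum>k<N. p k * (\<Sum>a<M. cmod (c k a))\<^sup>2)"
    proof (rule sum.cong[OF refl])
      fix k assume "k \<in> {..<N}"
      then have "(\<Sum>a<M. \<Sum>b<M. cmod (complex_of_real (p k) * (c k a * cnj (c k b))))
          = (\<Sum>a<M. \<Sum>b<M. p k * (cmod (c k a) * cmod (c k b)))" using P(1) by (simp add: norm_mult)
      then show "(\<Sum>a<M. \<Sum>b<M. cmod (complex_of_real (p k) * (c k a * cnj (c k b)))) = p k * (\<Sum>a<M. cmod (c k a))\<^sup>2"
        by (simp only: sum_distrib_left[symmetric] sum_distrib_right[symmetric] power2_eq_square)
    qed
    also have "\<dots> \<le> (\<Sum>k<N. p k * L)"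
      by (intro sum_mono mult_left_mono magic_decompD(4)[OF D]) (use P(1) in auto)
    also have "\<dots> = L" using P(4) by (simp flip: sum_distrib_right)
    finally show ?thesis .
  qed
  ultimately show ?thesis using SR by blast
qed

text \<open>Component k is replaced by the mixture of its stabiliser states with weights |c k j| / C
  k, where C k is the l1 norm. By \<open>weighted_cauchy_schwarz\<close> its projector is at most (C
  k)^2 times that mixture, hence at most \<open>L\<close> times it; averaging over k gives
  \<sigma>.\<close>

lemma magic_decomp_robustness:
  assumes D: "magic_decomp n \<rho> L N M p \<Psi> c \<phi>"
  shows "\<exists>\<sigma>\<in>mixed_stab_states n. psd (2 ^ n) (complex_of_real L \<cdot>\<^sub>m \<sigma> - \<rho>)"
proof -
  note P = pure_decompD[OF magic_decompD(1)[OF D]]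
  note st = magic_decompD(2)[OF D]
  define C where "C k = (\<Sum>j<M. cmod (c k j))" for k
  have C: "0 < C k" "(C k)\<^sup>2 \<le> L" if "k < N" for k
    using magic_decomp_sum_pos[OF D that] magic_decompD(4)[OF D that] by (simp_all add: C_def)
  define w where "w x = p (x div M) * (cmod (c (x div M) (x mod M)) / C (x div M))" for x
  define \<theta> where "\<theta> x = \<phi> (x div M) (x mod M)" for x
  define \<sigma> where "\<sigma> = msum (2 ^ n) (N * M) (\<lambda>x. complex_of_real (w x) \<cdot>\<^sub>m outer (\<theta> x) (\<theta> x))"
  have \<theta>: "\<theta> x \<in> stab_states n" and w: "0 \<le> w x" if "x < N * M" for x
    using less_mult_div_mod[OF that] st P(1) C(1) by (auto simp: \<theta>_def w_def less_imp_le)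
  have "(\<Sum>x<N * M. w x) = (\<Sum>k<N. \<Sum>j<M. p k * (cmod (c k j) / C k))"
    unfolding w_def by (rule sum_div_mod)
  also have "\<dots> = (\<Sum>k<N. p k * (C k / C k))"
    by (simp only: sum_distrib_left[symmetric] sum_divide_distrib[symmetric] C_def)
  also have "\<dots> = (\<Sum>k<N. p k)"
    by (intro sum.cong refl) (use C(1) in \<open>auto simp: less_imp_neq[symmetric]\<close>)
  finally have "(\<Sum>x<N * M. w x) = 1" using P(4) by simp
  then have mem: "\<sigma> \<in> mixed_stab_states n"
    unfolding mixed_stab_states_def \<sigma>_def using \<theta> w by blast
  have \<rho>c: "\<rho> \<in> carrier_mat (2 ^ n) (2 ^ n)" by (subst P(5)) simp
  have "psd (2 ^ n) (complex_of_real L \<cdot>\<^sub>m \<sigma> - \<rho>)"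
  proof (rule psdI)
    show "complex_of_real L \<cdot>\<^sub>m \<sigma> - \<rho> \<in> carrier_mat (2 ^ n) (2 ^ n)" using \<rho>c by (intro minus_carrier_mat)
    fix v :: "complex vec"
    define a where "a k j = (\<Sum>i<2 ^ n. cnj (v $ i) * \<phi> k j $ i)" for k j
    define b where "b k = (\<Sum>i<2 ^ n. cnj (v $ i) * \<Psi> k $ i)" for k
    have ba: "b k = (\<Sum>j<M. c k j * a k j)" if k: "k < N" for k
    proof -
      have "b k = (\<Sum>i<2 ^ n. \<Sum>j<M. c k j * (cnj (v $ i) * \<phi> k j $ i))"
        unfolding b_def magic_decompD(3)[OF D k]
        by (intro sum.cong refl) (simp add: vsum_smult_index[OF _ stab_states_carrier[OF st[OF k]]] sum_distrib_left mult_ac)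
      also have "\<dots> = (\<Sum>j<M. \<Sum>i<2 ^ n. c k j * (cnj (v $ i) * \<phi> k j $ i))" by (rule sum.swap)
      finally show ?thesis by (simp add: a_def sum_distrib_left)
    qed
    have qa: "qform (2 ^ n) v (outer (\<theta> x) (\<theta> x)) = complex_of_real ((cmod (a (x div M) (x mod M)))\<^sup>2)" if "x < N * M" for x
      using qform_outer[OF stab_states_carrier[OF \<theta>[OF that]], of v] by (simp add: a_def \<theta>_def)
    have "qform (2 ^ n) v \<sigma> = (\<Sum>x<N * M. complex_of_real (w x) * qform (2 ^ n) v (outer (\<theta> x) (\<theta> x)))"
      unfolding \<sigma>_def by (rule qform_linear, rule msum_smult_index) (auto intro!: outer_carrier stab_states_carrier \<theta>)
    also have "\<dots> = (\<Sum>x<N * M. complex_of_real (w x * (cmod (a (x div M) (x mod M)))\<^sup>2))"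
      by (intro sum.cong refl) (simp add: qa)
    also have "\<dots> = complex_of_real (\<Sum>x<N * M. w x * (cmod (a (x div M) (x mod M)))\<^sup>2)" by simp
    also have "(\<Sum>x<N * M. w x * (cmod (a (x div M) (x mod M)))\<^sup>2) = (\<Sum>k<N. \<Sum>j<M. p k * (cmod (c k j) / C k) * (cmod (a k j))\<^sup>2)"
      unfolding w_def by (rule sum_div_mod)
    also have "\<dots> = (\<Sum>k<N. p k / C k * (\<Sum>j<M. cmod (c k j) * (cmod (a k j))\<^sup>2))"
      by (simp add: sum_distrib_left mult.assoc)
    finally have 1: "qform (2 ^ n) v \<sigma> = complex_of_real (\<Sum>k<N. p k / C k * (\<Sum>j<M. cmod (c k j) * (cmod (a k j))\<^sup>2))" .
    have "qform (2 ^ n) v \<rho> = (\<Sum>k<N. complex_of_real (p k) * qform (2 ^ n) v (outer (\<Psi> k) (\<Psi> k)))"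
      by (subst P(5), rule qform_linear, rule msum_smult_index) (auto intro!: outer_carrier P(3))
    also have "\<dots> = complex_of_real (\<Sum>k<N. p k * (cmod (b k))\<^sup>2)"
      unfolding of_real_sum by (intro sum.cong refl) (simp add: qform_outer[OF P(3)] b_def)
    finally have 2: "qform (2 ^ n) v \<rho> = complex_of_real (\<Sum>k<N. p k * (cmod (b k))\<^sup>2)" .
    have "qform (2 ^ n) v (complex_of_real L \<cdot>\<^sub>m \<sigma> - \<rho>)
        = (\<Sum>k\<in>{True, False}. (if k then complex_of_real L else -1) * qform (2 ^ n) v (if k then \<sigma> else \<rho>))"
      by (rule qform_linear) (use \<rho>c in \<open>auto simp: \<sigma>_def msum_def\<close>)
    then have 3: "qform (2 ^ n) v (complex_of_real L \<cdot>\<^sub>m \<sigma> - \<rho>) = complex_of_real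
        (L * (\<Sum>k<N. p k / C k * (\<Sum>j<M. cmod (c k j) * (cmod (a k j))\<^sup>2)) - (\<Sum>k<N. p k * (cmod (b k))\<^sup>2))"
      by (simp add: 1 2)
    have "(\<Sum>k<N. p k * (cmod (b k))\<^sup>2) \<le> (\<Sum>k<N. L * (p k / C k * (\<Sum>j<M. cmod (c k j) * (cmod (a k j))\<^sup>2)))"
    proof (rule sum_mono)
      fix k assume "k \<in> {..<N}"
      then have k: "k < N" by simp
      define T where "T = (\<Sum>j<M. cmod (c k j) * (cmod (a k j))\<^sup>2)"
      have T: "0 \<le> T" by (simp add: T_def sum_nonneg)
      have "(cmod (b k))\<^sup>2 \<le> C k * T"
        unfolding ba[OF k] C_def T_def by (rule weighted_cauchy_schwarz)
      also have "\<dots> \<le> L / C k * T"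
        using C[OF k] T by (intro mult_right_mono) (simp_all add: pos_le_divide_eq power2_eq_square)
      finally have "p k * (cmod (b k))\<^sup>2 \<le> p k * (L / C k * T)" using P(1)[OF k] by (rule mult_left_mono)
      then show "p k * (cmod (b k))\<^sup>2 \<le> L * (p k / C k * (\<Sum>j<M. cmod (c k j) * (cmod (a k j))\<^sup>2))"
        by (simp add: T_def mult_ac)
    qed
    then have "0 \<le> L * (\<Sum>k<N. p k / C k * (\<Sum>j<M. cmod (c k j) * (cmod (a k j))\<^sup>2)) - (\<Sum>k<N. p k * (cmod (b k))\<^sup>2)"
      by (simp only: sum_distrib_left[symmetric] diff_ge_0_iff_ge)
    with 3 show "\<exists>x. 0 \<le> x \<and> qform (2 ^ n) v (complex_of_real L \<cdot>\<^sub>m \<sigma> - \<rho>) = complex_of_real x"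
      by (intro exI conjI)
  qed
  with mem show ?thesis by (rule bexI[rotated])
qed

text \<open>Witness and decomposition meet at the same value, so the inequalities between them are
  equalities and the three infima are attained.\<close>

lemma extremal_values:
  assumes B: "stab_witness n B" and L: "L \<le> Re (sandwich B \<rho>)" "0 < L" and D: "magic_decomp n \<rho> L N M p \<Psi> c \<phi>"
  shows "dyadic_negativity n \<rho> = L" "mixed_extent n \<rho> = L" "gen_robustness n \<rho> = L" "equimagical n \<rho>"
proof -
  note P = pure_decompD[OF magic_decompD(1)[OF D]]
  have \<rho>c: "\<rho> \<in> carrier_mat (2 ^ n) (2 ^ n)" by (subst P(5)) simp
  obtain K \<alpha> S R where K: "\<forall>k<K. S k \<in> stab_states n \<and> R k \<in> stab_states n"
    "\<rho> = msum (2 ^ n) K (\<lambda>k. \<alpha> k \<cdot>\<^sub>m outer (S k) (R k))" "(\<Sum>k<K. cmod (\<alpha> k)) \<le> L"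
    using magic_decomp_dyadic[OF D] by metis
  have dy: "L \<le> (\<Sum>k<N. cmod (\<alpha> k))"
    if "\<forall>k<N. S k \<in> stab_states n \<and> R k \<in> stab_states n" "\<rho> = msum (2 ^ n) N (\<lambda>k. \<alpha> k \<cdot>\<^sub>m outer (S k) (R k))"
    for N \<alpha> S R
    using dyadic_ge[OF B _ _ that(2)] that(1) L(1) by fastforce
  have "(\<Sum>k<K. cmod (\<alpha> k)) = L" using dy[OF K(1,2)] K(3) by linarith
  then show "dyadic_negativity n \<rho> = L"
    unfolding dyadic_negativity_def using K(1,2) dy by (intro cInf_eq_minimum) blast+
  have mx: "L \<le> (\<Sum>k<N. p k * stab_extent n (\<Psi> k))" if "pure_decomp n \<rho> N p \<Psi>" for N p \<Psi>
    using pure_decomp_ge[OF B that] L(1) by linarith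
  have sum: "(\<Sum>k<N. p k * stab_extent n (\<Psi> k)) = L"
    using mx[OF magic_decompD(1)[OF D]] magic_decomp_extent_sum[OF D] by linarith
  show me: "mixed_extent n \<rho> = L"
    unfolding mixed_extent_def using magic_decompD(1)[OF D] mx sum by (intro cInf_eq_minimum) blast+
  show "gen_robustness n \<rho> = L"
    unfolding gen_robustness_def
  proof (rule cInf_eq_minimum)
    show "L \<in> {t. \<exists>\<sigma>\<in>mixed_stab_states n. psd (2 ^ n) (complex_of_real t \<cdot>\<^sub>m \<sigma> - \<rho>)}"
      using magic_decomp_robustness[OF D] by simp
    fix t assume "t \<in> {t. \<exists>\<sigma>\<in>mixed_stab_states n. psd (2 ^ n) (complex_of_real t \<cdot>\<^sub>m \<sigma> - \<rho>)}"
    then obtain \<sigma> where "\<sigma> \<in> mixed_stab_states n" "psd (2 ^ n) (complex_of_real t \<cdot>\<^sub>m \<sigma> - \<rho>)" by auto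
    from robustness_ge[OF B \<rho>c _ this] L show "L \<le> t" by linarith
  qed
  have "\<exists>k<N. p k \<noteq> 0" using P(4) by (metis lessThan_iff sum.neutral zero_neq_one)
  then obtain m where m: "m < N" "p m \<noteq> 0" by blast
  text \<open>Components of weight zero carry no information about their extent; replace them by one of positive weight.\<close>
  define \<Phi> where "\<Phi> k = (if p k = 0 then \<Psi> m else \<Psi> k)" for k
  \<comment> \<open>Each extent is at most \<open>L\<close> while the weighted mean equals
    \<open>L\<close>, so no component of positive weight can fall short.\<close>
  have full: "stab_extent n (\<Psi> k) = L" if k: "k < N" "p k \<noteq> 0" for k
  proof -
    have "(\<Sum>k<N. p k * (L - stab_extent n (\<Psi> k))) = 0"
      using sum P(4) by (simp add: right_diff_distrib sum_subtractf flip: sum_distrib_right)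
    moreover have "\<forall>k\<in>{..<N}. 0 \<le> p k * (L - stab_extent n (\<Psi> k))"
      using P(1) magic_decomp_extent[OF D] by simp
    ultimately have "p k * (L - stab_extent n (\<Psi> k)) = 0"
      using sum_nonneg_eq_0_iff[of "{..<N}" "\<lambda>k. p k * (L - stab_extent n (\<Psi> k))"] k(1) by auto
    then show ?thesis using k(2) by simp
  qed
  have ext: "stab_extent n (\<Phi> k) = L" if "k < N" for k using full[OF that] full[OF m] by (simp add: \<Phi>_def)
  have "msum (2 ^ n) N (\<lambda>k. complex_of_real (p k) \<cdot>\<^sub>m outer (\<Phi> k) (\<Phi> k)) = \<rho>"
  proof -
    have \<Phi>c: "\<Phi> k \<in> carrier_vec (2 ^ n)" if "k < N" for k using P(3) that m by (simp add: \<Phi>_def)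
    have "msum (2 ^ n) N (\<lambda>k. complex_of_real (p k) \<cdot>\<^sub>m outer (\<Phi> k) (\<Phi> k)) $$ (i, j) = \<rho> $$ (i, j)"
      if ij: "i < 2 ^ n" "j < 2 ^ n" for i j
    proof -
      have "msum (2 ^ n) N (\<lambda>k. complex_of_real (p k) \<cdot>\<^sub>m outer (\<Phi> k) (\<Phi> k)) $$ (i, j)
          = (\<Sum>k<N. complex_of_real (p k) * outer (\<Phi> k) (\<Phi> k) $$ (i, j))"
        by (rule msum_smult_index[OF ij outer_carrier[OF \<Phi>c \<Phi>c]])
      also have "\<dots> = (\<Sum>k<N. complex_of_real (p k) * outer (\<Psi> k) (\<Psi> k) $$ (i, j))"
        by (intro sum.cong refl) (simp add: \<Phi>_def)
      also have "\<dots> = \<rho> $$ (i, j)"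
        by (subst P(5)) (rule msum_smult_index[symmetric, OF ij outer_carrier[OF P(3) P(3)]])
      finally show ?thesis .
    qed
    then show ?thesis using \<rho>c by (intro eq_matI) (auto simp: msum_def)
  qed
  then have "pure_decomp n \<rho> N p \<Phi>"
    unfolding pure_decomp_def using P(1,2,4) m by (auto simp: \<Phi>_def)
  moreover have "(\<Sum>k<N. p k * stab_extent n (\<Phi> k)) = mixed_extent n \<rho>"
    unfolding me using P(4) by (simp add: ext flip: sum_distrib_right)
  ultimately show "equimagical n \<rho>"
    unfolding equimagical_def using ext by (intro exI[of _ N] exI[of _ p] exI[of _ \<Phi>]) simp
qed

section \<open>Products of single-qubit states\<close>

text \<open>Both certificates for one qubit, with a common value. The stabiliser states are
  \<open>qubit_stab\<close>, so that they can be tensored onto states of the other qubits.\<close>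

definition qubit_value :: "complex mat \<Rightarrow> real \<Rightarrow> bool" where
  "qubit_value \<sigma> l \<longleftrightarrow> 1 \<le> l \<and> \<sigma> \<in> carrier_mat 2 2 \<and>
     (\<exists>B v. qubit_witness B \<and> sandwich B \<sigma> = complex_of_real v \<and> l \<le> v) \<and>
     (\<exists>N p \<Psi> c \<phi>. (\<forall>j<6. qubit_stab (\<phi> j)) \<and> pure_decomp 1 \<sigma> N p \<Psi> \<and>
        (\<forall>k<N. \<Psi> k = vsum 2 6 (\<lambda>j. c k j \<cdot>\<^sub>v \<phi> j) \<and> (\<Sum>j<6. cmod (c k j))\<^sup>2 \<le> l))"

lemma density_qubit_value:
  assumes "density 1 \<sigma>"
  shows "\<exists>l. qubit_value \<sigma> l"
proof -
  obtain r where r: "norm r \<le> 1" "\<sigma> = bloch (1 / 2) ((1 / 2) *\<^sub>R r)" by (rule density_bloch[OF assms])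
  obtain l q w where l: "1 \<le> l" "in_level l q r" "w = 0 \<or> norm w = 1" "l * (1 + linf w) \<le> 1 + inner w r"
    by (rule level_duality)
  obtain N :: nat and p z Q where "\<forall>k<N. 0 \<le> p k \<and> norm (z k) = 1 \<and> in_level l (Q k) (z k)"
    and z45: "(\<Sum>k<N. p k) = 1" "r = (\<Sum>k<N. p k *\<^sub>R z k)"
    by (rule level_pull[OF l(2) r(1) l(1)])
  then have z: "\<And>k. k < N \<Longrightarrow> 0 \<le> p k" "\<And>k. k < N \<Longrightarrow> norm (z k) = 1" "\<And>k. k < N \<Longrightarrow> in_level l (Q k) (z k)"
    by simp_all
  have "\<forall>j. j < 6 \<longrightarrow> (\<exists>x. pure_bloch x (octv j))" using pure_bloch_exists[OF norm_octv] by metis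
  then obtain \<phi> where \<phi>: "\<And>j. j < 6 \<Longrightarrow> pure_bloch (\<phi> j) (octv j)" by metis
  have "\<forall>k. k < N \<longrightarrow> (\<exists>x. pure_bloch x (z k))" using pure_bloch_exists[OF z(2)] by metis
  then obtain \<Psi> where \<Psi>: "\<And>k. k < N \<Longrightarrow> pure_bloch (\<Psi> k) (z k)" by metis
  have "\<forall>k. k < N \<longrightarrow> (\<exists>c. \<Psi> k = vsum 2 6 (\<lambda>j. c j \<cdot>\<^sub>v \<phi> j) \<and> (\<Sum>j<6. cmod (c j))\<^sup>2 \<le> l)"
  proof (intro allI impI)
    fix k assume k: "k < N"
    obtain c where "\<Psi> k = vsum 2 6 (\<lambda>j. c j \<cdot>\<^sub>v \<phi> j)" "(\<Sum>j<6. cmod (c j))\<^sup>2 \<le> l"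
      by (rule level_pure_decomposition[OF \<Psi>[OF k] z(2)[OF k] z(3)[OF k] l(1), of \<phi>]) (rule \<phi>)
    then show "\<exists>c. \<Psi> k = vsum 2 6 (\<lambda>j. c j \<cdot>\<^sub>v \<phi> j) \<and> (\<Sum>j<6. cmod (c j))\<^sup>2 \<le> l" by (intro exI conjI)
  qed
  then obtain c where c: "\<forall>k<N. \<Psi> k = vsum 2 6 (\<lambda>j. c k j \<cdot>\<^sub>v \<phi> j) \<and> (\<Sum>j<6. cmod (c k j))\<^sup>2 \<le> l" by metis
  note \<Psi>c = pure_blochD(1)[OF \<Psi>]
  have entry: "\<sigma> $$ (i, j) = msum 2 N (\<lambda>k. complex_of_real (p k) \<cdot>\<^sub>m outer (\<Psi> k) (\<Psi> k)) $$ (i, j)" if ij: "i < 2" "j < 2" for i j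
  proof -
    have "msum 2 N (\<lambda>k. complex_of_real (p k) \<cdot>\<^sub>m outer (\<Psi> k) (\<Psi> k)) $$ (i, j)
        = (\<Sum>k<N. complex_of_real (p k) * outer (\<Psi> k) (\<Psi> k) $$ (i, j))"
      by (rule msum_smult_index[OF ij outer_carrier[OF \<Psi>c \<Psi>c]])
    also have "\<dots> = (\<Sum>k<N. complex_of_real (p k) * bloch (1 / 2) ((1 / 2) *\<^sub>R z k) $$ (i, j))"
      by (intro sum.cong refl) (use \<Psi> in \<open>simp add: pure_bloch_def\<close>)
    also have "\<dots> = bloch (\<Sum>k<N. p k * (1 / 2)) (\<Sum>k<N. p k *\<^sub>R ((1 / 2) *\<^sub>R z k)) $$ (i, j)"
      by (rule bloch_sum[OF ij])
    also have "(\<Sum>k<N. p k * (1 / 2)) = 1 / 2" unfolding sum_distrib_right[symmetric] z45(1) by simp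
    also have "(\<Sum>k<N. p k *\<^sub>R ((1 / 2) *\<^sub>R z k)) = (1 / 2) *\<^sub>R r"
      unfolding z45(2) scaleR_sum_right by (intro sum.cong refl) simp
    finally show ?thesis unfolding r(2) ..
  qed
  have "\<sigma> = msum 2 N (\<lambda>k. complex_of_real (p k) \<cdot>\<^sub>m outer (\<Psi> k) (\<Psi> k))"
    by (rule mat2_eqI[OF _ msum_carrier entry entry entry entry]) (simp_all add: r(2))
  then have pd: "pure_decomp 1 \<sigma> N p \<Psi>"
    unfolding pure_decomp_def using z(1) z45(1) pure_blochD(3)[OF \<Psi>] by simp
  have "\<forall>j<6. qubit_stab (\<phi> j)" using pure_bloch_qubit_stab[OF \<phi>] by simp
  with pd c have D: "\<exists>N p \<Psi> c \<phi>. (\<forall>j<6. qubit_stab (\<phi> j)) \<and> pure_decomp 1 \<sigma> N p \<Psi> \<and>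
      (\<forall>k<N. \<Psi> k = vsum 2 6 (\<lambda>j. c k j \<cdot>\<^sub>v \<phi> j) \<and> (\<Sum>j<6. cmod (c k j))\<^sup>2 \<le> l)"
    by (intro exI conjI)
  obtain B v where "qubit_witness B" "sandwich B \<sigma> = complex_of_real v" "l \<le> v"
    unfolding r(2) by (rule witness_exists[OF l(3,4)])
  then have W: "\<exists>B v. qubit_witness B \<and> sandwich B \<sigma> = complex_of_real v \<and> l \<le> v" by (intro exI conjI)
  have "\<sigma> \<in> carrier_mat 2 2" unfolding r(2) by simp
  then show ?thesis unfolding qubit_value_def using l(1) W D by (intro exI[of _ l] conjI)
qed

lemma kronv_vsum:
  assumes "\<And>k. k < M \<Longrightarrow> \<phi> k \<in> carrier_vec d" "\<And>k. k < M' \<Longrightarrow> \<phi>' k \<in> carrier_vec d'"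
  shows "kronv (vsum d M (\<lambda>j. c j \<cdot>\<^sub>v \<phi> j)) (vsum d' M' (\<lambda>j. c' j \<cdot>\<^sub>v \<phi>' j))
    = vsum (d * d') (M * M') (\<lambda>j. (c (j div M') * c' (j mod M')) \<cdot>\<^sub>v kronv (\<phi> (j div M')) (\<phi>' (j mod M')))"
proof (rule eq_vecI)
  let ?x = "vsum d M (\<lambda>j. c j \<cdot>\<^sub>v \<phi> j)" and ?y = "vsum d' M' (\<lambda>j. c' j \<cdot>\<^sub>v \<phi>' j)"
  let ?z = "vsum (d * d') (M * M') (\<lambda>j. (c (j div M') * c' (j mod M')) \<cdot>\<^sub>v kronv (\<phi> (j div M')) (\<phi>' (j mod M')))"
  fix i assume "i < dim_vec ?z"
  then have i: "i < d * d'" by (simp add: vsum_def)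
  note di = less_mult_div_mod[OF i]
  have "kronv ?x ?y $ i = ?x $ (i div d') * ?y $ (i mod d')"
    by (rule kronv_index[OF vsum_carrier vsum_carrier i])
  also have "?x $ (i div d') = (\<Sum>j<M. c j * \<phi> j $ (i div d'))" by (rule vsum_smult_index[OF di(1) assms(1)])
  also have "?y $ (i mod d') = (\<Sum>j<M'. c' j * \<phi>' j $ (i mod d'))" by (rule vsum_smult_index[OF di(2) assms(2)])
  also have "(\<Sum>j<M. c j * \<phi> j $ (i div d')) * (\<Sum>j<M'. c' j * \<phi>' j $ (i mod d'))
      = (\<Sum>a<M. \<Sum>b<M'. (c a * c' b) * (\<phi> a $ (i div d') * \<phi>' b $ (i mod d')))"
    unfolding sum_product by (intro sum.cong refl) (simp only: mult_ac)
  also have "\<dots> = (\<Sum>j<M * M'. (c (j div M') * c' (j mod M')) * (\<phi> (j div M') $ (i div d') * \<phi>' (j mod M') $ (i mod d')))"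
    by (rule sum_div_mod[symmetric])
  also have "\<dots> = (\<Sum>j<M * M'. (c (j div M') * c' (j mod M')) * kronv (\<phi> (j div M')) (\<phi>' (j mod M')) $ i)"
  proof (intro sum.cong refl)
    fix j assume "j \<in> {..<M * M'}"
    then have "j < M * M'" by simp
    note dj = less_mult_div_mod[OF this]
    show "c (j div M') * c' (j mod M') * (\<phi> (j div M') $ (i div d') * \<phi>' (j mod M') $ (i mod d'))
       = c (j div M') * c' (j mod M') * kronv (\<phi> (j div M')) (\<phi>' (j mod M')) $ i"
      by (simp only: kronv_index[OF assms(1)[OF dj(1)] assms(2)[OF dj(2)] i])
  qed
  also have "\<dots> = ?z $ i"
    by (rule vsum_smult_index[symmetric, OF i]) (intro kronv_carrier assms less_mult_div_mod)
  finally show "kronv ?x ?y $ i = ?z $ i" .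
qed (simp add: kronv_def vsum_def)

lemma kron_msum:
  assumes "\<And>k. k < N \<Longrightarrow> F k \<in> carrier_mat d d" "\<And>k. k < N' \<Longrightarrow> F' k \<in> carrier_mat d' d'"
  shows "kron (msum d N (\<lambda>k. c k \<cdot>\<^sub>m F k)) (msum d' N' (\<lambda>k. c' k \<cdot>\<^sub>m F' k))
    = msum (d * d') (N * N') (\<lambda>k. (c (k div N') * c' (k mod N')) \<cdot>\<^sub>m kron (F (k div N')) (F' (k mod N')))"
proof (rule eq_matI)
  let ?x = "msum d N (\<lambda>k. c k \<cdot>\<^sub>m F k)" and ?y = "msum d' N' (\<lambda>k. c' k \<cdot>\<^sub>m F' k)"
  let ?z = "msum (d * d') (N * N') (\<lambda>k. (c (k div N') * c' (k mod N')) \<cdot>\<^sub>m kron (F (k div N')) (F' (k mod N')))"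
  fix i j assume "i < dim_row ?z" "j < dim_col ?z"
  then have ij: "i < d * d'" "j < d * d'" by (simp_all add: msum_def)
  note di = less_mult_div_mod[OF ij(1)] less_mult_div_mod[OF ij(2)]
  have "kron ?x ?y $$ (i, j) = ?x $$ (i div d', j div d') * ?y $$ (i mod d', j mod d')"
    by (rule kron_index[OF msum_carrier msum_carrier ij])
  also have "?x $$ (i div d', j div d') = (\<Sum>k<N. c k * F k $$ (i div d', j div d'))"
    by (rule msum_smult_index[OF di(1,3) assms(1)])
  also have "?y $$ (i mod d', j mod d') = (\<Sum>k<N'. c' k * F' k $$ (i mod d', j mod d'))"
    by (rule msum_smult_index[OF di(2,4) assms(2)])
  also have "(\<Sum>k<N. c k * F k $$ (i div d', j div d')) * (\<Sum>k<N'. c' k * F' k $$ (i mod d', j mod d'))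
      = (\<Sum>a<N. \<Sum>b<N'. (c a * c' b) * (F a $$ (i div d', j div d') * F' b $$ (i mod d', j mod d')))"
    unfolding sum_product by (intro sum.cong refl) (simp only: mult_ac)
  also have "\<dots> = (\<Sum>k<N * N'. (c (k div N') * c' (k mod N')) * (F (k div N') $$ (i div d', j div d') * F' (k mod N') $$ (i mod d', j mod d')))"
    by (rule sum_div_mod[symmetric])
  also have "\<dots> = (\<Sum>k<N * N'. (c (k div N') * c' (k mod N')) * kron (F (k div N')) (F' (k mod N')) $$ (i, j))"
  proof (intro sum.cong refl)
    fix k assume "k \<in> {..<N * N'}"
    then have "k < N * N'" by simp
    note dk = less_mult_div_mod[OF this]
    show "c (k div N') * c' (k mod N') * (F (k div N') $$ (i div d', j div d') * F' (k mod N') $$ (i mod d', j mod d'))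
       = c (k div N') * c' (k mod N') * kron (F (k div N')) (F' (k mod N')) $$ (i, j)"
      by (simp only: kron_index[OF assms(1)[OF dk(1)] assms(2)[OF dk(2)] ij])
  qed
  also have "\<dots> = ?z $$ (i, j)"
    by (rule msum_smult_index[symmetric, OF ij]) (intro kron_carrier assms less_mult_div_mod)
  finally show "kron ?x ?y $$ (i, j) = ?z $$ (i, j)" .
qed (simp_all add: kron_def msum_def)

text \<open>The l1 norm of a product family of coefficients is the product of the l1 norms. The
  single qubit stands on the left, as in the recursion of \<open>kron_list\<close>.\<close>

lemma magic_decomp_kron:
  assumes D: "magic_decomp n \<rho> L N' M' p' \<Psi>' c' \<phi>'" and \<phi>: "\<And>j. j < M \<Longrightarrow> qubit_stab (\<phi> j)"
    and d: "pure_decomp 1 \<sigma> N p \<Psi>"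
    and \<Psi>: "\<And>k. k < N \<Longrightarrow> \<Psi> k = vsum 2 M (\<lambda>j. c k j \<cdot>\<^sub>v \<phi> j)" "\<And>k. k < N \<Longrightarrow> (\<Sum>j<M. cmod (c k j))\<^sup>2 \<le> l" and l: "0 \<le> l"
  shows "magic_decomp (Suc n) (kron \<sigma> \<rho>) (l * L) (N * N') (M * M')
    (\<lambda>k. p (k div N') * p' (k mod N')) (\<lambda>k. kronv (\<Psi> (k div N')) (\<Psi>' (k mod N')))
    (\<lambda>k j. c (k div N') (j div M') * c' (k mod N') (j mod M')) (\<lambda>k j. kronv (\<phi> (j div M')) (\<phi>' (k mod N') (j mod M')))"
proof -
  note P = pure_decompD[OF d]
  note P' = pure_decompD[OF magic_decompD(1)[OF D]]
  note st = magic_decompD(2)[OF D]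
  have \<phi>c: "\<phi> j \<in> carrier_vec 2" if "j < M" for j using \<phi>[OF that] by (simp add: qubit_stab_def unit_vec_def)
  have \<Psi>c: "\<Psi> k \<in> carrier_vec 2" if "k < N" for k using P(3)[OF that] by simp
  have "kron \<sigma> \<rho> = kron (msum 2 N (\<lambda>k. complex_of_real (p k) \<cdot>\<^sub>m outer (\<Psi> k) (\<Psi> k)))
      (msum (2 ^ n) N' (\<lambda>k. complex_of_real (p' k) \<cdot>\<^sub>m outer (\<Psi>' k) (\<Psi>' k)))"
    using P(5) P'(5) by simp
  also have "\<dots> = msum (2 * 2 ^ n) (N * N') (\<lambda>k. (complex_of_real (p (k div N')) * complex_of_real (p' (k mod N')))
      \<cdot>\<^sub>m kron (outer (\<Psi> (k div N')) (\<Psi> (k div N'))) (outer (\<Psi>' (k mod N')) (\<Psi>' (k mod N'))))"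
    by (rule kron_msum) (intro outer_carrier \<Psi>c P'(3); assumption)+
  finally have eq: "kron \<sigma> \<rho> = msum (2 ^ Suc n) (N * N') (\<lambda>k. complex_of_real (p (k div N') * p' (k mod N'))
      \<cdot>\<^sub>m outer (kronv (\<Psi> (k div N')) (\<Psi>' (k mod N'))) (kronv (\<Psi> (k div N')) (\<Psi>' (k mod N'))))"
    by (simp only: outer_kronv of_real_mult power_Suc)
  have "(\<Sum>k<N * N'. p (k div N') * p' (k mod N')) = (\<Sum>a<N. \<Sum>b<N'. p a * p' b)" by (rule sum_div_mod)
  also have "\<dots> = 1" using P(4) P'(4) by (simp only: sum_product[symmetric] mult_1)
  finally have "pure_decomp (Suc n) (kron \<sigma> \<rho>) (N * N') (\<lambda>k. p (k div N') * p' (k mod N')) (\<lambda>k. kronv (\<Psi> (k div N')) (\<Psi>' (k mod N')))"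
    unfolding pure_decomp_def using eq P(1) P'(1) unit_vec_kronv[OF P(2) P'(2)] less_mult_div_mod by (intro conjI allI impI) auto
  moreover have "kronv (\<phi> (j div M')) (\<phi>' (k mod N') (j mod M')) \<in> stab_states (Suc n)" if "k < N * N'" "j < M * M'" for k j
    using less_mult_div_mod[OF that(1)] less_mult_div_mod[OF that(2)] by (intro stab_states_kronv \<phi> st)
  moreover have "kronv (\<Psi> (k div N')) (\<Psi>' (k mod N')) = vsum (2 ^ Suc n) (M * M') (\<lambda>j. (c (k div N') (j div M') * c' (k mod N') (j mod M'))
      \<cdot>\<^sub>v kronv (\<phi> (j div M')) (\<phi>' (k mod N') (j mod M')))" if "k < N * N'" for k
  proof -
    note dk = less_mult_div_mod[OF that]
    show ?thesis unfolding \<Psi>(1)[OF dk(1)] magic_decompD(3)[OF D dk(2)] power_Suc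
      by (rule kronv_vsum) (rule \<phi>c, assumption, rule stab_states_carrier[OF st[OF dk(2)]], assumption)
  qed
  moreover have "(\<Sum>j<M * M'. cmod (c (k div N') (j div M') * c' (k mod N') (j mod M')))\<^sup>2 \<le> l * L" if "k < N * N'" for k
  proof -
    note dk = less_mult_div_mod[OF that]
    have "(\<Sum>j<M * M'. cmod (c (k div N') (j div M') * c' (k mod N') (j mod M'))) = (\<Sum>a<M. \<Sum>b<M'. cmod (c (k div N') a * c' (k mod N') b))"
      by (rule sum_div_mod)
    also have "\<dots> = (\<Sum>a<M. cmod (c (k div N') a)) * (\<Sum>b<M'. cmod (c' (k mod N') b))"
      by (simp only: norm_mult sum_product)
    finally show ?thesis
      using mult_mono[OF \<Psi>(2)[OF dk(1)] magic_decompD(4)[OF D dk(2)] l zero_le_power2] by (simp only: power_mult_distrib)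
  qed
  ultimately show ?thesis unfolding magic_decomp_def by (intro conjI allI impI)
qed

lemma magic_decomp_nil:
  "magic_decomp 0 (1\<^sub>m 1) 1 1 1 (\<lambda>_. 1) (\<lambda>_. vec 1 (\<lambda>_. 1)) (\<lambda>_ _. 1) (\<lambda>_ _. vec 1 (\<lambda>_. 1))"
proof -
  have "unit_vec 0 (vec 1 (\<lambda>_. 1))" using stab_states_0 by (simp add: stab_states_def)
  moreover have "1\<^sub>m 1 = msum (2 ^ 0) 1 (\<lambda>k. complex_of_real 1 \<cdot>\<^sub>m outer (vec 1 (\<lambda>_. 1)) (vec 1 (\<lambda>_. 1)))"
    by (intro eq_matI) (auto simp: msum_def outer_def)
  moreover have "vec 1 (\<lambda>_. 1) = vsum (2 ^ 0) 1 (\<lambda>j. (1::complex) \<cdot>\<^sub>v vec 1 (\<lambda>_. 1))"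
    by (intro eq_vecI) (auto simp: vsum_def)
  ultimately show ?thesis using stab_states_0 unfolding magic_decomp_def pure_decomp_def by simp
qed

text \<open>Witness values and squared l1 norms are both multiplicative, so the two certificates
  keep meeting at the product. The bound by 1 from below is carried along because the inequalities
  are multiplied.\<close>

lemma kron_list_decomp:
  assumes "list_all2 qubit_value \<sigma>s ls"
  shows "1 \<le> prod_list ls \<and> kron_list \<sigma>s \<in> carrier_mat (2 ^ length \<sigma>s) (2 ^ length \<sigma>s) \<and>
    (\<exists>Bs v. length Bs = length \<sigma>s \<and> (\<forall>B\<in>set Bs. qubit_witness B) \<and>
      sandwich (kron_list Bs) (kron_list \<sigma>s) = complex_of_real v \<and> prod_list ls \<le> v) \<and>
    (\<exists>N M p \<Psi> c \<phi>. magic_decomp (length \<sigma>s) (kron_list \<sigma>s) (prod_list ls) N M p \<Psi> c \<phi>)"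
  using assms
proof (induction rule: list_all2_induct)
  case Nil
  have "sandwich (kron_list []) (kron_list []) = complex_of_real 1" by (simp add: sandwich_def mtrace_def)
  moreover have "\<exists>N M p \<Psi> c \<phi>. magic_decomp (length []) (kron_list []) (prod_list []) N M p \<Psi> c \<phi>"
    using magic_decomp_nil by (simp only: list.size kron_list_simps prod_list.Nil) (intro exI)
  ultimately show ?case by (intro conjI exI[of _ "[]"] exI[of _ "1::real"]) simp_all
next
  case (Cons \<sigma> \<sigma>s l ls)
  note q = Cons(1)[unfolded qubit_value_def]
  note l = conjunct1[OF q] conjunct1[OF conjunct2[OF q]]
  obtain B v where B: "qubit_witness B" "sandwich B \<sigma> = complex_of_real v" "l \<le> v"
    using conjunct1[OF conjunct2[OF conjunct2[OF q]]] by (elim exE conjE) (rule that)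
  obtain N p \<Psi> c \<phi> where d: "\<forall>j<6. qubit_stab (\<phi> j)" "pure_decomp 1 \<sigma> N p \<Psi>"
    "\<forall>k<N. \<Psi> k = vsum 2 6 (\<lambda>j. c k j \<cdot>\<^sub>v \<phi> j) \<and> (\<Sum>j<6. cmod (c k j))\<^sup>2 \<le> l"
    using conjunct2[OF conjunct2[OF conjunct2[OF q]]] by (elim exE conjE) (rule that)
  note L = conjunct1[OF Cons.IH] and c = conjunct1[OF conjunct2[OF Cons.IH]]
  obtain Bs v' where Bs: "length Bs = length \<sigma>s" "\<forall>B\<in>set Bs. qubit_witness B"
      "sandwich (kron_list Bs) (kron_list \<sigma>s) = complex_of_real v'" "prod_list ls \<le> v'"
    using conjunct1[OF conjunct2[OF conjunct2[OF Cons.IH]]] by (elim exE conjE) (rule that)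
  obtain N' M' p' \<Psi>' c' \<phi>' where D: "magic_decomp (length \<sigma>s) (kron_list \<sigma>s) (prod_list ls) N' M' p' \<Psi>' c' \<phi>'"
    using conjunct2[OF conjunct2[OF conjunct2[OF Cons.IH]]] by (elim exE) (rule that)
  have "1 * 1 \<le> l * prod_list ls" using l(1) L by (intro mult_mono) auto
  moreover have "kron \<sigma> (kron_list \<sigma>s) \<in> carrier_mat (2 ^ length (\<sigma> # \<sigma>s)) (2 ^ length (\<sigma> # \<sigma>s))"
    using kron_carrier[OF l(2) c] by simp
  moreover have "sandwich (kron_list (B # Bs)) (kron_list (\<sigma> # \<sigma>s)) = complex_of_real (v * v')"
  proof -
    have "B \<in> carrier_mat 2 2" using herm_carrier[OF qubit_witness_herm[OF B(1)]] .
    moreover have "kron_list Bs \<in> carrier_mat (2 ^ length \<sigma>s) (2 ^ length \<sigma>s)"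
      using kron_list_carrier[of Bs] herm_carrier[OF qubit_witness_herm] Bs(1,2) by auto
    ultimately show ?thesis using sandwich_kron[OF _ l(2) _ c, of B "kron_list Bs"] by (simp add: B(2) Bs(3))
  qed
  moreover have "l * prod_list ls \<le> v * v'" using B(3) Bs(4) l(1) L by (intro mult_mono) auto
  moreover have "\<exists>N M p \<Psi> c \<phi>. magic_decomp (Suc (length \<sigma>s)) (kron \<sigma> (kron_list \<sigma>s)) (l * prod_list ls) N M p \<Psi> c \<phi>"
    by (intro exI, rule magic_decomp_kron[OF D, of 6 \<phi> \<sigma> N p \<Psi> c l]) (use d l(1) in simp_all)
  ultimately show ?case using B(1) Bs(1,2)
    by (intro conjI exI[of _ "B # Bs"] exI[of _ "v * v'"]) simp_all
qed

lemma kron_list_values: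
  assumes "list_all2 qubit_value \<sigma>s ls"
  shows "dyadic_negativity (length \<sigma>s) (kron_list \<sigma>s) = prod_list ls" "mixed_extent (length \<sigma>s) (kron_list \<sigma>s) = prod_list ls"
    "gen_robustness (length \<sigma>s) (kron_list \<sigma>s) = prod_list ls" "equimagical (length \<sigma>s) (kron_list \<sigma>s)"
proof -
  obtain Bs v N M p \<Psi> c \<phi> where L: "1 \<le> prod_list ls" and Bs: "length Bs = length \<sigma>s" "\<forall>B\<in>set Bs. qubit_witness B"
    and v: "sandwich (kron_list Bs) (kron_list \<sigma>s) = complex_of_real v" "prod_list ls \<le> v"
    and D: "magic_decomp (length \<sigma>s) (kron_list \<sigma>s) (prod_list ls) N M p \<Psi> c \<phi>"
    using kron_list_decomp[OF assms] by (elim exE conjE) (rule that)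
  have "herm (2 ^ length \<sigma>s) (kron_list Bs)"
    using herm_kron_list[of Bs] qubit_witness_herm Bs by auto
  then have W: "stab_witness (length \<sigma>s) (kron_list Bs)"
    unfolding stab_witness_def using witness_norm_sq_le_1[OF _ Bs(1)] Bs(2) by simp
  have "prod_list ls \<le> Re (sandwich (kron_list Bs) (kron_list \<sigma>s))" "0 < prod_list ls" using v L by simp_all
  from extremal_values[OF W this D] show "dyadic_negativity (length \<sigma>s) (kron_list \<sigma>s) = prod_list ls"
    "mixed_extent (length \<sigma>s) (kron_list \<sigma>s) = prod_list ls"
    "gen_robustness (length \<sigma>s) (kron_list \<sigma>s) = prod_list ls" "equimagical (length \<sigma>s) (kron_list \<sigma>s)" .
qed

text \<open>The list with one element identifies the abstract value \<open>l\<close> with the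
  generalized robustness.\<close>

lemma qubit_value_robustness:
  assumes "qubit_value \<sigma> l"
  shows "gen_robustness 1 \<sigma> = l"
  using kron_list_values(3)[of "[\<sigma>]" "[l]"] assms by (simp add: kron_one_right[unfolded One_nat_def])

theorem theorem5:
  fixes \<sigma>s :: "complex mat list"
  assumes "\<forall>\<sigma>\<in>set \<sigma>s. density 1 \<sigma>"
  shows "dyadic_negativity (length \<sigma>s) (kron_list \<sigma>s) = mixed_extent (length \<sigma>s) (kron_list \<sigma>s)
    \<and> mixed_extent (length \<sigma>s) (kron_list \<sigma>s) = gen_robustness (length \<sigma>s) (kron_list \<sigma>s)
    \<and> gen_robustness (length \<sigma>s) (kron_list \<sigma>s) = (\<Prod>\<sigma>\<leftarrow>\<sigma>s. gen_robustness 1 \<sigma>)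
    \<and> equimagical (length \<sigma>s) (kron_list \<sigma>s)"
proof -
  have "qubit_value \<sigma> (gen_robustness 1 \<sigma>)" if "\<sigma> \<in> set \<sigma>s" for \<sigma>
    using density_qubit_value[of \<sigma>] qubit_value_robustness assms that by metis
  then have "list_all2 qubit_value \<sigma>s (map (gen_robustness 1) \<sigma>s)"
    by (simp add: list_all2_conv_all_nth)
  from kron_list_values[OF this] show ?thesis by simp
qed

end
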